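(* For an elasticity tensor $\mathbf{E}=(\operatorname{tr}\mathbf{d},\operatorname{tr}\mathbf{v},\mathbf{d}',\mathbf{v}',\mathbf{H})\in\mathbb{E}\mathrm{la}$ let $$\mathbf{k}_4:=\left(\|\mathbf{d}'\|^2\,\mathbf{d}'^2+\|\mathbf{v}'\|^2\,\mathbf{v}'^2+\mathbf{d}_2'^2\right)'$$ and $$K_1:=\operatorname{tr}\mathbf{d},\quad L_1:=\operatorname{tr}\mathbf{v},\quad I_3:=\operatorname{tr}\mathbf{d}_3,\quad K_4:=\|\mathbf{d}'\|^4+\|\mathbf{v}'\|^4+\|\mathbf{d}_2'\|^2,$$ $$K_5:=\mathbf{d}:\mathbf{k}_4,\quad L_5:=\mathbf{v}:\mathbf{k}_4,\quad K_9:=\mathbf{k}_4:\mathbf{H}:\mathbf{k}_4,\quad K_{10}:=\|\operatorname{tr}(\mathbf{H}\times\mathbf{k}_4)\|^2.$$ Then, under the action of $\mathrm{SO}(3)$: (1) A minimal functional basis for $\Sigma_{[\mathrm{SO}(3)]}\cup\Sigma_{[\mathbb{O}]}\cup\Sigma_{[\mathrm{O}(2)]}\cup\Sigma_{[\mathbb{D}_4]}$ (i.e. at least tetragonal elasticity tensors) consists of the seven polynomial invariants $K_1,L_1,I_3,K_4,K_5,L_5,K_9$. (2) A minimal functional basis for $\Sigma_{[\mathrm{SO}(3)]}\cup\Sigma_{[\mathbb{O}]}\cup\Sigma_{[\mathrm{O}(2)]}\cup\Sigma_{[\mathbb{D}_3]}$ (i.e. at least trigonal elasticity tensors) consists of the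 seven polynomial invariants $K_1,L_1,I_3,K_4,K_5,L_5,K_9$. (3) A minimal functional basis for $\Sigma_{[\mathrm{SO}(3)]}\cup\Sigma_{[\mathbb{O}]}\cup\Sigma_{[\mathrm{O}(2)]}\cup\Sigma_{[\mathbb{D}_3]}\cup\Sigma_{[\mathbb{D}_4]}$ (i.e. at least tetragonal or trigonal elasticity tensors) consists of the eight polynomial invariants $K_1,L_1,I_3,K_4,K_5,L_5,K_9,K_{10}$.
   Context: Tensors are on Euclidean $\mathbb{R}^3$, with components in an orthonormal basis $(e_i)$ and summation over repeated indices; $\mathbf{q}=(\delta_{ij})$ is the Euclidean metric. $\mathrm{SO}(3)$ acts on $n$th-order tensors by $(g\star \mathbf{T})_{i_1\dots i_n}=g_{i_1j_1}\cdots g_{i_nj_n}T_{j_1\dots j_n}$. $\mathbb{E}\mathrm{la}=\{\mathbf{E}\in\otimes^4(\mathbb{R}^3):E_{ijkl}=E_{klij}=E_{jikl}\}$ is the 21-dimensional space of elasticity tensors. $\mathbf{T}^s$ denotes the total symmetrization and $\mathbf{S}_1\odot\mathbf{S}_2:=(\mathbf{S}_1\otimes\mathbf{S}_2)^s$. For symmetric second-order tensors: $\mathbf{a}'=\mathbf{a}-\frac13(\operatorname{tr}\mathbf{a})\mathbf{q}$ (deviatoric part), $\mathbf{a}'^2=(\mathbf{a}')^2$ is the matrix square, $\mathbf{a}:\mathbf{b}=a_{ij}b_{ij}$, and $\mathbf{a}:\mathbf{H}:\mathbf{b}=a_{ij}H_{ijkl}b_{kl}$. For a tensor of any order, $\|\mathbf{T}\|^2$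 is the sum of the squares of its components. Generalized cross product: for totally symmetric tensors $\mathbf{S}_1,\mathbf{S}_2$ of orders $n_1,n_2$, $\mathbf{S}_1\times\mathbf{S}_2:=(\mathbf{S}_2\cdot\boldsymbol{\varepsilon}\cdot\mathbf{S}_1)^s$, a totally symmetric tensor of order $n_1+n_2-1$, where $\boldsymbol{\varepsilon}$ is the Levi-Civita tensor and $\cdot$ is contraction over one index, i.e. the total symmetrization of $(\mathbf{S}_2)_{i_1\dots i_{n_2-1}p}\,\varepsilon_{pkr}\,(\mathbf{S}_1)_{rj_1\dots j_{n_1-1}}$. Thus $\mathbf{H}\times\mathbf{k}_4$ is a totally symmetric tensor of order 5, and its trace $\operatorname{tr}$ (contraction of any two indices) is a totally symmetric tensor of order 3. Harmonic decomposition: for $\mathbf{E}\in\mathbb{E}\mathrm{la}$, $d_{ij}=E_{kkij}$, $v_{ij}=E_{kikj}$, $\mathbf{a}=\frac27(\mathbf{d}+2\mathbf{v})$ and $\mathbf{H}=\mathbf{E}^s-\mathbf{q}\odot\mathbf{a}'-\frac{7}{30}(\operatorname{tr}\mathbf{a})\,\mathbf{q}\odot\mathbf{q}$, which is a totally symmetric traceless fourth-order tensor. The tensor $\mathbf{E}$ is identified with the tuple $(\operatorname{tr}\mathbf{d},\operatorname{tr}\mathbf{v},\mathbf{d}',\mathbf{v}',\mathbf{H})$ (an $\mathrm{SO}(3)$-equivariant linear isomorphism). Also $(\mathbf{d}_2)_{ij}=H_{ipqr}H_{pqrj}$ and $(\mathbf{d}_3)_{ij}=H_{ikpq}H_{pqrs}H_{rskj}$.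 Strata: for a subgroup $K$ of $\mathrm{SO}(3)$, $\Sigma_{[K]}\subset\mathbb{E}\mathrm{la}$ is the set of tensors whose symmetry group $\{g\in\mathrm{SO}(3):g\star\mathbf{E}=\mathbf{E}\}$ is conjugate to $K$ in $\mathrm{SO}(3)$. $\mathbb{D}_n$ ($n=3,4$) is the subgroup of order $2n$ generated by the rotation by $2\pi/n$ about $e_3$ and the rotation by $\pi$ about $e_1$; $\mathrm{O}(2)$ is generated by all rotations about $e_3$ and the rotation by $\pi$ about $e_1$; $\mathbb{O}$ is the octahedral group (the 24 rotations preserving the cube with vertices $(\pm1,\pm1,\pm1)$). Functional basis: a finite set $\{\varphi_1,\dots,\varphi_s\}$ of $\mathrm{SO}(3)$-invariant real functions on an $\mathrm{SO}(3)$-stable set $X$ is a functional basis for $X$ if for every $\mathrm{SO}(3)$-invariant function $f:X\to\mathbb{R}$ there is a function $F:\mathbb{R}^s\to\mathbb{R}$ (no regularity required) with $f(x)=F(\varphi_1(x),\dots,\varphi_s(x))$ for all $x\in X$. It is minimal if no proper subset of it is a functional basis for $X$. *)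

theory Defs
  imports
    "HOL-Analysis.Analysis"
    "HOL-Algebra.Generated_Groups"
    "HOL-Combinatorics.Permutations"
begin

text \<open>
  Second- and fourth-order tensors on Euclidean 3-space are given by their components in the
  standard basis. On these types \<open>\<bullet>\<close> and \<open>norm\<close> are the componentwise inner product and the
  root of the sum of the squared components, so \<open>a \<bullet> b\<close> is the double contraction of \<open>a\<close> and \<open>b\<close>.
  Basis indices have type \<open>3\<close>, where the numeral \<open>3\<close> equals \<open>0\<close>.
\<close>

type_synonym tensor2 = "real^3^3"
type_synonym tensor3 = "real^3^3^3"
type_synonym tensor4 = "real^3^3^3^3"

text \<open>
  Operations whose result depends on the order act on component functions \<open>3 list \<Rightarrow> real\<close>; a
  tensor of order \<open>n\<close> is represented by such a function, only its values on lists of length \<open>n\<close>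
  being meaningful.
\<close>

definition comps2 :: "tensor2 \<Rightarrow> 3 list \<Rightarrow> real" where
  "comps2 a is = a $ (is!0) $ (is!1)"

definition comps4 :: "tensor4 \<Rightarrow> 3 list \<Rightarrow> real" where
  "comps4 T is = T $ (is!0) $ (is!1) $ (is!2) $ (is!3)"

definition symmetrization :: "(3 list \<Rightarrow> real) \<Rightarrow> 3 list \<Rightarrow> real" where
  "symmetrization T is =
     (\<Sum>\<sigma> | \<sigma> permutes {..<length is}. T (permute_list \<sigma> is)) / fact (length is)"

definition levi_civita :: "3 \<Rightarrow> 3 \<Rightarrow> 3 \<Rightarrow> real" where
  "levi_civita i j k =
     (if (i, j, k) \<in> {(1, 2, 3), (2, 3, 1), (3, 1, 2)} then 1
      else if (i, j, k) \<in> {(3, 2, 1), (2, 1, 3), (1, 3, 2)} then -1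
      else 0)"

text \<open>
  Generalized cross product of \<open>S\<^sub>1\<close> and \<open>S\<^sub>2\<close>, where \<open>n\<^sub>2\<close> is the order of \<open>S\<^sub>2\<close>. In an index list
  \<open>is\<close>, the first \<open>n\<^sub>2 - 1\<close> entries are the free indices of \<open>S\<^sub>2\<close>, the next one is the free index
  of the Levi-Civita tensor, and the rest are the free indices of \<open>S\<^sub>1\<close>.
\<close>

definition gen_cross :: "nat \<Rightarrow> (3 list \<Rightarrow> real) \<Rightarrow> (3 list \<Rightarrow> real) \<Rightarrow> 3 list \<Rightarrow> real" where
  "gen_cross n\<^sub>2 S\<^sub>1 S\<^sub>2 = symmetrization (\<lambda>is. \<Sum>p\<in>UNIV. \<Sum>r\<in>UNIV.
     S\<^sub>2 (take (n\<^sub>2 - 1) is @ [p]) * levi_civita p (is ! (n\<^sub>2 - 1)) r * S\<^sub>1 (r # drop n\<^sub>2 is))"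

definition contract :: "(3 list \<Rightarrow> real) \<Rightarrow> 3 list \<Rightarrow> real" where
  "contract T is = (\<Sum>p\<in>UNIV. T (p # p # is))"

definition total_sym4 :: "tensor4 \<Rightarrow> tensor4" where
  "total_sym4 T = (\<chi> i j k l. symmetrization (comps4 T) [i, j, k, l])"

definition sym_prod :: "tensor2 \<Rightarrow> tensor2 \<Rightarrow> tensor4" where
  "sym_prod a b = total_sym4 (\<chi> i j k l. a$i$j * b$k$l)"

definition dev :: "tensor2 \<Rightarrow> tensor2" where
  "dev a = a - (trace a / 3) *\<^sub>R mat 1"


definition Ela :: "tensor4 set" where
  "Ela = {E. \<forall>i j k l. E$i$j$k$l = E$k$l$i$j \<and> E$i$j$k$l = E$j$i$k$l}"

definition SO3 :: "tensor2 monoid" where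
  "SO3 = \<lparr>carrier = {g. rotation_matrix g}, mult = (**), one = mat 1\<rparr>"

definition act :: "tensor2 \<Rightarrow> tensor4 \<Rightarrow> tensor4" where
  "act g T = (\<chi> i j k l. \<Sum>p\<in>UNIV. \<Sum>q\<in>UNIV. \<Sum>r\<in>UNIV. \<Sum>s\<in>UNIV.
     g$i$p * g$j$q * g$k$r * g$l$s * T$p$q$r$s)"

definition symmetry_group :: "tensor4 \<Rightarrow> tensor2 set" where
  "symmetry_group E = {g \<in> carrier SO3. act g E = E}"

text \<open>The transpose of a rotation matrix is its inverse.\<close>

definition stratum :: "tensor2 set \<Rightarrow> tensor4 set" where
  "stratum K =
     {E \<in> Ela. \<exists>g \<in> carrier SO3. symmetry_group E = (\<lambda>h. g ** h ** transpose g) ` K}"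

definition rot_e1 :: "real \<Rightarrow> tensor2" where
  "rot_e1 t = vector [vector [1, 0, 0],
                      vector [0, cos t, - sin t],
                      vector [0, sin t, cos t]]"

definition rot_e3 :: "real \<Rightarrow> tensor2" where
  "rot_e3 t = vector [vector [cos t, - sin t, 0],
                      vector [sin t, cos t, 0],
                      vector [0, 0, 1]]"

definition dihedral :: "nat \<Rightarrow> tensor2 set" where
  "dihedral n = generate SO3 {rot_e3 (2 * pi / n), rot_e1 pi}"

definition O2 :: "tensor2 set" where
  "O2 = generate SO3 (insert (rot_e1 pi) (range rot_e3))"

definition octahedral :: "tensor2 set" where
  "octahedral = (let cube = {x :: real^3. \<forall>i. \<bar>x$i\<bar> \<le> 1}
                 in {g \<in> carrier SO3. (\<lambda>x. g *v x) ` cube = cube})"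


definition d_of :: "tensor4 \<Rightarrow> tensor2" where
  "d_of E = (\<chi> i j. \<Sum>k\<in>UNIV. E$k$k$i$j)"

definition v_of :: "tensor4 \<Rightarrow> tensor2" where
  "v_of E = (\<chi> i j. \<Sum>k\<in>UNIV. E$k$i$k$j)"

definition a_of :: "tensor4 \<Rightarrow> tensor2" where
  "a_of E = (2/7) *\<^sub>R (d_of E + 2 *\<^sub>R v_of E)"

definition H_of :: "tensor4 \<Rightarrow> tensor4" where
  "H_of E = total_sym4 E - sym_prod (mat 1) (dev (a_of E))
     - (7/30 * trace (a_of E)) *\<^sub>R sym_prod (mat 1) (mat 1)"

definition d2_of :: "tensor4 \<Rightarrow> tensor2" where
  "d2_of E = (let H = H_of E in
     \<chi> i j. \<Sum>p\<in>UNIV. \<Sum>q\<in>UNIV. \<Sum>r\<in>UNIV. H$i$p$q$r * H$p$q$r$j)"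

definition d3_of :: "tensor4 \<Rightarrow> tensor2" where
  "d3_of E = (let H = H_of E in
     \<chi> i j. \<Sum>k\<in>UNIV. \<Sum>p\<in>UNIV. \<Sum>q\<in>UNIV. \<Sum>r\<in>UNIV. \<Sum>s\<in>UNIV.
       H$i$k$p$q * H$p$q$r$s * H$r$s$k$j)"

definition k4_of :: "tensor4 \<Rightarrow> tensor2" where
  "k4_of E = (let d' = dev (d_of E); v' = dev (v_of E); d2' = dev (d2_of E) in
     dev ((norm d')\<^sup>2 *\<^sub>R (d' ** d') + (norm v')\<^sup>2 *\<^sub>R (v' ** v') + d2' ** d2'))"

definition K1 :: "tensor4 \<Rightarrow> real" where
  "K1 E = trace (d_of E)"

definition L1 :: "tensor4 \<Rightarrow> real" where
  "L1 E = trace (v_of E)"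

definition I3 :: "tensor4 \<Rightarrow> real" where
  "I3 E = trace (d3_of E)"

definition K4 :: "tensor4 \<Rightarrow> real" where
  "K4 E = norm (dev (d_of E)) ^ 4 + norm (dev (v_of E)) ^ 4 + (norm (dev (d2_of E)))\<^sup>2"

definition K5 :: "tensor4 \<Rightarrow> real" where
  "K5 E = d_of E \<bullet> k4_of E"

definition L5 :: "tensor4 \<Rightarrow> real" where
  "L5 E = v_of E \<bullet> k4_of E"

definition K9 :: "tensor4 \<Rightarrow> real" where
  "K9 E = (\<Sum>i\<in>UNIV. \<Sum>j\<in>UNIV. \<Sum>k\<in>UNIV. \<Sum>l\<in>UNIV.
     k4_of E$i$j * H_of E$i$j$k$l * k4_of E$k$l)"

definition K10 :: "tensor4 \<Rightarrow> real" where
  "K10 E = (norm (\<chi> i j k.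
     contract (gen_cross 2 (comps4 (H_of E)) (comps2 (k4_of E))) [i, j, k] :: tensor3))\<^sup>2"


definition SO3_stable :: "tensor4 set \<Rightarrow> bool" where
  "SO3_stable X \<longleftrightarrow> (\<forall>g \<in> carrier SO3. \<forall>x \<in> X. act g x \<in> X)"

text \<open>A real function on \<open>X\<close> is a total function considered only through its values on \<open>X\<close>.\<close>

definition SO3_invariant :: "tensor4 set \<Rightarrow> (tensor4 \<Rightarrow> real) \<Rightarrow> bool" where
  "SO3_invariant X f \<longleftrightarrow> (\<forall>g \<in> carrier SO3. \<forall>x \<in> X. f (act g x) = f x)"

text \<open>
  A finite set of functions is given by a list enumerating it; \<open>F\<close> is a function on lists of
  \<open>length \<phi>s\<close> reals.
\<close>

definition functional_basis :: "tensor4 set \<Rightarrow> (tensor4 \<Rightarrow> real) list \<Rightarrow> bool" where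
  "functional_basis X \<phi>s \<longleftrightarrow>
     SO3_stable X \<and>
     (\<forall>\<phi> \<in> set \<phi>s. SO3_invariant X \<phi>) \<and>
     (\<forall>f. SO3_invariant X f \<longrightarrow>
        (\<exists>F :: real list \<Rightarrow> real. \<forall>x \<in> X. f x = F (map (\<lambda>\<phi>. \<phi> x) \<phi>s)))"

definition minimal_functional_basis :: "tensor4 set \<Rightarrow> (tensor4 \<Rightarrow> real) list \<Rightarrow> bool" where
  "minimal_functional_basis X \<phi>s \<longleftrightarrow>
     distinct \<phi>s \<and>
     functional_basis X \<phi>s \<and>
     (\<forall>\<psi>s. set \<psi>s \<subset> set \<phi>s \<longrightarrow> \<not> functional_basis X \<psi>s)"

end

theory Submission
  imports Defs
begin

text \<open>
  Every tensor in the unions of strata considered here can be rotated so that it is fixed by the dihedral group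
  \<open>D\<^sub>4\<close> or \<open>D\<^sub>3\<close> about the third axis. Linear algebra then gives a normal form with six parameters: \<open>d\<close> and
  \<open>v\<close> are determined by their traces \<open>k\<close>, \<open>l\<close> and by the multiples \<open>\<delta>\<close>, \<open>\<nu>\<close> of \<open>t = diag (1, 1, -2)\<close> in their
  deviators, and \<open>H = \<alpha> zonal + \<beta> B\<close>, where \<open>B\<close> is the harmonic tensor of \<open>Re ((x + i y)\<^sup>4)\<close> or of
  \<open>4 z Im ((x + i y)\<^sup>3)\<close>. The sign of \<open>\<beta>\<close> can be changed by a rotation about the axis.

  The deviator of \<open>d\<^sub>2\<close> is \<open>p t\<close> with \<open>3 p = 4 \<beta>\<^sup>2 - 100 \<alpha>\<^sup>2\<close>, respectively \<open>3 p = 2 \<beta>\<^sup>2 - 100 \<alpha>\<^sup>2\<close>. Since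
  the deviator of \<open>t\<^sup>2\<close> is \<open>- t\<close>, one has \<open>k\<^sub>4 = - m t\<close> with \<open>m = 6 \<delta>\<^sup>4 + 6 \<nu>\<^sup>4 + p\<^sup>2\<close>, and
  \<open>K4 = 6 m\<close>, \<open>K5 = - 6 \<delta> m\<close>, \<open>L5 = - 6 \<nu> m\<close>, \<open>K9 = 72 \<alpha> m\<^sup>2\<close>, while \<open>I3\<close> is \<open>720 \<alpha>\<^sup>3 + 48 \<alpha> \<beta>\<^sup>2\<close>, respectively
  \<open>720 \<alpha>\<^sup>3 - 144 \<alpha> \<beta>\<^sup>2\<close>. If \<open>m \<noteq> 0\<close>, these values determine \<open>\<delta>\<close>, \<open>\<nu>\<close>, \<open>\<alpha>\<close> and \<open>\<beta>\<^sup>2\<close>. If \<open>m = 0\<close>, the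
  tensor is isotropic or cubic, a trigonal normal form can be rotated into a tetragonal one, and \<open>I3\<close>
  determines \<open>\<alpha>\<close> (lemma \<open>params_unique\<close>). So the seven invariants separate the orbits among the tetragonal
  tensors, and among the trigonal ones. The invariant \<open>K10\<close> vanishes on tetragonal normal forms and is
  \<open>81/25 m\<^sup>2 \<beta>\<^sup>2\<close> on trigonal ones, so for \<open>m \<noteq> 0\<close> it tells the two families apart, up to
  the axisymmetric tensors, which belong to both. As no regularity is
  required of \<open>F\<close>, separating orbits is all that a functional basis has to do (lemma
  \<open>functional_basisI\<close>).

  For minimality, each invariant is shown to be the only one that distinguishes some pair of normal forms with
  \<open>m \<noteq> 0\<close> and \<open>\<beta> \<noteq> 0\<close>. Such normal forms have symmetry group exactly \<open>D\<^sub>4\<close> or \<open>D\<^sub>3\<close>: a symmetry fixes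
  \<open>k\<^sub>4\<close>, hence the axis, and fixes \<open>B\<close>, which restricts the angle (lemma \<open>stratum_dihedralI\<close>). The remaining part of the
  development is the equivariance under rotations and the polynomiality of all constructions.
\<close>

section \<open>Rotations acting on tensors\<close>

text \<open>
  The action of \<open>g\<close> on a tensor of any order is an iterated contraction with rows of \<open>g\<close>, one for
  each index. All equivariance proofs move these contractions past each other and past sums.
\<close>

definition row_contract :: "tensor2 \<Rightarrow> 3 \<Rightarrow> (3 \<Rightarrow> real) \<Rightarrow> real" where
  "row_contract g i X = (\<Sum>p\<in>UNIV. g$i$p * X p)"

text \<open>
  The action of \<open>g\<close> on second-order tensors, \<open>g a g\<^sup>T\<close>.
\<close>

definition act2 :: "tensor2 \<Rightarrow> tensor2 \<Rightarrow> tensor2" where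
  "act2 g a = g ** a ** transpose g"

lemma row_contract_swap: "row_contract g i (\<lambda>p. row_contract h j (\<lambda>q. X p q)) = row_contract h j (\<lambda>q. row_contract g i (\<lambda>p. X p q))"
proof -
  have "row_contract g i (\<lambda>p. row_contract h j (\<lambda>q. X p q)) = (\<Sum>p\<in>UNIV. \<Sum>q\<in>UNIV. g$i$p * (h$j$q * X p q))"
    by (simp add: row_contract_def sum_distrib_left)
  also have "\<dots> = (\<Sum>q\<in>UNIV. \<Sum>p\<in>UNIV. g$i$p * (h$j$q * X p q))"
    by (rule sum.swap)
  also have "\<dots> = row_contract h j (\<lambda>q. row_contract g i (\<lambda>p. X p q))"
    by (simp add: row_contract_def sum_distrib_left mult.left_commute)
  finally show ?thesis .
qed

lemma row_contract_add: "row_contract g i (\<lambda>p. X p + Y p) = row_contract g i X + row_contract g i Y"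
  by (simp add: row_contract_def algebra_simps sum.distrib)

lemma row_contract_diff: "row_contract g i (\<lambda>p. X p - Y p) = row_contract g i X - row_contract g i Y"
  by (simp add: row_contract_def algebra_simps sum_subtractf)

lemma row_contract_mult_left: "row_contract g i (\<lambda>p. c * X p) = c * row_contract g i X"
  by (simp add: row_contract_def sum_distrib_left mult.left_commute)

lemma row_contract_mult_right: "row_contract g i (\<lambda>p. X p * c) = row_contract g i X * c"
  by (simp add: row_contract_def sum_distrib_right mult.assoc)

lemma row_contract_sum: "row_contract g i (\<lambda>p. \<Sum>k\<in>A. X p k) = (\<Sum>k\<in>A. row_contract g i (\<lambda>p. X p k))"
proof -
  have "row_contract g i (\<lambda>p. \<Sum>k\<in>A. X p k) = (\<Sum>p\<in>UNIV. \<Sum>k\<in>A. g$i$p * X p k)"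
    by (simp add: row_contract_def sum_distrib_left)
  also have "\<dots> = (\<Sum>k\<in>A. \<Sum>p\<in>UNIV. g$i$p * X p k)" by (rule sum.swap)
  finally show ?thesis by (simp add: row_contract_def)
qed

lemma rot_columns:
  assumes "rotation_matrix g"
  shows "(\<Sum>k\<in>UNIV. g$k$p * g$k$q) = (if p = q then 1 else 0)"
proof -
  have "transpose g ** g = mat 1"
    using assms by (simp add: rotation_matrix_def orthogonal_matrix_def)
  then have "(transpose g ** g)$p$q = mat 1 $p$q" by simp
  then show ?thesis by (simp add: matrix_matrix_mult_def transpose_def mat_def)
qed

lemma rot_rows:
  assumes "rotation_matrix g"
  shows "(\<Sum>k\<in>UNIV. g$p$k * g$q$k) = (if p = q then 1 else 0)"
proof -
  have "g ** transpose g = mat 1"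
    using assms by (simp add: rotation_matrix_def orthogonal_matrix_def)
  then have "(g ** transpose g)$p$q = mat 1 $p$q" by simp
  then show ?thesis by (simp add: matrix_matrix_mult_def transpose_def mat_def)
qed

text \<open>
  Contracting two rotated indices is the same as contracting the original ones, because the columns of \<open>g\<close>
  are orthonormal.
\<close>

lemma row_contract_contract:
  assumes "rotation_matrix g"
  shows "(\<Sum>k\<in>UNIV. row_contract g k (\<lambda>p. row_contract g k (\<lambda>q. Z p q))) = (\<Sum>p\<in>UNIV. Z p p)"
proof -
  have "(\<Sum>k\<in>UNIV. row_contract g k (\<lambda>p. row_contract g k (\<lambda>q. Z p q)))
      = (\<Sum>k\<in>UNIV. \<Sum>p\<in>UNIV. \<Sum>q\<in>UNIV. g$k$p * g$k$q * Z p q)"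
    by (simp add: row_contract_def sum_distrib_left mult.assoc)
  also have "\<dots> = (\<Sum>p\<in>UNIV. \<Sum>k\<in>UNIV. \<Sum>q\<in>UNIV. g$k$p * g$k$q * Z p q)"
    by (rule sum.swap)
  also have "\<dots> = (\<Sum>p\<in>UNIV. \<Sum>q\<in>UNIV. \<Sum>k\<in>UNIV. g$k$p * g$k$q * Z p q)"
    by (intro sum.cong refl sum.swap)
  also have "\<dots> = (\<Sum>p\<in>UNIV. \<Sum>q\<in>UNIV. (if p = q then 1 else 0) * Z p q)"
    by (simp add: sum_distrib_right[symmetric] rot_columns[OF assms])
  also have "\<dots> = (\<Sum>p\<in>UNIV. Z p p)"
    by (simp add: if_distrib[of "\<lambda>x. x * _"] cong: if_cong)
  finally show ?thesis .
qed

lemma row_contract_inner1: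
  assumes "rotation_matrix g"
  shows "(\<Sum>k\<in>UNIV. row_contract g k X * row_contract g k Y) = (\<Sum>p\<in>UNIV. X p * Y p)"
proof -
  have "(\<Sum>k\<in>UNIV. row_contract g k X * row_contract g k Y)
      = (\<Sum>k\<in>UNIV. row_contract g k (\<lambda>p. row_contract g k (\<lambda>q. X p * Y q)))"
    by (simp add: row_contract_mult_left row_contract_mult_right)
  then show ?thesis by (simp add: row_contract_contract[OF assms])
qed

lemma sum_lists_Suc:
  fixes f :: "3 list \<Rightarrow> real"
  shows "(\<Sum>js | length js = Suc n. f js) = (\<Sum>j\<in>UNIV. \<Sum>js | length js = n. f (j # js))"
proof -
  have "{js :: 3 list. length js = Suc n} = (\<lambda>(j, js). j # js) ` (UNIV \<times> {js. length js = n})"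
    by (auto simp: length_Suc_conv image_iff)
  moreover have "inj_on (\<lambda>(j, js). j # js) (UNIV \<times> {js :: 3 list. length js = n})"
    by (auto simp: inj_on_def)
  ultimately show ?thesis
    by (simp add: sum.reindex sum.cartesian_product case_prod_unfold)
qed

text \<open>
  The action of \<open>g\<close> on component functions, uniformly in the order: the order is the length of the
  index list.
\<close>

definition act_comps :: "tensor2 \<Rightarrow> (3 list \<Rightarrow> real) \<Rightarrow> 3 list \<Rightarrow> real" where
  "act_comps g T is = (\<Sum>js | length js = length is. (\<Prod>k<length is. g$(is!k)$(js!k)) * T js)"

lemma act_comps_Nil: "act_comps g T [] = T []"
  by (simp add: act_comps_def)

lemma act_comps_Cons: "act_comps g T (i # is) = row_contract g i (\<lambda>j. act_comps g (\<lambda>js. T (j # js)) is)"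
  by (simp add: act_comps_def sum_lists_Suc row_contract_def prod.lessThan_Suc_shift sum_distrib_left mult.assoc
      del: prod.lessThan_Suc)

text \<open>
  The componentwise inner product of two tensors of order \<open>n\<close> is invariant.
\<close>

lemma act_comps_inner:
  assumes g: "rotation_matrix g"
  shows "(\<Sum>is | length is = n. act_comps g T is * act_comps g U is) = (\<Sum>is | length is = n. T is * U is)"
proof (induction n arbitrary: T U)
  case 0
  show ?case by (simp add: act_comps_Nil)
next
  case (Suc n)
  have "(\<Sum>is | length is = Suc n. act_comps g T is * act_comps g U is)
    = (\<Sum>i\<in>UNIV. \<Sum>is | length is = n. row_contract g i (\<lambda>j. act_comps g (\<lambda>js. T (j # js)) is) * row_contract g i (\<lambda>j. act_comps g (\<lambda>js. U (j # js)) is))"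
    by (simp add: sum_lists_Suc act_comps_Cons)
  also have "\<dots> = (\<Sum>is | length is = n. \<Sum>j\<in>UNIV. act_comps g (\<lambda>js. T (j # js)) is * act_comps g (\<lambda>js. U (j # js)) is)"
    by (subst sum.swap) (simp add: row_contract_inner1[OF g])
  also have "\<dots> = (\<Sum>j\<in>UNIV. \<Sum>is | length is = n. T (j # is) * U (j # is))"
    by (subst sum.swap) (simp add: Suc.IH)
  finally show ?case by (simp add: sum_lists_Suc)
qed

lemma sum_lists:
  fixes f :: "3 list \<Rightarrow> real"
  shows "(\<Sum>is | length is = 2. f is) = (\<Sum>i\<in>UNIV. \<Sum>j\<in>UNIV. f [i, j])"
    and "(\<Sum>is | length is = 3. f is) = (\<Sum>i\<in>UNIV. \<Sum>j\<in>UNIV. \<Sum>k\<in>UNIV. f [i, j, k])"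
    and "(\<Sum>is | length is = 4. f is) = (\<Sum>i\<in>UNIV. \<Sum>j\<in>UNIV. \<Sum>k\<in>UNIV. \<Sum>l\<in>UNIV. f [i, j, k, l])"
  by (simp_all add: eval_nat_numeral sum_lists_Suc)

lemma row_contract_inner2:
  assumes g: "rotation_matrix g"
  shows "(\<Sum>k\<in>UNIV. \<Sum>l\<in>UNIV. row_contract g k (\<lambda>p. row_contract g l (X p)) * row_contract g k (\<lambda>p. row_contract g l (Y p)))
    = (\<Sum>p\<in>UNIV. \<Sum>q\<in>UNIV. X p q * Y p q)"
  using act_comps_inner[OF g, where n = 2 and T = "\<lambda>js. X (js!0) (js!1)" and U = "\<lambda>js. Y (js!0) (js!1)"]
  by (simp add: sum_lists act_comps_Cons act_comps_Nil)

lemma row_contract_inner3: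
  assumes g: "rotation_matrix g"
  shows "(\<Sum>k\<in>UNIV. \<Sum>l\<in>UNIV. \<Sum>m\<in>UNIV. row_contract g k (\<lambda>p. row_contract g l (\<lambda>q. row_contract g m (X p q)))
        * row_contract g k (\<lambda>p. row_contract g l (\<lambda>q. row_contract g m (Y p q))))
    = (\<Sum>p\<in>UNIV. \<Sum>q\<in>UNIV. \<Sum>r\<in>UNIV. X p q r * Y p q r)"
  using act_comps_inner[OF g, where n = 3 and T = "\<lambda>js. X (js!0) (js!1) (js!2)"
      and U = "\<lambda>js. Y (js!0) (js!1) (js!2)"]
  by (simp add: sum_lists act_comps_Cons act_comps_Nil)

lemma row_contract_inner4:
  assumes g: "rotation_matrix g"
  shows "(\<Sum>k\<in>UNIV. \<Sum>l\<in>UNIV. \<Sum>m\<in>UNIV. \<Sum>n\<in>UNIV.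
        row_contract g k (\<lambda>p. row_contract g l (\<lambda>q. row_contract g m (\<lambda>r. row_contract g n (X p q r))))
        * row_contract g k (\<lambda>p. row_contract g l (\<lambda>q. row_contract g m (\<lambda>r. row_contract g n (Y p q r)))))
    = (\<Sum>p\<in>UNIV. \<Sum>q\<in>UNIV. \<Sum>r\<in>UNIV. \<Sum>s\<in>UNIV. X p q r s * Y p q r s)"
  using act_comps_inner[OF g, where n = 4 and T = "\<lambda>js. X (js!0) (js!1) (js!2) (js!3)"
      and U = "\<lambda>js. Y (js!0) (js!1) (js!2) (js!3)"]
  by (simp add: sum_lists act_comps_Cons act_comps_Nil)

lemma act2_nth: "act2 g a $i$j = row_contract g i (\<lambda>p. row_contract g j (\<lambda>q. a$p$q))"
proof -
  have "act2 g a $i$j = (\<Sum>q\<in>UNIV. \<Sum>p\<in>UNIV. g$i$p * a$p$q * g$j$q)"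
    by (simp add: act2_def matrix_matrix_mult_def transpose_def sum_distrib_right)
  also have "\<dots> = (\<Sum>p\<in>UNIV. \<Sum>q\<in>UNIV. g$i$p * a$p$q * g$j$q)" by (rule sum.swap)
  finally show ?thesis by (simp add: row_contract_def sum_distrib_left mult_ac)
qed

lemma act_nth:
  "act g T $i$j$k$l = row_contract g i (\<lambda>p. row_contract g j (\<lambda>q. row_contract g k (\<lambda>r. row_contract g l (\<lambda>s. T$p$q$r$s))))"
  by (simp add: act_def row_contract_def sum_distrib_left mult.assoc)

lemma act2_mat: "rotation_matrix g \<Longrightarrow> act2 g (mat 1) = mat 1"
  by (simp add: act2_def rotation_matrix_def orthogonal_matrix_def)

lemma act2_add: "act2 g (a + b) = act2 g a + act2 g b"
  by (simp add: vec_eq_iff act2_nth row_contract_add)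

lemma act2_diff: "act2 g (a - b) = act2 g a - act2 g b"
  by (simp add: vec_eq_iff act2_nth row_contract_diff)

lemma act2_scaleR: "act2 g (c *\<^sub>R a) = c *\<^sub>R act2 g a"
  by (simp add: vec_eq_iff act2_nth row_contract_mult_left)

lemma act2_mult:
  assumes "rotation_matrix g"
  shows "act2 g (a ** b) = act2 g a ** act2 g b"
proof -
  have "transpose g ** (g ** x) = x" for x :: tensor2
    using assms by (simp add: rotation_matrix_def orthogonal_matrix_def matrix_mul_assoc)
  then show ?thesis
    by (simp add: act2_def matrix_mul_assoc[symmetric])
qed

lemma trace_act2: "rotation_matrix g \<Longrightarrow> trace (act2 g a) = trace a"
  by (simp add: trace_def act2_nth row_contract_contract)

lemma inner_act2: "rotation_matrix g \<Longrightarrow> act2 g a \<bullet> act2 g b = a \<bullet> b"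
  by (simp add: inner_vec_def act2_nth row_contract_inner2)

lemma norm_act2: "rotation_matrix g \<Longrightarrow> norm (act2 g a) = norm a"
  by (simp add: norm_eq_sqrt_inner inner_act2)

lemma dev_act2: "rotation_matrix g \<Longrightarrow> dev (act2 g a) = act2 g (dev a)"
  by (simp add: dev_def act2_diff act2_scaleR act2_mat trace_act2)

lemma act_add: "act g (A + B) = act g A + act g B"
  by (simp add: vec_eq_iff act_nth row_contract_add)

lemma act_diff: "act g (A - B) = act g A - act g B"
  by (simp add: vec_eq_iff act_nth row_contract_diff)

lemma act_scaleR: "act g (c *\<^sub>R A) = c *\<^sub>R act g A"
  by (simp add: vec_eq_iff act_nth row_contract_mult_left)

lemma row_contract_mult: "row_contract (g ** h) i X = row_contract g i (\<lambda>p. row_contract h p X)"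
proof -
  have "row_contract (g ** h) i X = (\<Sum>q\<in>UNIV. \<Sum>p\<in>UNIV. g$i$p * (h$p$q * X q))"
    by (simp add: row_contract_def matrix_matrix_mult_def sum_distrib_right mult.assoc)
  also have "\<dots> = (\<Sum>p\<in>UNIV. \<Sum>q\<in>UNIV. g$i$p * (h$p$q * X q))" by (rule sum.swap)
  finally show ?thesis by (simp add: row_contract_def sum_distrib_left)
qed

lemma row_contract_one: "row_contract (mat 1) i X = X i"
  by (simp add: row_contract_def mat_def if_distrib[of "\<lambda>x. x * _"] cong: if_cong)

lemma act_one: "act (mat 1) T = T"
  by (simp add: vec_eq_iff act_nth row_contract_one)

lemma act_mult: "act (g ** h) T = act g (act h T)"
proof -
  have "act (g ** h) T $i$j$k$l = act g (act h T) $i$j$k$l" for i j k l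
  proof -
    have "row_contract h a (\<lambda>p. row_contract g j (\<lambda>b. X p b)) = row_contract g j (\<lambda>b. row_contract h a (\<lambda>p. X p b))" for a j X
      by (rule row_contract_swap)
    then show ?thesis by (simp add: act_nth row_contract_mult)
  qed
  then show ?thesis by (simp add: vec_eq_iff)
qed

section \<open>The rotation group and the strata\<close>

lemma carrier_SO3 [simp]: "g \<in> carrier SO3 \<longleftrightarrow> rotation_matrix g"
  and mult_SO3 [simp]: "g \<otimes>\<^bsub>SO3\<^esub> h = g ** h"
  and one_SO3 [simp]: "\<one>\<^bsub>SO3\<^esub> = mat 1"
  by (simp_all add: SO3_def)

lemma rotation_transpose: "rotation_matrix g \<Longrightarrow> rotation_matrix (transpose g)"
  by (simp add: rotation_matrix_def det_transpose orthogonal_matrix_transpose)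

lemma rotation_mult:
  fixes g h :: tensor2
  shows "rotation_matrix g \<Longrightarrow> rotation_matrix h \<Longrightarrow> rotation_matrix (g ** h)"
  by (auto simp: rotation_matrix_def det_mul intro: orthogonal_matrix_mul)

lemma rotation_one: "rotation_matrix (mat 1)"
  by (simp add: rotation_matrix_def orthogonal_matrix_id)

lemma transpose_rotation:
  assumes "rotation_matrix g"
  shows "transpose g ** g = mat 1" "g ** transpose g = mat 1"
  using assms by (simp_all add: rotation_matrix_def orthogonal_matrix_def)

lemma act_transpose_cancel:
  assumes "rotation_matrix g"
  shows "act (transpose g) (act g T) = T" "act g (act (transpose g) T) = T"
  using transpose_rotation[OF assms] by (simp_all add: act_mult[symmetric] act_one)

lemma group_SO3: "group SO3"
proof (rule groupI)
  fix x assume "x \<in> carrier SO3"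
  then show "\<exists>y\<in>carrier SO3. y \<otimes>\<^bsub>SO3\<^esub> x = \<one>\<^bsub>SO3\<^esub>"
    using rotation_transpose transpose_rotation by (intro bexI[of _ "transpose x"]) auto
qed (auto simp: rotation_mult rotation_one matrix_mul_assoc)

lemma inv_SO3: "rotation_matrix g \<Longrightarrow> inv\<^bsub>SO3\<^esub> g = transpose g"
  using group.inv_equality[OF group_SO3, of "transpose g" g]
  by (simp add: rotation_transpose transpose_rotation)

lemma subgroup_symmetry_group: "subgroup (symmetry_group E) SO3"
proof (rule group.subgroupI[OF group_SO3])
  show "symmetry_group E \<noteq> {}"
    using rotation_one act_one by (auto simp: symmetry_group_def)
next
  fix a assume "a \<in> symmetry_group E"
  then have "rotation_matrix a" "act a E = E" by (auto simp: symmetry_group_def)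
  then show "inv\<^bsub>SO3\<^esub> a \<in> symmetry_group E"
    using act_transpose_cancel[of a E] by (simp add: symmetry_group_def inv_SO3 rotation_transpose)
qed (auto simp: symmetry_group_def rotation_mult act_mult)

lemma symmetry_group_act:
  assumes g: "rotation_matrix g"
  shows "symmetry_group (act g E) = (\<lambda>h. g ** h ** transpose g) ` symmetry_group E"
proof -
  have 1: "g ** h ** transpose g \<in> symmetry_group (act g E)" if "h \<in> symmetry_group E" for h
    using that g by (simp add: symmetry_group_def rotation_mult rotation_transpose act_mult
      act_transpose_cancel)
  have 2: "k \<in> (\<lambda>h. g ** h ** transpose g) ` symmetry_group E" if "k \<in> symmetry_group (act g E)" for k
  proof
    show "k = g ** (transpose g ** k ** g) ** transpose g"
      using transpose_rotation[OF g] by (metis matrix_mul_assoc matrix_mul_lid matrix_mul_rid)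
    have "act (transpose g) (act k (act g E)) = E"
      using that act_transpose_cancel[OF g] by (simp add: symmetry_group_def)
    then show "transpose g ** k ** g \<in> symmetry_group E"
      using that g by (simp add: symmetry_group_def rotation_mult rotation_transpose act_mult)
  qed
  show ?thesis using 1 2 by blast
qed

lemma act_Ela:
  assumes "E \<in> Ela"
  shows "act g E \<in> Ela"
proof -
  have s: "E$i$j$k$l = E$k$l$i$j" "E$i$j$k$l = E$j$i$k$l" for i j k l
    using assms unfolding Ela_def by blast+
  have "act g E $i$j$k$l = act g E $k$l$i$j" for i j k l
  proof -
    have "act g E $i$j$k$l = row_contract g i (\<lambda>p. row_contract g j (\<lambda>q. row_contract g k (\<lambda>r. row_contract g l (\<lambda>s. E$r$s$p$q))))"
      by (subst act_nth, subst s(1)) (rule refl)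
    also have "\<dots> = row_contract g i (\<lambda>p. row_contract g k (\<lambda>r. row_contract g j (\<lambda>q. row_contract g l (\<lambda>s. E$r$s$p$q))))"
      by (subst row_contract_swap) (rule refl)
    also have "\<dots> = row_contract g k (\<lambda>r. row_contract g i (\<lambda>p. row_contract g l (\<lambda>s. row_contract g j (\<lambda>q. E$r$s$p$q))))"
      by (subst row_contract_swap, subst (3) row_contract_swap) (rule refl)
    also have "\<dots> = act g E $k$l$i$j"
      by (subst (2) row_contract_swap) (simp add: act_nth)
    finally show ?thesis .
  qed
  moreover have "act g E $i$j$k$l = act g E $j$i$k$l" for i j k l
  proof -
    have "act g E $i$j$k$l = row_contract g i (\<lambda>p. row_contract g j (\<lambda>q. row_contract g k (\<lambda>r. row_contract g l (\<lambda>s. E$q$p$r$s))))"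
      by (simp only: act_nth s(2))
    also have "\<dots> = act g E $j$i$k$l"
      by (subst row_contract_swap) (simp add: act_nth)
    finally show ?thesis .
  qed
  ultimately show ?thesis by (simp add: Ela_def)
qed

lemma stratum_stable: "SO3_stable (stratum K)"
proof -
  have "act g E \<in> stratum K" if "rotation_matrix g" "E \<in> stratum K" for g E
  proof -
    from that obtain h where h: "E \<in> Ela" "rotation_matrix h"
      "symmetry_group E = (\<lambda>k. h ** k ** transpose h) ` K"
      by (auto simp: stratum_def)
    have "symmetry_group (act g E) = (\<lambda>k. (g ** h) ** k ** transpose (g ** h)) ` K"
      unfolding symmetry_group_act[OF that(1)] h(3) image_image
      by (simp add: matrix_transpose_mul matrix_mul_assoc)
    then show ?thesis
      using h that act_Ela rotation_mult[OF that(1) h(2)] by (auto simp: stratum_def)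
  qed
  then show ?thesis by (simp add: SO3_stable_def)
qed

lemma SO3_stable_Un: "SO3_stable A \<Longrightarrow> SO3_stable B \<Longrightarrow> SO3_stable (A \<union> B)"
  by (auto simp: SO3_stable_def)

text \<open>
  The orbit of an element of \<open>stratum K\<close> contains a tensor whose symmetry group is \<open>K\<close> itself and
  not merely a conjugate of it.
\<close>

lemma stratum_normalize:
  assumes "E \<in> stratum K"
  obtains g where "rotation_matrix g" "act g E \<in> Ela" "symmetry_group (act g E) = K"
proof -
  obtain h where h: "E \<in> Ela" "rotation_matrix h"
      "symmetry_group E = (\<lambda>k. h ** k ** transpose h) ` K"
    using assms by (auto simp: stratum_def)
  have "transpose h ** (h ** k ** transpose h) ** h = k" for k
    using transpose_rotation[OF h(2)] by (metis matrix_mul_assoc matrix_mul_lid matrix_mul_rid)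
  then have "symmetry_group (act (transpose h) E) = K"
    unfolding symmetry_group_act[OF rotation_transpose[OF h(2)]] h(3) image_image
    by simp
  then show ?thesis
    using that rotation_transpose[OF h(2)] act_Ela[OF h(1)] by blast
qed

lemma stratumI: "E \<in> Ela \<Longrightarrow> symmetry_group E = K \<Longrightarrow> E \<in> stratum K"
  unfolding stratum_def using rotation_one
  by (auto intro!: bexI[of _ "mat 1"] simp: transpose_mat)

section \<open>Total symmetrization and covariants\<close>

lemma comps4_act: "comps4 (act g T) [i, j, k, l] = act_comps g (comps4 T) [i, j, k, l]"
  by (simp add: comps4_def act_nth act_comps_Cons act_comps_Nil)

lemma symmetrization_cong:
  assumes "\<And>js. length js = length is \<Longrightarrow> T js = U js"
  shows "symmetrization T is = symmetrization U is"
  using assms by (simp add: symmetrization_def)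

lemma bij_permute_list:
  assumes "\<sigma> permutes {..<n}"
  shows "bij_betw (permute_list \<sigma>) {js :: 'a list. length js = n} {js. length js = n}"
proof (rule bij_betw_byWitness[where f' = "permute_list (inv_into UNIV \<sigma>)"])
  have i: "inv_into UNIV \<sigma> permutes {..<n}" using assms by (rule permutes_inv)
  have "permute_list (inv_into UNIV \<sigma>) (permute_list \<sigma> js) = js" if "length js = n" for js :: "'a list"
    using permute_list_compose[of "inv_into UNIV \<sigma>" js \<sigma>] that i permutes_inv_o[OF assms] by simp
  moreover have "permute_list \<sigma> (permute_list (inv_into UNIV \<sigma>) js) = js" if "length js = n" for js :: "'a list"
    using permute_list_compose[of "\<sigma>" js "inv_into UNIV \<sigma>"] that assms permutes_inv_o[OF assms] by simp
  ultimately show "\<forall>js\<in>{js :: 'a list. length js = n}. permute_list (inv_into UNIV \<sigma>) (permute_list \<sigma> js) = js"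
    "\<forall>js\<in>{js :: 'a list. length js = n}. permute_list \<sigma> (permute_list (inv_into UNIV \<sigma>) js) = js"
    by auto
qed auto

lemma act_comps_permute:
  assumes \<sigma>: "\<sigma> permutes {..<length is}"
  shows "act_comps g T (permute_list \<sigma> is) = act_comps g (\<lambda>js. T (permute_list \<sigma> js)) is"
proof -
  let ?n = "length is"
  have "act_comps g T (permute_list \<sigma> is)
      = (\<Sum>js | length js = ?n. (\<Prod>k<?n. g$(permute_list \<sigma> is!k)$(js!k)) * T js)"
    by (simp add: act_comps_def)
  also have "\<dots> = (\<Sum>js | length js = ?n.
      (\<Prod>k<?n. g$(permute_list \<sigma> is!k)$(permute_list \<sigma> js!k)) * T (permute_list \<sigma> js))"
    by (rule sum.reindex_bij_betw[OF bij_permute_list[OF \<sigma>], symmetric])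
  also have "\<dots> = (\<Sum>js | length js = ?n. (\<Prod>k<?n. g$(is!k)$(js!k)) * T (permute_list \<sigma> js))"
  proof (rule sum.cong[OF refl])
    fix js :: "3 list" assume "js \<in> {js. length js = ?n}"
    then have "(\<Prod>k<?n. g$(permute_list \<sigma> is!k)$(permute_list \<sigma> js!k))
        = (\<Prod>k<?n. g$(is!\<sigma> k)$(js!\<sigma> k))"
      using \<sigma> by (intro prod.cong) (auto simp: permute_list_nth)
    also have "\<dots> = (\<Prod>k<?n. g$(is!k)$(js!k))"
      using prod.permute[OF \<sigma>, of "\<lambda>k. g$(is!k)$(js!k)"] by (simp add: o_def)
    finally show "(\<Prod>k<?n. g$(permute_list \<sigma> is!k)$(permute_list \<sigma> js!k)) * T (permute_list \<sigma> js)
        = (\<Prod>k<?n. g$(is!k)$(js!k)) * T (permute_list \<sigma> js)" by simp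
  qed
  finally show ?thesis by (simp add: act_comps_def)
qed

lemma act_comps_sum: "act_comps g (\<lambda>js. \<Sum>x\<in>A. T x js) is = (\<Sum>x\<in>A. act_comps g (T x) is)"
proof -
  have "act_comps g (\<lambda>js. \<Sum>x\<in>A. T x js) is
    = (\<Sum>js | length js = length is. \<Sum>x\<in>A. (\<Prod>k<length is. g$(is!k)$(js!k)) * T x js)"
    by (simp add: act_comps_def sum_distrib_left)
  also have "\<dots> = (\<Sum>x\<in>A. \<Sum>js | length js = length is. (\<Prod>k<length is. g$(is!k)$(js!k)) * T x js)"
    by (rule sum.swap)
  finally show ?thesis by (simp add: act_comps_def)
qed

lemma act_comps_divide: "act_comps g (\<lambda>js. T js / c) is = act_comps g T is / c"
  by (simp add: act_comps_def sum_divide_distrib)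

lemma act_comps_cong: "(\<And>js. length js = length is \<Longrightarrow> T js = U js) \<Longrightarrow> act_comps g T is = act_comps g U is"
  by (simp add: act_comps_def)

lemma symmetrization_act_comps: "symmetrization (act_comps g T) is = act_comps g (symmetrization T) is"
proof -
  have "act_comps g (symmetrization T) is
    = act_comps g (\<lambda>js. (\<Sum>\<sigma> | \<sigma> permutes {..<length is}. T (permute_list \<sigma> js)) / fact (length is)) is"
    by (rule act_comps_cong) (simp add: symmetrization_def)
  then show ?thesis
    by (simp add: symmetrization_def act_comps_permute act_comps_sum act_comps_divide)
qed

lemma contract_act_comps:
  assumes "rotation_matrix g"
  shows "contract (act_comps g T) is = act_comps g (contract T) is"
proof -
  have "contract (act_comps g T) is = (\<Sum>p\<in>UNIV. act_comps g (\<lambda>js. T (p # p # js)) is)"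
    by (simp add: contract_def act_comps_Cons row_contract_contract[OF assms, of "\<lambda>p q. act_comps g (\<lambda>js. T (p # q # js)) is"])
  also have "\<dots> = act_comps g (contract T) is"
    by (simp add: contract_def[abs_def] act_comps_sum)
  finally show ?thesis .
qed

lemma total_sym4_act: "total_sym4 (act g T) = act g (total_sym4 T)"
proof -
  have "symmetrization (comps4 (act g T)) [i, j, k, l] = symmetrization (act_comps g (comps4 T)) [i, j, k, l]" for i j k l
  proof (rule symmetrization_cong)
    fix js :: "3 list" assume "length js = length [i, j, k, l]"
    then obtain a b c d where "js = [a, b, c, d]"
      by (auto simp: length_Suc_conv)
    then show "comps4 (act g T) js = act_comps g (comps4 T) js" by (simp add: comps4_act)
  qed
  then show ?thesis
    by (simp add: total_sym4_def vec_eq_iff symmetrization_act_comps act_nth act_comps_Cons act_comps_Nil)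
qed

lemma sym_prod_act: "sym_prod (act2 g a) (act2 g b) = act g (sym_prod a b)"
proof -
  have "(\<chi> i j k l. act2 g a$i$j * act2 g b$k$l) = act g (\<chi> i j k l. a$i$j * b$k$l)"
    by (simp add: vec_eq_iff act_nth act2_nth row_contract_mult_left row_contract_mult_right)
  then show ?thesis by (simp add: sym_prod_def total_sym4_act)
qed

lemma d_of_act:
  assumes "rotation_matrix g"
  shows "d_of (act g E) = act2 g (d_of E)"
  by (simp add: vec_eq_iff d_of_def act_nth act2_nth row_contract_sum row_contract_contract[OF assms])

lemma v_of_act:
  assumes "rotation_matrix g"
  shows "v_of (act g E) = act2 g (v_of E)"
proof -
  have "act g E $k$i$l$j = row_contract g k (\<lambda>p. row_contract g l (\<lambda>r. row_contract g i (\<lambda>q. row_contract g j (\<lambda>s. E$p$q$r$s))))" for k i l j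
    by (subst act_nth, subst (2) row_contract_swap) (rule refl)
  then show ?thesis
    by (simp add: vec_eq_iff v_of_def act2_nth row_contract_sum row_contract_contract[OF assms])
qed

lemma H_of_act:
  assumes "rotation_matrix g"
  shows "H_of (act g E) = act g (H_of E)"
proof -
  have a: "a_of (act g E) = act2 g (a_of E)"
    by (simp add: a_of_def d_of_act v_of_act assms act2_add act2_scaleR)
  have "sym_prod (mat 1) (dev (act2 g (a_of E))) = act g (sym_prod (mat 1) (dev (a_of E)))"
    "sym_prod (mat 1) (mat 1) = act g (sym_prod (mat 1) (mat 1))"
    using sym_prod_act[of g "mat 1" "dev (a_of E)"] sym_prod_act[of g "mat 1" "mat 1"]
    by (simp_all add: assms act2_mat dev_act2)
  then show ?thesis
    by (simp add: H_of_def a act_diff act_scaleR total_sym4_act trace_act2 assms)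
qed

text \<open>
  The sum over the permutations of the first \<open>m\<close> positions of an index list. Splitting off the image
  of the last position gives a recursion which expands a symmetrization into an explicit sum.
\<close>

definition symsum :: "nat \<Rightarrow> (3 list \<Rightarrow> real) \<Rightarrow> 3 list \<Rightarrow> real" where
  "symsum m T is = (\<Sum>\<sigma> | \<sigma> permutes {..<m}. T (permute_list \<sigma> is))"

lemma symsum_0: "symsum 0 T is = T is"
  by (simp add: symsum_def)

lemma symsum_Suc:
  assumes "m < length is"
  shows "symsum (Suc m) T is = (\<Sum>b\<le>m. symsum m T (is[m := is!b, b := is!m]))"
proof -
  have "symsum (Suc m) T is = (\<Sum>\<sigma> | \<sigma> permutes (insert m {..<m}). T (permute_list \<sigma> is))"
    by (simp add: symsum_def lessThan_Suc)
  also have "\<dots> = (\<Sum>b\<in>insert m {..<m}. \<Sum>q | q permutes {..<m}. T (permute_list (Transposition.transpose m b \<circ> q) is))"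
    by (subst sum_over_permutations_insert) auto
  also have "\<dots> = (\<Sum>b\<in>insert m {..<m}. symsum m T (is[m := is!b, b := is!m]))"
  proof (rule sum.cong[OF refl])
    fix b assume b: "b \<in> insert m {..<m}"
    have "permute_list (Transposition.transpose m b \<circ> q) is = permute_list q (is[m := is!b, b := is!m])"
      if "q permutes {..<m}" for q
    proof -
      have q: "q permutes {..<length is}" using that assms by (auto intro: permutes_subset)
      have "permute_list (Transposition.transpose m b) is = is[m := is!b, b := is!m]"
        using assms b by (auto intro!: nth_equalityI simp: permute_list_def nth_list_update transpose_def)
      then show ?thesis using permute_list_compose[OF q] by simp
    qed
    then show "(\<Sum>q | q permutes {..<m}. T (permute_list (Transposition.transpose m b \<circ> q) is))
        = symsum m T (is[m := is!b, b := is!m])"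
      by (simp add: symsum_def)
  qed
  also have "insert m {..<m} = {..m}" by auto
  finally show ?thesis .
qed

lemma symmetrization_symsum: "symmetrization T is = symsum (length is) T is / fact (length is)"
  by (simp add: symmetrization_def symsum_def)

lemma symmetrization4:
  "symmetrization T [i, j, k, l] =
    (T [i, j, k, l] + T [i, j, l, k] + T [i, k, j, l] + T [i, k, l, j] + T [i, l, j, k] + T [i, l, k, j]
   + T [j, i, k, l] + T [j, i, l, k] + T [j, k, i, l] + T [j, k, l, i] + T [j, l, i, k] + T [j, l, k, i]
   + T [k, i, j, l] + T [k, i, l, j] + T [k, j, i, l] + T [k, j, l, i] + T [k, l, i, j] + T [k, l, j, i]
   + T [l, i, j, k] + T [l, i, k, j] + T [l, j, i, k] + T [l, j, k, i] + T [l, k, i, j] + T [l, k, j, i]) / 24"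
  by (simp add: symmetrization_symsum eval_nat_numeral symsum_Suc symsum_0 atMost_Suc
      atMost_0 del: fact_Suc) (simp add: fact_numeral eval_nat_numeral)

lemma total_sym4_swap:
  "total_sym4 T $j$i$k$l = total_sym4 T $i$j$k$l"
  "total_sym4 T $i$k$j$l = total_sym4 T $i$j$k$l"
  "total_sym4 T $i$j$l$k = total_sym4 T $i$j$k$l"
  by (simp_all add: total_sym4_def symmetrization4 add_ac)

lemma H_of_swap:
  "H_of E $j$i$k$l = H_of E $i$j$k$l"
  "H_of E $i$k$j$l = H_of E $i$j$k$l"
  "H_of E $i$j$l$k = H_of E $i$j$k$l"
  by (simp_all add: H_of_def sym_prod_def total_sym4_swap)

text \<open>
  Both factors \<open>H\<close> are rewritten with the three contracted indices outermost, so that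
  the invariance of the inner product of order three applies.
\<close>

lemma d2_of_act:
  assumes g: "rotation_matrix g"
  shows "d2_of (act g E) = act2 g (d2_of E)"
proof -
  define H where "H = H_of E"
  have 1: "act g H $i$p$q$r = row_contract g p (\<lambda>b. row_contract g q (\<lambda>c. row_contract g r (\<lambda>d. row_contract g i (\<lambda>a. H$a$b$c$d))))" for i p q r
    by (subst act_nth, subst row_contract_swap, subst (2) row_contract_swap, subst (3) row_contract_swap) (rule refl)
  have 2: "act g H $p$q$r$j = row_contract g p (\<lambda>b. row_contract g q (\<lambda>c. row_contract g r (\<lambda>d. row_contract g j (\<lambda>e. H$b$c$d$e))))" for p q r j
    by (rule act_nth)
  have "d2_of (act g E) $i$j = act2 g (d2_of E) $i$j" for i j
  proof -
    have "d2_of (act g E) $i$j = (\<Sum>p\<in>UNIV. \<Sum>q\<in>UNIV. \<Sum>r\<in>UNIV.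
        row_contract g i (\<lambda>a. H$a$p$q$r) * row_contract g j (\<lambda>e. H$p$q$r$e))"
      by (simp add: d2_of_def Let_def H_of_act[OF g] H_def[symmetric] 1[of i] 2[of _ _ _ j] row_contract_inner3[OF g])
    also have "\<dots> = act2 g (d2_of E) $i$j"
      by (simp add: act2_nth d2_of_def Let_def H_def[symmetric] row_contract_sum row_contract_mult_left row_contract_mult_right)
    finally show ?thesis .
  qed
  then show ?thesis by (simp add: vec_eq_iff)
qed

text \<open>
  Composition of fourth-order tensors, viewed as linear maps on second-order tensors. The invariant
  \<open>I3\<close> is the trace of the third power of \<open>H\<close> in this sense.
\<close>

definition compose4 :: "tensor4 \<Rightarrow> tensor4 \<Rightarrow> tensor4" where
  "compose4 A B = (\<chi> i k r s. \<Sum>p\<in>UNIV. \<Sum>q\<in>UNIV. A$i$k$p$q * B$p$q$r$s)"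

lemma compose4_act:
  assumes g: "rotation_matrix g"
  shows "compose4 (act g A) (act g B) = act g (compose4 A B)"
proof -
  have 1: "act g A $i$k$p$q = row_contract g p (\<lambda>c. row_contract g q (\<lambda>d. row_contract g i (\<lambda>a. row_contract g k (\<lambda>b. A$a$b$c$d))))" for i k p q
    by (subst act_nth, subst (2) row_contract_swap, subst row_contract_swap, subst (3) row_contract_swap, subst (2) row_contract_swap) (rule refl)
  have "compose4 (act g A) (act g B) $i$k$r$s = act g (compose4 A B) $i$k$r$s" for i k r s
  proof -
    have "compose4 (act g A) (act g B) $i$k$r$s = (\<Sum>p\<in>UNIV. \<Sum>q\<in>UNIV.
       row_contract g i (\<lambda>a. row_contract g k (\<lambda>b. A$a$b$p$q)) * row_contract g r (\<lambda>c. row_contract g s (\<lambda>d. B$p$q$c$d)))"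
      by (simp add: compose4_def 1[of i k] act_nth[of g B _ _ r s] row_contract_inner2[OF g])
    also have "\<dots> = act g (compose4 A B) $i$k$r$s"
      by (simp add: act_nth compose4_def row_contract_sum row_contract_mult_left row_contract_mult_right)
    finally show ?thesis .
  qed
  then show ?thesis by (simp add: vec_eq_iff)
qed

lemma inner_act:
  assumes g: "rotation_matrix g"
  shows "act g A \<bullet> act g B = A \<bullet> B"
  by (simp add: inner_vec_def act_nth row_contract_inner4[OF g])

lemma I3_inner: "I3 E = compose4 (H_of E) (H_of E) \<bullet> H_of E"
proof -
  have s: "H_of E $r$s$k$i = H_of E $i$k$r$s" for r s k i
    using H_of_swap by metis
  have sw: "(\<Sum>p\<in>UNIV. \<Sum>q\<in>UNIV. \<Sum>r\<in>UNIV. \<Sum>s\<in>UNIV. f p q r s)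
     = (\<Sum>r\<in>UNIV. \<Sum>s\<in>UNIV. \<Sum>p\<in>UNIV. \<Sum>q\<in>UNIV. f p q r s)" for f :: "3 \<Rightarrow> 3 \<Rightarrow> 3 \<Rightarrow> 3 \<Rightarrow> real"
  proof -
    have "(\<Sum>p\<in>UNIV. \<Sum>q\<in>UNIV. \<Sum>r\<in>UNIV. \<Sum>s\<in>UNIV. f p q r s)
        = (\<Sum>p\<in>UNIV. \<Sum>r\<in>UNIV. \<Sum>s\<in>UNIV. \<Sum>q\<in>UNIV. f p q r s)"
      by (subst (2) sum.swap, subst (3) sum.swap) (rule refl)
    also have "\<dots> = (\<Sum>r\<in>UNIV. \<Sum>s\<in>UNIV. \<Sum>p\<in>UNIV. \<Sum>q\<in>UNIV. f p q r s)"
      by (subst sum.swap, subst (2) sum.swap) (rule refl)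
    finally show ?thesis .
  qed
  show ?thesis
  proof -
    have "(\<Sum>p\<in>UNIV. \<Sum>q\<in>UNIV. \<Sum>r\<in>UNIV. \<Sum>s\<in>UNIV. H_of E$i$k$p$q * H_of E$p$q$r$s * H_of E$r$s$k$i)
      = (\<Sum>r\<in>UNIV. \<Sum>s\<in>UNIV. compose4 (H_of E) (H_of E) $i$k$r$s * H_of E$i$k$r$s)" for i k
      by (subst sw) (simp add: compose4_def s[of _ _ k i] sum_distrib_right)
    then show ?thesis
      by (simp add: I3_def trace_def d3_of_def Let_def inner_vec_def)
  qed
qed

lemma k4_of_act:
  assumes g: "rotation_matrix g"
  shows "k4_of (act g E) = act2 g (k4_of E)"
  by (simp add: k4_of_def Let_def d_of_act v_of_act d2_of_act dev_act2 norm_act2 g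
      act2_mult[symmetric] act2_add[symmetric] act2_scaleR[symmetric])

lemma levi_civita_cross:
  "(\<Sum>p\<in>UNIV. \<Sum>r\<in>UNIV. X p * levi_civita p j r * Y r) = - cross3 (\<chi> p. X p) (\<chi> r. Y r) $ j"
proof -
  have "\<forall>j. (\<Sum>p\<in>UNIV. \<Sum>r\<in>UNIV. X p * levi_civita p j r * Y r) = - cross3 (\<chi> p. X p) (\<chi> r. Y r) $ j"
    by (simp add: forall_3 sum_3 levi_civita_def cross3_def)
  then show ?thesis by blast
qed

text \<open>
  The Levi-Civita tensor is invariant under rotations because the cross product is equivariant.
\<close>

lemma levi_civita_rotation:
  assumes g: "rotation_matrix g"
  shows "(\<Sum>p\<in>UNIV. \<Sum>r\<in>UNIV. row_contract g p X * levi_civita p j r * row_contract g r Y)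
    = row_contract g j (\<lambda>q. \<Sum>p\<in>UNIV. \<Sum>r\<in>UNIV. X p * levi_civita p q r * Y r)"
proof -
  have "(\<chi> p. row_contract g p Z) = g *v (\<chi> p. Z p)" for Z
    by (simp add: vec_eq_iff row_contract_def matrix_vector_mult_def)
  then have "(\<Sum>p\<in>UNIV. \<Sum>r\<in>UNIV. row_contract g p X * levi_civita p j r * row_contract g r Y)
    = - (g *v cross3 (\<chi> p. X p) (\<chi> r. Y r)) $ j"
    by (simp add: levi_civita_cross cross_rotation_matrix[OF g])
  also have "\<dots> = row_contract g j (\<lambda>q. \<Sum>p\<in>UNIV. \<Sum>r\<in>UNIV. X p * levi_civita p q r * Y r)"
    by (simp add: levi_civita_cross row_contract_def matrix_vector_mult_def sum_negf)
  finally show ?thesis .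
qed

text \<open>
  The third-order tensor \<open>tr (H \<times> a)\<close> whose squared norm, for \<open>a = k\<^sub>4\<close>, is \<open>K10\<close>.
\<close>

definition K10_tensor :: "tensor2 \<Rightarrow> tensor4 \<Rightarrow> 3 list \<Rightarrow> real" where
  "K10_tensor a H = contract (gen_cross 2 (comps4 H) (comps2 a))"

lemma act2_nth': "act2 g a $i$j = row_contract g j (\<lambda>q. row_contract g i (\<lambda>p. a$p$q))"
  by (subst act2_nth, subst row_contract_swap) (rule refl)

lemma gen_cross_act:
  assumes g: "rotation_matrix g" and n: "length is = 5"
  shows "gen_cross 2 (comps4 (act g H)) (comps2 (act2 g a)) is = act_comps g (gen_cross 2 (comps4 H) (comps2 a)) is"
proof -
  define W where "W H a = (\<lambda>is. \<Sum>p\<in>UNIV. \<Sum>r\<in>UNIV.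
     comps2 a (take (2 - 1) is @ [p]) * levi_civita p (is ! (2 - 1)) r * comps4 H (r # drop 2 is))" for H a
  have W: "W (act g H) (act2 g a) js = act_comps g (W H a) js" if len: "length js = 5" for js
  proof -
    obtain i j k l m where js: "js = [i, j, k, l, m]"
      using len by (auto simp: length_Suc_conv numeral_eq_Suc)
    define U where "U = (\<lambda>z. row_contract g k (\<lambda>b. row_contract g l (\<lambda>c. row_contract g m (\<lambda>d. H$z$b$c$d))))"
    have "W (act g H) (act2 g a) js = (\<Sum>p\<in>UNIV. \<Sum>r\<in>UNIV.
       row_contract g p (\<lambda>y. row_contract g i (\<lambda>x. a$x$y)) * levi_civita p j r * row_contract g r U)"
      by (simp add: W_def js comps2_def comps4_def act2_nth' act_nth U_def)
    also have "\<dots> = row_contract g j (\<lambda>q. \<Sum>p\<in>UNIV. \<Sum>r\<in>UNIV.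
       row_contract g i (\<lambda>x. a$x$p) * levi_civita p q r * U r)"
      by (rule levi_civita_rotation[OF g])
    also have "\<dots> = row_contract g j (\<lambda>q. row_contract g i (\<lambda>x. \<Sum>p\<in>UNIV. \<Sum>r\<in>UNIV.
       a$x$p * levi_civita p q r * U r))"
      by (simp add: row_contract_sum row_contract_mult_right)
    also have "\<dots> = row_contract g i (\<lambda>x. row_contract g j (\<lambda>q. \<Sum>p\<in>UNIV. \<Sum>r\<in>UNIV.
       a$x$p * levi_civita p q r * U r))"
      by (rule row_contract_swap)
    also have "\<dots> = act_comps g (W H a) js"
      by (simp add: W_def js comps2_def comps4_def act_comps_Cons act_comps_Nil row_contract_sum row_contract_mult_left U_def)
    finally show ?thesis .
  qed
  have "gen_cross 2 (comps4 (act g H)) (comps2 (act2 g a)) is = symmetrization (W (act g H) (act2 g a)) is"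
    by (simp add: gen_cross_def W_def)
  also have "\<dots> = symmetrization (act_comps g (W H a)) is"
    by (rule symmetrization_cong) (simp add: W n)
  finally show ?thesis by (simp add: symmetrization_act_comps gen_cross_def W_def)
qed

lemma K10_tensor_act:
  assumes g: "rotation_matrix g" and n: "length is = 3"
  shows "K10_tensor (act2 g a) (act g H) is = act_comps g (K10_tensor a H) is"
proof -
  have "K10_tensor (act2 g a) (act g H) is = contract (act_comps g (gen_cross 2 (comps4 H) (comps2 a))) is"
    using n by (simp add: K10_tensor_def contract_def gen_cross_act[OF g])
  then show ?thesis by (simp add: contract_act_comps[OF g] K10_tensor_def)
qed

lemma K10_sum: "K10 E = (\<Sum>is | length is = 3. K10_tensor (k4_of E) (H_of E) is * K10_tensor (k4_of E) (H_of E) is)"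
  by (simp add: K10_def sum_lists power2_norm_eq_inner inner_vec_def K10_tensor_def)

lemma invariants:
  assumes g: "rotation_matrix g"
  shows "K1 (act g E) = K1 E" "L1 (act g E) = L1 E" "I3 (act g E) = I3 E" "K4 (act g E) = K4 E"
    "K5 (act g E) = K5 E" "L5 (act g E) = L5 E" "K9 (act g E) = K9 E" "K10 (act g E) = K10 E"
proof -
  show "K1 (act g E) = K1 E" "L1 (act g E) = L1 E" "K4 (act g E) = K4 E"
    "K5 (act g E) = K5 E" "L5 (act g E) = L5 E"
    by (simp_all add: K1_def L1_def K4_def K5_def L5_def d_of_act v_of_act d2_of_act k4_of_act g
        trace_act2 dev_act2 norm_act2 inner_act2)
  show "I3 (act g E) = I3 E"
    by (simp add: I3_inner H_of_act compose4_act inner_act g)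
  define kk where "kk = (\<lambda>a::tensor2. (\<chi> i j k l. a$i$j * a$k$l) :: tensor4)"
  have 1: "K9 E = kk (k4_of E) \<bullet> H_of E" for E
    by (simp add: K9_def kk_def inner_vec_def mult_ac)
  have "kk (act2 g a) = act g (kk a)" for a
    by (simp add: kk_def vec_eq_iff act_nth act2_nth row_contract_mult_left row_contract_mult_right)
  then show "K9 (act g E) = K9 E"
    by (simp add: 1 k4_of_act H_of_act inner_act g)
  have "K10 (act g E) = (\<Sum>is | length is = 3. act_comps g (K10_tensor (k4_of E) (H_of E)) is * act_comps g (K10_tensor (k4_of E) (H_of E)) is)"
    by (simp add: K10_sum k4_of_act H_of_act g K10_tensor_act)
  then show "K10 (act g E) = K10 E"
    by (simp add: act_comps_inner[OF g] K10_sum)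
qed

section \<open>Functional bases\<close>

text \<open>
  Invariant functions that separate the orbits form a functional basis, since no regularity is asked
  of \<open>F\<close>: it may be defined through a choice of one point for each tuple of values.
\<close>

lemma functional_basisI:
  assumes "SO3_stable X" and "\<And>\<phi>. \<phi> \<in> set \<phi>s \<Longrightarrow> SO3_invariant X \<phi>"
    and sep: "\<And>x y. x \<in> X \<Longrightarrow> y \<in> X \<Longrightarrow> (\<And>\<phi>. \<phi> \<in> set \<phi>s \<Longrightarrow> \<phi> x = \<phi> y) \<Longrightarrow> \<exists>g. rotation_matrix g \<and> act g x = y"
  shows "functional_basis X \<phi>s"
  unfolding functional_basis_def
proof (intro conjI allI impI ballI)
  fix f assume f: "SO3_invariant X f"
  define F where "F vs = f (SOME x. x \<in> X \<and> map (\<lambda>\<phi>. \<phi> x) \<phi>s = vs)" for vs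
  show "\<exists>F :: real list \<Rightarrow> real. \<forall>x \<in> X. f x = F (map (\<lambda>\<phi>. \<phi> x) \<phi>s)"
  proof (intro exI ballI)
    fix x assume x: "x \<in> X"
    define y where "y = (SOME y. y \<in> X \<and> map (\<lambda>\<phi>. \<phi> y) \<phi>s = map (\<lambda>\<phi>. \<phi> x) \<phi>s)"
    have "y \<in> X \<and> map (\<lambda>\<phi>. \<phi> y) \<phi>s = map (\<lambda>\<phi>. \<phi> x) \<phi>s"
      unfolding y_def by (rule someI[of _ x]) (simp add: x)
    then have "\<exists>g. rotation_matrix g \<and> act g x = y"
      using x by (intro sep) auto
    then obtain g where g: "rotation_matrix g" "act g x = y" by blast
    then have "f y = f x"
      using f x by (auto simp: SO3_invariant_def)
    then show "f x = F (map (\<lambda>\<phi>. \<phi> x) \<phi>s)"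
      by (simp add: F_def y_def)
  qed
qed (use assms in auto)

text \<open>
  Among the listed functions exactly the one at position \<open>i\<close> distinguishes \<open>x\<close> from \<open>y\<close>.
\<close>

definition separates_only :: "(tensor4 \<Rightarrow> real) list \<Rightarrow> nat \<Rightarrow> tensor4 \<Rightarrow> tensor4 \<Rightarrow> bool" where
  "separates_only \<phi>s i x y \<longleftrightarrow> (\<forall>j<length \<phi>s. (\<phi>s!j) x = (\<phi>s!j) y \<longleftrightarrow> j \<noteq> i)"

text \<open>
  If each listed function is indispensable for separating some pair of points, no proper subset is a
  functional basis: the missing function is itself invariant and would have to be a function of the
  remaining ones. Distinctness of the list follows from the same pairs.
\<close>

lemma minimal_functional_basisI:
  assumes fb: "functional_basis X \<phi>s"
    and w: "\<And>i. i < length \<phi>s \<Longrightarrow> \<exists>x\<in>X. \<exists>y\<in>X. separates_only \<phi>s i x y"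
  shows "minimal_functional_basis X \<phi>s"
  unfolding minimal_functional_basis_def
proof (intro conjI allI impI notI fb)
  show "distinct \<phi>s"
    unfolding distinct_conv_nth using w unfolding separates_only_def by metis
next
  fix \<psi>s assume sub: "set \<psi>s \<subset> set \<phi>s" and b: "functional_basis X \<psi>s"
  then obtain i where i: "i < length \<phi>s" "\<phi>s!i \<notin> set \<psi>s"
    by (metis in_set_conv_nth psubsetE subsetI)
  obtain x y where xy: "x \<in> X" "y \<in> X" "separates_only \<phi>s i x y"
    using w[OF i(1)] by auto
  have eq: "map (\<lambda>\<psi>. \<psi> x) \<psi>s = map (\<lambda>\<psi>. \<psi> y) \<psi>s"
  proof (rule map_cong[OF refl])
    fix \<psi> assume "\<psi> \<in> set \<psi>s"
    then have \<psi>: "\<psi> \<in> set \<phi>s" "\<psi> \<noteq> \<phi>s!i" using sub i by auto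
    from \<psi>(1) obtain j where j: "j < length \<phi>s" "\<phi>s!j = \<psi>"
      unfolding in_set_conv_nth by blast
    with \<psi>(2) have "j \<noteq> i" by blast
    with j xy(3) show "\<psi> x = \<psi> y" unfolding separates_only_def by blast
  qed
  have "SO3_invariant X (\<phi>s!i)"
    using fb i(1) by (simp add: functional_basis_def)
  then obtain F where F: "\<forall>x\<in>X. (\<phi>s!i) x = F (map (\<lambda>\<psi>. \<psi> x) \<psi>s)"
    using b unfolding functional_basis_def by blast
  have "(\<phi>s!i) x = (\<phi>s!i) y"
    unfolding F[rule_format, OF xy(1)] F[rule_format, OF xy(2)] eq ..
  then show False using xy(3) i(1) unfolding separates_only_def by blast
qed

section \<open>Polynomiality\<close>

lemma poly_component: "real_polynomial_function (\<lambda>E :: tensor4. E$i$j$k$l)"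
  by (intro real_polynomial_function.intros(1) bounded_linear_compose[OF bounded_linear_vec_nth] bounded_linear_vec_nth)

lemmas poly_intros = real_polynomial_function.intros(2-4) real_polynomial_function_sum
  real_polynomial_function_diff real_polynomial_function_divide

lemma poly_power: "real_polynomial_function f \<Longrightarrow> real_polynomial_function (\<lambda>x. f x ^ n)"
  by (induction n) (auto simp: real_polynomial_function.intros(2) real_polynomial_function.intros(4))

text \<open>
  Second-order tensors whose components are polynomials in the components of the argument.
\<close>

definition poly2 :: "(tensor4 \<Rightarrow> tensor2) \<Rightarrow> bool" where
  "poly2 A \<longleftrightarrow> (\<forall>i j. real_polynomial_function (\<lambda>E. A E $i$j))"

lemma poly_trace: "poly2 A \<Longrightarrow> real_polynomial_function (\<lambda>E. trace (A E))"
  unfolding trace_def poly2_def by (auto intro!: poly_intros)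

lemma poly_inner: "poly2 A \<Longrightarrow> poly2 B \<Longrightarrow> real_polynomial_function (\<lambda>E. A E \<bullet> B E)"
  unfolding inner_vec_def poly2_def by (auto intro!: poly_intros)

lemma poly_norm2: "poly2 A \<Longrightarrow> real_polynomial_function (\<lambda>E. (norm (A E))\<^sup>2)"
  by (simp add: power2_norm_eq_inner poly_inner)

lemma poly_norm4: "poly2 A \<Longrightarrow> real_polynomial_function (\<lambda>E. norm (A E) ^ 4)"
  using poly_power[OF poly_norm2, of A 2] by simp

lemma poly2_add: "poly2 A \<Longrightarrow> poly2 B \<Longrightarrow> poly2 (\<lambda>E. A E + B E)"
  unfolding poly2_def by (auto intro!: poly_intros)

lemma poly2_scaleR: "real_polynomial_function f \<Longrightarrow> poly2 A \<Longrightarrow> poly2 (\<lambda>E. f E *\<^sub>R A E)"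
  unfolding poly2_def by (auto intro!: poly_intros)

lemma poly2_mult: "poly2 A \<Longrightarrow> poly2 B \<Longrightarrow> poly2 (\<lambda>E. A E ** B E)"
  unfolding poly2_def matrix_matrix_mult_def by (auto intro!: poly_intros)

lemma poly2_dev: "poly2 A \<Longrightarrow> poly2 (\<lambda>E. dev (A E))"
  unfolding poly2_def dev_def trace_def by (auto intro!: poly_intros)

lemma poly2_d_of: "poly2 d_of" and poly2_v_of: "poly2 v_of"
  unfolding poly2_def d_of_def v_of_def by (auto intro!: poly_intros poly_component)

lemma poly2_a_of: "poly2 a_of"
  unfolding a_of_def[abs_def]
  by (intro poly2_scaleR poly2_add poly2_d_of poly2_v_of real_polynomial_function.intros(2))

lemma poly_symmetrization:
  assumes "\<And>js. real_polynomial_function (\<lambda>E. T E js)"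
  shows "real_polynomial_function (\<lambda>E. symmetrization (T E) is)"
  unfolding symmetrization_def
  using assms by (intro real_polynomial_function_divide real_polynomial_function_sum finite_permutations) auto

lemma poly_H_of: "real_polynomial_function (\<lambda>E. H_of E $i$j$k$l)"
  using poly_trace[OF poly2_a_of] poly2_dev[OF poly2_a_of]
  by (auto simp: H_of_def sym_prod_def total_sym4_def comps4_def poly2_def
      intro!: real_polynomial_function_diff poly_symmetrization poly_component real_polynomial_function.intros(2-4))

lemma poly2_d2_of: "poly2 d2_of" 
  by (auto simp: poly2_def d2_of_def Let_def intro!: poly_intros poly_H_of)

lemma poly2_k4_of: "poly2 k4_of"
  unfolding k4_of_def[abs_def] Let_def
  by (intro poly2_dev poly2_add poly2_scaleR poly2_mult poly_norm2 poly2_d_of poly2_v_of poly2_d2_of)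

lemma poly_K10: "real_polynomial_function K10"
proof -
  have "real_polynomial_function (\<lambda>E. K10_tensor (k4_of E) (H_of E) is)" for "is"
    unfolding K10_tensor_def contract_def gen_cross_def comps2_def comps4_def
    using poly2_k4_of poly_H_of
    by (intro real_polynomial_function_sum poly_symmetrization real_polynomial_function.intros(2-4))
      (auto simp: poly2_def)
  moreover have "finite {is :: 3 list. length is = 3}"
    using finite_lists_length_eq[of "UNIV :: 3 set" 3] by simp
  ultimately show ?thesis unfolding K10_sum[abs_def] by (auto intro!: poly_intros)
qed

lemma all_polynomial: "\<forall>\<phi> \<in> {K1, L1, I3, K4, K5, L5, K9, K10}. real_polynomial_function \<phi>"
proof -
  have "real_polynomial_function K1" "real_polynomial_function L1"
    unfolding K1_def[abs_def] L1_def[abs_def] by (intro poly_trace poly2_d_of poly2_v_of)+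
  moreover have "real_polynomial_function I3"
    unfolding I3_inner[abs_def] inner_vec_def compose4_def vec_lambda_beta inner_real_def
    by (intro real_polynomial_function_sum real_polynomial_function.intros(4) poly_H_of finite)
  moreover have "real_polynomial_function K4"
    unfolding K4_def[abs_def] 
    by (intro real_polynomial_function.intros(3) poly_norm2 poly_norm4 poly2_dev poly2_d_of poly2_v_of poly2_d2_of)
  moreover have "real_polynomial_function K5" "real_polynomial_function L5"
    unfolding K5_def[abs_def] L5_def[abs_def] by (intro poly_inner poly2_d_of poly2_v_of poly2_k4_of)+
  moreover have "real_polynomial_function K9"
    unfolding K9_def[abs_def] using poly2_k4_of
    by (intro real_polynomial_function_sum real_polynomial_function.intros(4) poly_H_of finite) (simp_all add: poly2_def)
  ultimately show ?thesis using poly_K10 by auto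
qed

section \<open>Harmonic tensors and normal forms\<close>

text \<open>
  Totally symmetric and traceless fourth-order tensors.
\<close>

definition harmonic4 :: "tensor4 \<Rightarrow> bool" where
  "harmonic4 H \<longleftrightarrow> (\<forall>i j k l. H$j$i$k$l = H$i$j$k$l \<and> H$i$k$j$l = H$i$j$k$l \<and> H$i$j$l$k = H$i$j$k$l)
     \<and> (\<forall>k l. (\<Sum>i\<in>UNIV. H$i$i$k$l) = 0)"

lemma harmonic4_swap:
  assumes "harmonic4 H"
  shows "H$j$i$k$l = H$i$j$k$l" "H$i$k$j$l = H$i$j$k$l" "H$i$j$l$k = H$i$j$k$l"
  using assms unfolding harmonic4_def by blast+

lemma harmonic4_trace: "harmonic4 H \<Longrightarrow> (\<Sum>i\<in>UNIV. H$i$i$k$l) = 0"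
  unfolding harmonic4_def by blast

lemma harmonic4I:
  assumes "\<And>i j k l. H$j$i$k$l = H$i$j$k$l" "\<And>i j k l. H$i$k$j$l = H$i$j$k$l"
    "\<And>i j k l. H$i$j$l$k = H$i$j$k$l" "\<And>k l. (\<Sum>i\<in>UNIV. H$i$i$k$l) = 0"
  shows "harmonic4 H"
  using assms unfolding harmonic4_def by blast

lemma harmonic4_lin:
  assumes A: "harmonic4 A" and B: "harmonic4 B"
  shows "harmonic4 (a *\<^sub>R A + b *\<^sub>R B)"
proof (rule harmonic4I)
  show "(\<Sum>i\<in>UNIV. (a *\<^sub>R A + b *\<^sub>R B)$i$i$k$l) = 0" for k l
    by (simp add: sum.distrib sum_distrib_left[symmetric] harmonic4_trace[OF A] harmonic4_trace[OF B])
qed (simp_all add: harmonic4_swap[OF A] harmonic4_swap[OF B])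

lemma total_sym4_harmonic4: 
  assumes "harmonic4 H"
  shows "total_sym4 H = H"
  by (simp add: vec_eq_iff total_sym4_def symmetrization4 comps4_def harmonic4_swap[OF assms])

lemma total_sym4_add: "total_sym4 (A + B) = total_sym4 A + total_sym4 B"
  by (simp add: vec_eq_iff total_sym4_def symmetrization_def comps4_def sum.distrib add_divide_distrib)

lemma total_sym4_scaleR: "total_sym4 (c *\<^sub>R A) = c *\<^sub>R total_sym4 A"
  by (simp add: vec_eq_iff total_sym4_def symmetrization_def comps4_def sum_distrib_left[symmetric])

lemma sym_prod_add_right: "sym_prod q (a + b) = sym_prod q a + sym_prod q b"
proof -
  have "(\<chi> i j k l. q$i$j * (a + b)$k$l) = (\<chi> i j k l. q$i$j * a$k$l) + (\<chi> i j k l. q$i$j * b$k$l)"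
    by (simp add: vec_eq_iff algebra_simps)
  then show ?thesis by (simp add: sym_prod_def total_sym4_add)
qed

lemma sym_prod_scaleR_right: "sym_prod q (c *\<^sub>R a) = c *\<^sub>R sym_prod q a"
proof -
  have "(\<chi> i j k l. q$i$j * (c *\<^sub>R a)$k$l) = c *\<^sub>R (\<chi> i j k l. q$i$j * a$k$l)"
    by (simp add: vec_eq_iff algebra_simps)
  then show ?thesis by (simp add: sym_prod_def total_sym4_scaleR)
qed

text \<open>
  The part of an elasticity tensor that is built from the metric and two symmetric second-order
  tensors; it accounts for \<open>d\<close> and \<open>v\<close> and does not contribute to \<open>H\<close>.
\<close>

definition metric_part :: "tensor2 \<Rightarrow> tensor2 \<Rightarrow> tensor4" where
  "metric_part x y = (\<chi> i j k l. mat 1$i$j * x$k$l + x$i$j * mat 1$k$l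
     + mat 1$i$k * y$j$l + mat 1$i$l * y$j$k + mat 1$j$k * y$i$l + mat 1$j$l * y$i$k)"

text \<open>
  These index permutations bring each summand of \<open>metric_part\<close> to the form \<open>q\<^sub>i\<^sub>j a\<^sub>k\<^sub>l\<close>.
\<close>

lemma total_sym4_permuted:
  "total_sym4 (\<chi> i j k l. T$k$l$i$j) = total_sym4 T"
  "total_sym4 (\<chi> i j k l. T$i$k$j$l) = total_sym4 T"
  "total_sym4 (\<chi> i j k l. T$i$l$j$k) = total_sym4 T"
  "total_sym4 (\<chi> i j k l. T$j$k$i$l) = total_sym4 T"
  "total_sym4 (\<chi> i j k l. T$j$l$i$k) = total_sym4 T"
  by (simp_all add: vec_eq_iff total_sym4_def symmetrization4 comps4_def add_ac)

lemma total_sym4_metric_part: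
  "total_sym4 (metric_part x y) = sym_prod (mat 1) (2 *\<^sub>R x + 4 *\<^sub>R y)"
proof -
  define T :: "tensor2 \<Rightarrow> tensor4" where "T a = (\<chi> i j k l. mat 1$i$j * a$k$l)" for a
  have "metric_part x y = T x + (\<chi> i j k l. T x$k$l$i$j) + (\<chi> i j k l. T y$i$k$j$l)
     + (\<chi> i j k l. T y$i$l$j$k) + (\<chi> i j k l. T y$j$k$i$l) + (\<chi> i j k l. T y$j$l$i$k)"
    by (simp add: metric_part_def T_def vec_eq_iff)
  then have "total_sym4 (metric_part x y) = 2 *\<^sub>R total_sym4 (T x) + 4 *\<^sub>R total_sym4 (T y)"
    by (simp only: total_sym4_add total_sym4_permuted) (simp add: vec_eq_iff)
  then show ?thesis
    by (simp only: sym_prod_add_right sym_prod_scaleR_right) (simp add: sym_prod_def T_def)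
qed

lemma sum_delta_left:
  "(\<Sum>k\<in>UNIV. mat 1$k$i * f k) = (f i :: real)" "(\<Sum>k\<in>UNIV. mat 1$i$k * f k) = (f i :: real)"
  by (simp_all add: mat_def if_distrib[of "\<lambda>x. x * _"] cong: if_cong)

lemma symmetric_nth:
  fixes x :: tensor2
  assumes "transpose x = x"
  shows "x$i$j = x$j$i"
  using arg_cong[OF assms, of "\<lambda>a. a$j$i"] by (simp add: Finite_Cartesian_Product.transpose_def)

lemma d_of_metric_part:
  assumes "transpose y = y"
  shows "d_of (metric_part x y) = 3 *\<^sub>R x + trace x *\<^sub>R mat 1 + 4 *\<^sub>R y"
proof -
  have s: "y$i$j = y$j$i" for i j
    using assms by (rule symmetric_nth)
  have "d_of (metric_part x y) $i$j = 3 * x$i$j + trace x * mat 1$i$j + (y$i$j + y$j$i + y$i$j + y$j$i)" for i j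
    unfolding d_of_def metric_part_def vec_lambda_beta sum.distrib sum_delta_left
    by (simp add: mat_def[of 1] trace_def sum_distrib_right)
  then show ?thesis by (simp add: vec_eq_iff s[of _ _])
qed

lemma v_of_metric_part:
  assumes "transpose x = x" "transpose y = y"
  shows "v_of (metric_part x y) = 2 *\<^sub>R x + 5 *\<^sub>R y + trace y *\<^sub>R mat 1"
proof -
  have s: "x$i$j = x$j$i" "y$i$j = y$j$i" for i j
    by (rule symmetric_nth[OF assms(1)] symmetric_nth[OF assms(2)])+
  have sd: "(\<Sum>k\<in>UNIV. f k * mat 1$k$i) = (f i :: real)" for f i
    using sum_delta_left(1)[of i f] by (simp add: mult.commute)
  have "v_of (metric_part x y) $i$j = x$i$j + x$j$i + 3 * y$i$j + y$j$i + y$i$j + trace y * mat 1$i$j" for i j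
    unfolding v_of_def metric_part_def vec_lambda_beta sum.distrib sum_delta_left sd
    by (simp add: mat_def[of 1] trace_def sum_distrib_left s(2)[of i j])
  then show ?thesis by (simp add: vec_eq_iff s)
qed

lemma d_of_add: "d_of (A + B) = d_of A + d_of B" and v_of_add: "v_of (A + B) = v_of A + v_of B"
  by (simp_all add: vec_eq_iff d_of_def v_of_def sum.distrib)

lemma d_of_harmonic4: "harmonic4 H \<Longrightarrow> d_of H = 0" and v_of_harmonic4: "harmonic4 H \<Longrightarrow> v_of H = 0"
proof -
  assume H: "harmonic4 H"
  then show "d_of H = 0" by (simp add: vec_eq_iff d_of_def harmonic4_trace)
  have "(\<Sum>k\<in>UNIV. H$k$i$k$j) = (\<Sum>k\<in>UNIV. H$k$k$i$j)" for i j
    by (intro sum.cong refl harmonic4_swap(2)[OF H])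
  then show "v_of H = 0" by (simp add: vec_eq_iff v_of_def harmonic4_trace[OF H])
qed

text \<open>
  The deviator \<open>diag (1, 1, -2)\<close>, which spans the symmetric traceless tensors that are invariant under
  rotations about the third axis.
\<close>

definition axial :: tensor2 where
  "axial = (\<chi> i j. if i = j then (if i = 3 then -2 else 1) else 0)"

text \<open>
  The coefficients solve the linear system which says that \<open>d\<close> has trace \<open>k\<close> and deviator \<open>\<delta> axial\<close>,
  and \<open>v\<close> has trace \<open>l\<close> and deviator \<open>\<nu> axial\<close>.
\<close>

definition axisymmetric_part :: "real \<Rightarrow> real \<Rightarrow> real \<Rightarrow> real \<Rightarrow> tensor4" where
  "axisymmetric_part k l \<delta> \<nu> = metric_part
     (((2 * k - l) / 30) *\<^sub>R mat 1 + ((5 * \<delta> - 4 * \<nu>) / 7) *\<^sub>R axial)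
     (((3 * l - k) / 60) *\<^sub>R mat 1 + ((3 * \<nu> - 2 * \<delta>) / 7) *\<^sub>R axial)"

lemma axial_square: "axial ** axial = 2 *\<^sub>R mat 1 - axial"
  and axial_inner: "axial \<bullet> axial = 6" "mat 1 \<bullet> axial = 0"
  by (simp_all add: axial_def sum_3 mat_def vec_eq_iff forall_3 matrix_matrix_mult_def inner_vec_def)

lemma transpose_lin: "transpose (a *\<^sub>R mat 1 + b *\<^sub>R axial) = a *\<^sub>R mat 1 + b *\<^sub>R axial"
  by (simp add: vec_eq_iff transpose_def axial_def mat_def)

lemma trace_lin: "trace (a *\<^sub>R mat 1 + b *\<^sub>R axial) = 3 * a"
  by (simp add: trace_def axial_def sum_3 mat_def)

lemma dev_lin: "dev (a *\<^sub>R mat 1 + b *\<^sub>R axial) = b *\<^sub>R axial"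
  by (simp add: dev_def trace_lin)

text \<open>
  The parameters have the intended meaning, and the harmonic summand is \<open>H\<close>.
\<close>

lemma normal_form_parts:
  assumes H: "harmonic4 H"
    and E_def: "E = axisymmetric_part k l \<delta> \<nu> + H"
  shows "d_of E = (k / 3) *\<^sub>R mat 1 + \<delta> *\<^sub>R axial"
    and "v_of E = (l / 3) *\<^sub>R mat 1 + \<nu> *\<^sub>R axial"
    and "H_of E = H"
proof -
  show d: "d_of E = (k / 3) *\<^sub>R mat 1 + \<delta> *\<^sub>R axial"
    by (simp add: E_def axisymmetric_part_def d_of_add d_of_harmonic4[OF H] d_of_metric_part transpose_lin trace_lin)
      (simp add: vec_eq_iff field_simps)
  show v: "v_of E = (l / 3) *\<^sub>R mat 1 + \<nu> *\<^sub>R axial"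
    by (simp add: E_def axisymmetric_part_def v_of_add v_of_harmonic4[OF H] v_of_metric_part transpose_lin trace_lin)
      (simp add: vec_eq_iff field_simps)
  have a: "a_of E = (2 * (k + 2 * l) / 21) *\<^sub>R mat 1 + (2 * (\<delta> + 2 * \<nu>) / 7) *\<^sub>R axial"
    unfolding a_of_def d v by (simp add: vec_eq_iff field_simps)
  have "total_sym4 E = sym_prod (mat 1) (((k + 2 * l) / 15) *\<^sub>R mat 1 + (2 * (\<delta> + 2 * \<nu>) / 7) *\<^sub>R axial) + H"
    unfolding E_def axisymmetric_part_def total_sym4_add total_sym4_harmonic4[OF H]
    unfolding total_sym4_metric_part
    by (simp, rule arg_cong[where f = "sym_prod (mat 1)"], simp add: vec_eq_iff field_simps)
  then show "H_of E = H"
    unfolding H_of_def a dev_lin trace_lin sym_prod_add_right sym_prod_scaleR_right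
    by (simp add: field_simps)
qed

text \<open>
  The vector \<open>e\<^sub>1 + i e\<^sub>2\<close>, an eigenvector of every rotation about the third axis.
\<close>

definition complex_dir :: "3 \<Rightarrow> complex" where
  "complex_dir i = (if i = 1 then 1 else if i = 2 then \<i> else 0)"

text \<open>
  The vector \<open>e\<^sub>3\<close>.
\<close>

definition axis_dir :: "3 \<Rightarrow> real" where
  "axis_dir i = (if i = 3 then 1 else 0)"

text \<open>
  The zonal harmonic of degree four, as the symmetric tensor of the polynomial
  \<open>35 z\<^sup>4 - 30 z\<^sup>2 r\<^sup>2 + 3 r\<^sup>4\<close>.
\<close>

definition zonal :: tensor4 where
  "zonal = (\<chi> i j k l. let e = axis_dir; q = mat 1 :: tensor2 in
     35 * e i * e j * e k * e l
     - 5 * (q$i$j * e k * e l + q$i$k * e j * e l + q$i$l * e j * e k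
          + q$j$k * e i * e l + q$j$l * e i * e k + q$k$l * e i * e j)
     + (q$i$j * q$k$l + q$i$k * q$j$l + q$i$l * q$j$k))"

text \<open>
  The symmetric tensor of the polynomial \<open>Re ((x + i y)\<^sup>4)\<close>.
\<close>

definition tetragonal :: tensor4 where
  "tetragonal = (\<chi> i j k l. let w = complex_dir in Re (w i * w j * w k * w l))"

text \<open>
  The symmetric tensor of the polynomial \<open>4 z Im ((x + i y)\<^sup>3)\<close>.
\<close>

definition trigonal :: tensor4 where
  "trigonal = (\<chi> i j k l. let e = axis_dir; w = complex_dir in
     e i * Im (w j * w k * w l) + e j * Im (w i * w k * w l)
   + e k * Im (w i * w j * w l) + e l * Im (w i * w j * w k))"

lemma mat_sym: "(mat 1 :: tensor2)$j$i = mat 1$i$j"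
  by (simp add: mat_def)

lemma harmonic4_zonal: "harmonic4 zonal"
proof (rule harmonic4I)
  have "\<forall>k l. (\<Sum>i\<in>UNIV. zonal$i$i$k$l) = 0"
    by (simp add: forall_3 sum_3 zonal_def axis_dir_def mat_def Let_def)
  then show "(\<Sum>i\<in>UNIV. zonal$i$i$k$l) = 0" for k l by blast
qed (simp_all add: zonal_def Let_def mat_sym mult_ac add_ac)

lemma harmonic4_tetragonal: "harmonic4 tetragonal"
proof (rule harmonic4I)
  have "\<forall>k l. (\<Sum>i\<in>UNIV. tetragonal$i$i$k$l) = 0"
    by (simp add: forall_3 sum_3 tetragonal_def complex_dir_def Let_def)
  then show "(\<Sum>i\<in>UNIV. tetragonal$i$i$k$l) = 0" for k l by blast
qed (simp_all only: tetragonal_def Let_def vec_lambda_beta mult_ac)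

lemma harmonic4_trigonal: "harmonic4 trigonal"
proof (rule harmonic4I)
  have "\<forall>k l. (\<Sum>i\<in>UNIV. trigonal$i$i$k$l) = 0"
    by (simp add: forall_3 sum_3 trigonal_def axis_dir_def complex_dir_def Let_def)
  then show "(\<Sum>i\<in>UNIV. trigonal$i$i$k$l) = 0" for k l by blast
qed (simp_all only: trigonal_def Let_def vec_lambda_beta mult_ac add_ac)

text \<open>
  The components of the three tensors, first as a formula and then as a table of all 81 values.
\<close>

lemma zonal_eq: "\<forall>i j k l. zonal$i$j$k$l = (let e = axis_dir; q = mat 1 :: tensor2 in
     35 * e i * e j * e k * e l
     - 5 * (q$i$j * e k * e l + q$i$k * e j * e l + q$i$l * e j * e k
          + q$j$k * e i * e l + q$j$l * e i * e k + q$k$l * e i * e j)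
     + (q$i$j * q$k$l + q$i$k * q$j$l + q$i$l * q$j$k))"
  by (simp add: zonal_def)

lemma tetragonal_eq: "\<forall>i j k l. tetragonal$i$j$k$l = Re (complex_dir i * complex_dir j * complex_dir k * complex_dir l)"
  by (simp add: tetragonal_def Let_def)

lemma trigonal_eq: "\<forall>i j k l. trigonal$i$j$k$l = (let e = axis_dir; w = complex_dir in
     e i * Im (w j * w k * w l) + e j * Im (w i * w k * w l)
   + e k * Im (w i * w j * w l) + e l * Im (w i * w j * w k))"
  by (simp add: trigonal_def)

lemmas zonal_nth = zonal_eq[unfolded forall_3 axis_dir_def mat_def Let_def, simplified]
lemmas tetragonal_nth = tetragonal_eq[unfolded forall_3 complex_dir_def, simplified]
lemmas trigonal_nth = trigonal_eq[unfolded forall_3 axis_dir_def complex_dir_def Let_def, simplified]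

text \<open>
  With \<open>B = tetragonal\<close> these are the elasticity tensors fixed by \<open>D\<^sub>4\<close>, with \<open>B = trigonal\<close> those
  fixed by \<open>D\<^sub>3\<close>.
\<close>

definition normal_form :: "tensor4 \<Rightarrow> real \<Rightarrow> real \<Rightarrow> real \<Rightarrow> real \<Rightarrow> real \<Rightarrow> real \<Rightarrow> tensor4" where
  "normal_form B k l \<delta> \<nu> \<alpha> \<beta> = axisymmetric_part k l \<delta> \<nu> + (\<alpha> *\<^sub>R zonal + \<beta> *\<^sub>R B)"

section \<open>Values of the invariants on normal forms\<close>

text \<open>
  When \<open>d\<close>, \<open>v\<close> and \<open>d\<^sub>2\<close> are all combinations of the metric and \<open>axial\<close>, so is \<open>k\<^sub>4\<close>. The square of
  \<open>axial\<close> is \<open>2 mat 1 - axial\<close>, so \<open>k\<^sub>4\<close> is a negative multiple of \<open>axial\<close> unless all three deviators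
  vanish, and the factor is determined by \<open>K4\<close>.
\<close>

lemma invariants_from_d2:
  assumes d: "d_of E = (k / 3) *\<^sub>R mat 1 + \<delta> *\<^sub>R axial"
    and v: "v_of E = (l / 3) *\<^sub>R mat 1 + \<nu> *\<^sub>R axial"
    and d2: "d2_of E = c *\<^sub>R mat 1 + p *\<^sub>R axial"
    and m: "m = 6 * \<delta>^4 + 6 * \<nu>^4 + p\<^sup>2"
  shows "K1 E = k" "L1 E = l" "k4_of E = (- m) *\<^sub>R axial" "K4 E = 6 * m" "K5 E = - 6 * \<delta> * m" "L5 E = - 6 * \<nu> * m"
proof -
  have n: "(norm (x *\<^sub>R axial))\<^sup>2 = 6 * x\<^sup>2" for x
    unfolding power2_norm_eq_inner inner_scaleR_left inner_scaleR_right axial_inner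
    by (simp add: power2_eq_square)
  have n4: "norm (x *\<^sub>R axial) ^ 4 = 36 * x ^ 4" for x
    using arg_cong[OF n[of x], of "\<lambda>y. y\<^sup>2"] by (simp add: power_mult_distrib flip: power_mult)
  have sq: "(x *\<^sub>R axial) ** (x *\<^sub>R axial) = (2 * x\<^sup>2) *\<^sub>R mat 1 + (- x\<^sup>2) *\<^sub>R axial" for x
  proof -
    have "(x *\<^sub>R axial) ** (x *\<^sub>R axial) = x\<^sup>2 *\<^sub>R (axial ** axial)"
      by (simp add: vec_eq_iff matrix_matrix_mult_def sum_distrib_left power2_eq_square mult_ac)
    then show ?thesis by (simp add: axial_square algebra_simps)
  qed
  show "K1 E = k" "L1 E = l" unfolding K1_def L1_def d v by (simp_all add: trace_lin)
  show "K4 E = 6 * m"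
    unfolding K4_def d v d2 dev_lin n n4 m by simp
  have "(norm (\<delta> *\<^sub>R axial))\<^sup>2 *\<^sub>R ((\<delta> *\<^sub>R axial) ** (\<delta> *\<^sub>R axial)) +
     (norm (\<nu> *\<^sub>R axial))\<^sup>2 *\<^sub>R ((\<nu> *\<^sub>R axial) ** (\<nu> *\<^sub>R axial)) + (p *\<^sub>R axial) ** (p *\<^sub>R axial)
     = (2 * m) *\<^sub>R mat 1 + (- m) *\<^sub>R axial"
    unfolding n sq m by (simp add: vec_eq_iff algebra_simps eval_nat_numeral)
  then show k4: "k4_of E = (- m) *\<^sub>R axial"
    unfolding k4_of_def d v d2 dev_lin Let_def by (simp only: dev_lin)
  show "K5 E = - 6 * \<delta> * m" "L5 E = - 6 * \<nu> * m"
    unfolding K5_def L5_def k4 d v by (simp_all add: inner_add_left axial_inner)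
qed

lemma harmonic4_normal:
  "harmonic4 (\<alpha> *\<^sub>R zonal + \<beta> *\<^sub>R tetragonal)" "harmonic4 (\<alpha> *\<^sub>R zonal + \<beta> *\<^sub>R trigonal)"
  by (intro harmonic4_lin harmonic4_zonal harmonic4_tetragonal harmonic4_trigonal)+

lemmas tetragonal_parts = normal_form_parts[OF harmonic4_normal(1) normal_form_def]
lemmas trigonal_parts = normal_form_parts[OF harmonic4_normal(2) normal_form_def]

lemma d2_of_tetragonal: "d2_of (normal_form tetragonal k l \<delta> \<nu> \<alpha> \<beta>)
    = ((280 * \<alpha>\<^sup>2 + 8 * \<beta>\<^sup>2) / 3) *\<^sub>R mat 1 + ((4 * \<beta>\<^sup>2 - 100 * \<alpha>\<^sup>2) / 3) *\<^sub>R axial"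
  unfolding d2_of_def Let_def tetragonal_parts vec_eq_iff forall_3 sum_3 axial_def mat_def
  by (simp add: zonal_nth tetragonal_nth) (simp add: power2_eq_square field_simps)

lemma d2_of_trigonal: "d2_of (normal_form trigonal k l \<delta> \<nu> \<alpha> \<beta>)
    = ((280 * \<alpha>\<^sup>2 + 16 * \<beta>\<^sup>2) / 3) *\<^sub>R mat 1 + ((2 * \<beta>\<^sup>2 - 100 * \<alpha>\<^sup>2) / 3) *\<^sub>R axial"
  unfolding d2_of_def Let_def trigonal_parts vec_eq_iff forall_3 sum_3 axial_def mat_def
  by (simp add: zonal_nth trigonal_nth) (simp add: power2_eq_square field_simps)

lemma I3_tetragonal: "I3 (normal_form tetragonal k l \<delta> \<nu> \<alpha> \<beta>) = 720 * \<alpha>^3 + 48 * \<alpha> * \<beta>\<^sup>2"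
  unfolding I3_inner tetragonal_parts compose4_def inner_vec_def sum_3 
  by (simp add: zonal_nth tetragonal_nth) (simp add: power2_eq_square power3_eq_cube algebra_simps)

lemma I3_trigonal: "I3 (normal_form trigonal k l \<delta> \<nu> \<alpha> \<beta>) = 720 * \<alpha>^3 - 144 * \<alpha> * \<beta>\<^sup>2"
  unfolding I3_inner trigonal_parts compose4_def inner_vec_def sum_3
  by (simp add: zonal_nth trigonal_nth) (simp add: power2_eq_square power3_eq_cube algebra_simps)

lemma K9_tetragonal: "k4_of (normal_form tetragonal k l \<delta> \<nu> \<alpha> \<beta>) = (- m) *\<^sub>R axial
    \<Longrightarrow> K9 (normal_form tetragonal k l \<delta> \<nu> \<alpha> \<beta>) = 72 * \<alpha> * m\<^sup>2"
  unfolding K9_def tetragonal_parts sum_3 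
  by (simp add: zonal_nth tetragonal_nth axial_def) (simp add: power2_eq_square algebra_simps)

lemma K9_trigonal: "k4_of (normal_form trigonal k l \<delta> \<nu> \<alpha> \<beta>) = (- m) *\<^sub>R axial
    \<Longrightarrow> K9 (normal_form trigonal k l \<delta> \<nu> \<alpha> \<beta>) = 72 * \<alpha> * m\<^sup>2"
  unfolding K9_def trigonal_parts sum_3
  by (simp add: zonal_nth trigonal_nth axial_def) (simp add: power2_eq_square algebra_simps)

text \<open>
  The trace of the symmetrization of a fifth-order tensor is the average of the contractions over all
  ordered pairs of positions. In the application only the pairs of the first position with one of the last three
  contribute.
\<close>

lemma contract_symmetrization5:
  assumes pair12: "\<And>a b c. (\<Sum>p\<in>UNIV. T [p, p, a, b, c]) = 0"
    and pair13: "\<And>a b c. (\<Sum>p\<in>UNIV. T [p, a, p, b, c]) = V a b c"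
    and pair14: "\<And>a b c. (\<Sum>p\<in>UNIV. T [p, a, b, p, c]) = V a b c"
    and pair15: "\<And>a b c. (\<Sum>p\<in>UNIV. T [p, a, b, c, p]) = V a b c"
    and pair23: "\<And>a b c. (\<Sum>p\<in>UNIV. T [a, p, p, b, c]) = 0"
    and pair24: "\<And>a b c. (\<Sum>p\<in>UNIV. T [a, p, b, p, c]) = 0"
    and pair25: "\<And>a b c. (\<Sum>p\<in>UNIV. T [a, p, b, c, p]) = 0"
    and pair34: "\<And>a b c. (\<Sum>p\<in>UNIV. T [a, b, p, p, c]) = 0"
    and pair35: "\<And>a b c. (\<Sum>p\<in>UNIV. T [a, b, p, c, p]) = 0"
    and pair45: "\<And>a b c. (\<Sum>p\<in>UNIV. T [a, b, c, p, p]) = 0"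
  shows "contract (symmetrization T) [i, j, k]
    = (V i j k + V i k j + V j i k + V j k i + V k i j + V k j i) / 20"
proof -
  have "contract (symmetrization T) [i, j, k] = (\<Sum>p\<in>UNIV. symsum 5 T [p, p, i, j, k]) / 120"
    by (simp add: contract_def symmetrization_symsum sum_divide_distrib fact_numeral eval_nat_numeral)
  also have "(\<Sum>p\<in>UNIV. symsum 5 T [p, p, i, j, k])
     = 6 * (V i j k + V i k j + V j i k + V j k i + V k i j + V k j i)"
    by (simp add: eval_nat_numeral symsum_Suc symsum_0 atMost_Suc atMost_0 sum.distrib
       sum_distrib_left[symmetric] pair12 pair13 pair14 pair15 pair23 pair24 pair25 pair34 pair35 pair45)
  finally show ?thesis by simp
qed

text \<open>
  The contraction to which the trace of \<open>H \<times> a\<close> reduces.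
\<close>

definition cross_trace :: "tensor2 \<Rightarrow> tensor4 \<Rightarrow> 3 \<Rightarrow> 3 \<Rightarrow> 3 \<Rightarrow> real" where
  "cross_trace a H i j k = (\<Sum>x\<in>UNIV. \<Sum>p\<in>UNIV. \<Sum>r\<in>UNIV. a$x$p * levi_civita p i r * H$r$x$j$k)"

text \<open>
  The contractions over other pairs of positions vanish: they contract the Levi-Civita tensor with
  the symmetric tensor \<open>a\<close> or \<open>H\<close>, or take a trace of \<open>H\<close>.
\<close>

lemma K10_tensor_harmonic4:
  assumes a: "transpose a = a" and H: "harmonic4 H"
  shows "K10_tensor a H [i, j, k] = (cross_trace a H i j k + cross_trace a H i k j + cross_trace a H j i k
     + cross_trace a H j k i + cross_trace a H k i j + cross_trace a H k j i) / 20"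
proof -
  define W where "W = (\<lambda>is. \<Sum>p\<in>UNIV. \<Sum>r\<in>UNIV.
     comps2 a (take (2 - 1) is @ [p]) * levi_civita p (is ! (2 - 1)) r * comps4 H (r # drop 2 is))"
  have W: "W [x, y, b, c, d] = (\<Sum>p\<in>UNIV. \<Sum>r\<in>UNIV. a$x$p * levi_civita p y r * H$r$b$c$d)" for x y b c d
    by (simp add: W_def comps2_def comps4_def)
  have sa: "a$2$1 = a$1$2" "a$3$1 = a$1$3" "a$3$2 = a$2$3"
    by (rule symmetric_nth[OF a])+
  have p12: "(\<Sum>p\<in>UNIV. W [p, p, b, c, d]) = 0" for b c d
    by (simp add: W sum_3 levi_civita_def sa)
  have p23: "(\<Sum>p\<in>UNIV. W [b, p, p, c, d]) = 0" for b c d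
    by (simp add: W sum_3 levi_civita_def harmonic4_swap(1)[OF H, of 2 1] harmonic4_swap(1)[OF H, of 3 1]
      harmonic4_swap(1)[OF H, of 3 2])
  have p34: "(\<Sum>p\<in>UNIV. W [b, c, p, p, d]) = 0" for b c d
  proof -
    have "(\<Sum>x\<in>UNIV. H$r$x$x$d) = 0" for r
    proof -
      have "(\<Sum>x\<in>UNIV. H$r$x$x$d) = (\<Sum>x\<in>UNIV. H$x$x$r$d)"
        by (intro sum.cong refl trans[OF harmonic4_swap(1)[OF H] harmonic4_swap(2)[OF H]])
      then show ?thesis by (simp add: harmonic4_trace[OF H])
    qed
    moreover have "(\<Sum>x\<in>UNIV. W [b, c, x, x, d])
        = (\<Sum>p\<in>UNIV. \<Sum>r\<in>UNIV. \<Sum>x\<in>UNIV. a$b$p * levi_civita p c r * H$r$x$x$d)"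
      unfolding W by (rule trans[OF sum.swap]) (intro sum.cong refl sum.swap)
    ultimately show ?thesis by (simp add: sum_distrib_left[symmetric])
  qed
  have s1: "W [x, y, c, b, d] = W [x, y, b, c, d]" and s2: "W [x, y, b, d, c] = W [x, y, b, c, d]" for x y b c d
    by (simp_all only: W harmonic4_swap(2)[OF H, of _ c b] harmonic4_swap(3)[OF H, of _ b d c])
  have p13: "(\<Sum>p\<in>UNIV. W [p, b, p, c, d]) = cross_trace a H b c d" for b c d
    by (simp add: W cross_trace_def)
  have "contract (symmetrization W) [i, j, k] = (cross_trace a H i j k + cross_trace a H i k j + cross_trace a H j i k
     + cross_trace a H j k i + cross_trace a H k i j + cross_trace a H k j i) / 20"
  proof (rule contract_symmetrization5)
    fix b c d
    show "(\<Sum>p\<in>UNIV. W [p, b, c, p, d]) = cross_trace a H b c d"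
      "(\<Sum>p\<in>UNIV. W [p, b, c, d, p]) = cross_trace a H b c d"
      using p13[of b c d] by (simp_all only: s1[of _ _ _ c] s2[of _ _ c _ d])
    show "(\<Sum>p\<in>UNIV. W [b, p, c, p, d]) = 0" "(\<Sum>p\<in>UNIV. W [b, p, c, d, p]) = 0"
      using p23[of b c d] by (simp_all only: s1[of _ _ _ c] s2[of _ _ c _ d])
    show "(\<Sum>p\<in>UNIV. W [b, c, p, d, p]) = 0" "(\<Sum>p\<in>UNIV. W [b, c, d, p, p]) = 0"
      using p34[of b c d] by (simp_all only: s1[of _ _ _ d] s2[of _ _ _ _ d])
  qed (rule p12 p13 p23 p34)+
  then show ?thesis by (simp add: K10_tensor_def gen_cross_def W_def)
qed

lemma transpose_scaled_axial: "transpose (c *\<^sub>R axial) = c *\<^sub>R axial"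
  using transpose_lin[of 0 c] by simp

lemma cross_trace_axial:
  assumes H: "harmonic4 H"
  shows "cross_trace (c *\<^sub>R axial) H i j k
    = 3 * c * ((if i = 2 then H$1$3$j$k else 0) - (if i = 1 then H$2$3$j$k else 0))"
proof -
  have s: "H$3$1$j$k = H$1$3$j$k" "H$3$2$j$k = H$2$3$j$k" "H$2$1$j$k = H$1$2$j$k"
    by (rule harmonic4_swap(1)[OF H])+
  have "\<forall>i. cross_trace (c *\<^sub>R axial) H i j k
    = 3 * c * ((if i = 2 then H$1$3$j$k else 0) - (if i = 1 then H$2$3$j$k else 0))"
    by (simp add: forall_3 cross_trace_def sum_3 axial_def levi_civita_def s)
  then show ?thesis by blast
qed

text \<open>
  The value vanishes because no nonzero totally symmetric third-order tensor is
  invariant under \<open>D\<^sub>4\<close> and the contracted tensor is.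
\<close>

lemma K10_tetragonal:
  assumes "k4_of (normal_form tetragonal k l \<delta> \<nu> \<alpha> \<beta>) = (- m) *\<^sub>R axial"
  shows "K10 (normal_form tetragonal k l \<delta> \<nu> \<alpha> \<beta>) = 0"
proof -
  define H where "H = \<alpha> *\<^sub>R zonal + \<beta> *\<^sub>R tetragonal"
  have H: "harmonic4 H" unfolding H_def by (rule harmonic4_normal)
  define c where "c = cross_trace ((- m) *\<^sub>R axial) H"
  have z: "\<forall>i j k. c i j k + c j i k + c k i j = 0"
    unfolding c_def cross_trace_axial[OF H] forall_3
    by (simp add: H_def zonal_nth tetragonal_nth)
  have sw: "c i k j = c i j k" for i j k
    unfolding c_def cross_trace_def
    by (simp only: harmonic4_swap(3)[OF H, of _ _ k j])
  have "c i j k + c i k j + c j i k + c j k i + c k i j + c k j i = 0" for i j k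
    using z[rule_format, of i j k] sw[of i k j] sw[of j k i] sw[of k j i] by linarith
  then have "K10_tensor ((- m) *\<^sub>R axial) H [i, j, k] = 0" for i j k
    by (simp only: K10_tensor_harmonic4[OF transpose_scaled_axial H]
        c_def[symmetric] div_0)
  then show ?thesis
    by (simp add: K10_sum assms tetragonal_parts H_def[symmetric] sum_lists)
qed

lemma K10_trigonal:
  assumes "k4_of (normal_form trigonal k l \<delta> \<nu> \<alpha> \<beta>) = (- m) *\<^sub>R axial"
  shows "K10 (normal_form trigonal k l \<delta> \<nu> \<alpha> \<beta>) = 81 / 25 * m\<^sup>2 * \<beta>\<^sup>2"
proof -
  define H where "H = \<alpha> *\<^sub>R zonal + \<beta> *\<^sub>R trigonal"
  have H: "harmonic4 H" unfolding H_def by (rule harmonic4_normal)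
  have "K10 (normal_form trigonal k l \<delta> \<nu> \<alpha> \<beta>) = (\<Sum>i\<in>UNIV. \<Sum>j\<in>UNIV. \<Sum>k\<in>UNIV.
      (K10_tensor ((- m) *\<^sub>R axial) H [i, j, k])\<^sup>2)"
    by (simp add: K10_sum assms trigonal_parts H_def[symmetric] sum_lists power2_eq_square)
  also have "\<dots> = 81 / 25 * m\<^sup>2 * \<beta>\<^sup>2"
    unfolding K10_tensor_harmonic4[OF transpose_scaled_axial H] cross_trace_axial[OF H] sum_3
    by (simp add: H_def zonal_nth trigonal_nth) (simp add: power2_eq_square field_simps)
  finally show ?thesis .
qed

section \<open>Symmetries of the normal forms\<close>

lemma rot_e3_nth [simp]:
  "rot_e3 t$1$1 = cos t" "rot_e3 t$1$2 = - sin t" "rot_e3 t$1$3 = 0"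
  "rot_e3 t$2$1 = sin t" "rot_e3 t$2$2 = cos t" "rot_e3 t$2$3 = 0"
  "rot_e3 t$3$1 = 0" "rot_e3 t$3$2 = 0" "rot_e3 t$3$3 = 1"
  by (simp_all add: rot_e3_def)

lemma rot_e1_nth [simp]:
  "rot_e1 t$1$1 = 1" "rot_e1 t$1$2 = 0" "rot_e1 t$1$3 = 0"
  "rot_e1 t$2$1 = 0" "rot_e1 t$2$2 = cos t" "rot_e1 t$2$3 = - sin t"
  "rot_e1 t$3$1 = 0" "rot_e1 t$3$2 = sin t" "rot_e1 t$3$3 = cos t"
  by (simp_all add: rot_e1_def)

lemma sin_sq_plus: "sin t * sin t + cos t * cos t = (1::real)" "cos t * cos t + sin t * sin t = (1::real)"
  using sin_cos_squared_add[of t] by (simp_all add: power2_eq_square)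

lemma rotation_rot_e3: "rotation_matrix (rot_e3 t)"
  unfolding rotation_matrix_def orthogonal_matrix
  by (simp add: det_3 vec_eq_iff forall_3 matrix_matrix_mult_def sum_3 Finite_Cartesian_Product.transpose_def
      mat_def sin_sq_plus)

lemma rotation_rot_e1: "rotation_matrix (rot_e1 t)"
  unfolding rotation_matrix_def orthogonal_matrix
  by (simp add: det_3 vec_eq_iff forall_3 matrix_matrix_mult_def sum_3 Finite_Cartesian_Product.transpose_def
      mat_def sin_sq_plus)

lemma rot_e3_add: "rot_e3 (s + t) = rot_e3 s ** rot_e3 t"
  by (simp add: vec_eq_iff forall_3 matrix_matrix_mult_def sum_3 cos_add sin_add)

lemma rot_e3_0: "rot_e3 0 = mat 1"
  by (simp add: vec_eq_iff forall_3 mat_def)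

lemma rot_e1_pi_square: "rot_e1 pi ** rot_e1 pi = mat 1"
  by (simp add: vec_eq_iff forall_3 matrix_matrix_mult_def sum_3 mat_def)

text \<open>
  The contraction with a row of \<open>g\<close>, extended to complex vectors.
\<close>

definition row_contract_complex :: "tensor2 \<Rightarrow> 3 \<Rightarrow> (3 \<Rightarrow> complex) \<Rightarrow> complex" where
  "row_contract_complex g i X = (\<Sum>p\<in>UNIV. of_real (g$i$p) * X p)"

lemma row_contract_complex_mult_left: "row_contract_complex g i (\<lambda>p. c * X p) = c * row_contract_complex g i X"
  by (simp add: row_contract_complex_def sum_distrib_left mult.left_commute)

lemma row_contract_complex_mult_right: "row_contract_complex g i (\<lambda>p. X p * c) = row_contract_complex g i X * c"
  by (simp add: row_contract_complex_def sum_distrib_right mult.assoc)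

lemma row_contract_Re: "row_contract g i (\<lambda>p. Re (X p)) = Re (row_contract_complex g i X)"
  and row_contract_Im: "row_contract g i (\<lambda>p. Im (X p)) = Im (row_contract_complex g i X)"
  by (simp_all add: row_contract_def row_contract_complex_def)

lemma row_contract_rot_e3_axis: "row_contract (rot_e3 t) i axis_dir = axis_dir i"
proof -
  have "\<forall>i. row_contract (rot_e3 t) i axis_dir = axis_dir i"
    by (simp add: forall_3 row_contract_def sum_3 axis_dir_def)
  then show ?thesis by blast
qed

lemma row_contract_rot_e1_axis: "row_contract (rot_e1 pi) i axis_dir = - axis_dir i"
proof -
  have "\<forall>i. row_contract (rot_e1 pi) i axis_dir = - axis_dir i"
    by (simp add: forall_3 row_contract_def sum_3 axis_dir_def)
  then show ?thesis by blast
qed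

lemma row_contract_complex_rot_e3_dir: "row_contract_complex (rot_e3 t) i complex_dir = cis (- t) * complex_dir i"
proof -
  have "\<forall>i. row_contract_complex (rot_e3 t) i complex_dir = cis (- t) * complex_dir i"
    by (simp add: forall_3 row_contract_complex_def sum_3 complex_dir_def complex_eq_iff)
  then show ?thesis by blast
qed

lemma row_contract_complex_rot_e1_dir: "row_contract_complex (rot_e1 pi) i complex_dir = cnj (complex_dir i)"
proof -
  have "\<forall>i. row_contract_complex (rot_e1 pi) i complex_dir = cnj (complex_dir i)"
    by (simp add: forall_3 row_contract_complex_def sum_3 complex_dir_def)
  then show ?thesis by blast
qed

lemma row_contract_mat1:
  assumes "rotation_matrix g"
  shows "row_contract g i (\<lambda>p. row_contract g j (\<lambda>q. mat 1$p$q)) = mat 1$i$j"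
  using act2_nth[of g "mat 1" i j] act2_mat[OF assms] by simp

lemma row_contract_minus: "row_contract g i (\<lambda>p. - X p) = - row_contract g i X"
  by (simp add: row_contract_def sum_negf)

lemma act_zonal:
  assumes g: "rotation_matrix g" and e: "\<And>i. row_contract g i axis_dir = s * axis_dir i" and s: "s = 1 \<or> s = -1"
  shows "act g zonal = zonal"
  using s
  by (elim disjE) (simp_all add: vec_eq_iff act_nth zonal_def Let_def row_contract_minus row_contract_add row_contract_diff row_contract_mult_left row_contract_mult_right
        e row_contract_mat1[OF g])

lemma act_metric_part:
  assumes g: "rotation_matrix g"
  shows "act g (metric_part x y) = metric_part (act2 g x) (act2 g y)"
  by (simp add: vec_eq_iff act_nth metric_part_def act2_nth row_contract_add row_contract_mult_left row_contract_mult_right row_contract_mat1[OF g])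

lemma act2_axial_rot: "act2 (rot_e3 t) axial = axial" "act2 (rot_e1 pi) axial = axial"
  by (simp_all add: vec_eq_iff forall_3 act2_nth row_contract_def sum_3 axial_def sin_sq_plus mult.commute)

lemma act_axisymmetric_part:
  assumes "rotation_matrix g" "act2 g axial = axial"
  shows "act g (axisymmetric_part k l \<delta> \<nu>) = axisymmetric_part k l \<delta> \<nu>"
  using assms by (simp add: axisymmetric_part_def act_metric_part act2_add act2_scaleR act2_mat)

lemma act_normal_form:
  "act (rot_e3 t) (normal_form B k l \<delta> \<nu> \<alpha> \<beta>) = normal_form (act (rot_e3 t) B) k l \<delta> \<nu> \<alpha> \<beta>"
  "act (rot_e1 pi) (normal_form B k l \<delta> \<nu> \<alpha> \<beta>) = normal_form (act (rot_e1 pi) B) k l \<delta> \<nu> \<alpha> \<beta>"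
  using act_zonal[OF rotation_rot_e3, where s = 1] act_zonal[OF rotation_rot_e1, where s = "-1"]
  by (simp_all add: normal_form_def act_add act_scaleR act_axisymmetric_part rotation_rot_e3 rotation_rot_e1
      act2_axial_rot row_contract_rot_e3_axis row_contract_rot_e1_axis)

lemma row_contract_complex_triple:
  fixes g h j k
  defines "w \<equiv> complex_dir"
  shows "row_contract_complex (rot_e3 t) h (\<lambda>p. row_contract_complex (rot_e3 t) j (\<lambda>q. row_contract_complex (rot_e3 t) k (\<lambda>r. w p * w q * w r)))
      = cis (- (3 * t)) * (w h * w j * w k)"
    and "row_contract_complex (rot_e1 pi) h (\<lambda>p. row_contract_complex (rot_e1 pi) j (\<lambda>q. row_contract_complex (rot_e1 pi) k (\<lambda>r. w p * w q * w r)))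
      = cnj (w h * w j * w k)"
proof -
  have "cis (- (3 * t)) = cis (- t) * cis (- t) * cis (- t)"
    by (simp add: cis_mult)
  then show "row_contract_complex (rot_e3 t) h (\<lambda>p. row_contract_complex (rot_e3 t) j (\<lambda>q. row_contract_complex (rot_e3 t) k (\<lambda>r. w p * w q * w r)))
      = cis (- (3 * t)) * (w h * w j * w k)"
    unfolding w_def by (simp add: row_contract_complex_mult_left row_contract_complex_mult_right row_contract_complex_rot_e3_dir)
qed (simp add: w_def row_contract_complex_mult_left row_contract_complex_mult_right row_contract_complex_rot_e1_dir)

text \<open>
  Rotating by \<open>t\<close> multiplies the eigenvector \<open>complex_dir\<close> by the phase \<open>-t\<close>, and hence its fourth
  power by the phase \<open>-4 t\<close>.
\<close>

lemma act_rot_e3_tetragonal: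
  "act (rot_e3 t) tetragonal = (\<chi> i j k l. let w = complex_dir in Re (cis (- (4 * t)) * (w i * w j * w k * w l)))"
proof -
  have "cis (- (4 * t)) = cis (- t) * cis (- t) * cis (- t) * cis (- t)"
    by (simp add: cis_mult)
  then have c: "cis (- t) * a * (cis (- t) * b) * (cis (- t) * d) * (cis (- t) * e) = cis (- (4 * t)) * (a * b * d * e)"
    for a b d e by simp
  show ?thesis
    by (simp only: vec_eq_iff act_nth tetragonal_def Let_def vec_lambda_beta row_contract_Re row_contract_complex_mult_left row_contract_complex_mult_right
        row_contract_complex_rot_e3_dir c simp_thms)
qed

lemma act_rot_e1_tetragonal: "act (rot_e1 pi) tetragonal = tetragonal"
  by (simp only: vec_eq_iff act_nth tetragonal_def Let_def vec_lambda_beta row_contract_Re row_contract_complex_mult_left row_contract_complex_mult_right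
      row_contract_complex_rot_e1_dir complex_cnj_mult[symmetric] cnj.simps simp_thms)

lemma act_rot_e3_trigonal:
  "act (rot_e3 t) trigonal = (\<chi> i j k l. let e = axis_dir; w = complex_dir; f = (\<lambda>z. Im (cis (- (3 * t)) * z)) in
     e i * f (w j * w k * w l) + e j * f (w i * w k * w l)
   + e k * f (w i * w j * w l) + e l * f (w i * w j * w k))"
  by (simp only: vec_eq_iff act_nth trigonal_def Let_def vec_lambda_beta row_contract_add row_contract_mult_left row_contract_mult_right
      row_contract_Im row_contract_complex_triple row_contract_rot_e3_axis simp_thms)

lemma act_rot_e1_trigonal: "act (rot_e1 pi) trigonal = trigonal"
  by (simp only: vec_eq_iff act_nth trigonal_def Let_def vec_lambda_beta row_contract_add row_contract_mult_left row_contract_mult_right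
      row_contract_Im row_contract_complex_triple row_contract_rot_e1_axis cnj.simps minus_mult_minus simp_thms)

lemma normal_form_minus: "normal_form (- B) k l \<delta> \<nu> \<alpha> \<beta> = normal_form B k l \<delta> \<nu> \<alpha> (- \<beta>)"
  by (simp add: normal_form_def)

lemma rotation_fixing_axis:
  assumes g: "rotation_matrix g" and z: "g$1$3 = 0" "g$2$3 = 0" "g$3$3 = 1"
  obtains t where "0 \<le> t" "g = rot_e3 t"
proof -
  have c: "(\<Sum>k\<in>UNIV. g$k$p * g$k$q) = (if p = q then 1 else 0)" for p q
    by (rule rot_columns[OF g])
  have z3: "g$3$1 = 0" "g$3$2 = 0"
    using c[of 3 1] c[of 3 2] z by (simp_all add: sum_3)
  have 1: "g$1$1 * g$1$1 + g$2$1 * g$2$1 = 1" and 2: "g$1$1 * g$1$2 + g$2$1 * g$2$2 = 0"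
    using c[of 1 1] c[of 1 2] z3 by (simp_all add: sum_3)
  have "det g = 1" using g by (simp add: rotation_matrix_def)
  then have 3: "g$1$1 * g$2$2 - g$1$2 * g$2$1 = 1"
    by (simp add: det_3 z z3)
  \<comment> \<open>The determinant excludes a reflection in the plane.\<close>
  have 4: "g$2$2 = g$1$1" "g$1$2 = - g$2$1" using 1 2 3 by algebra+
  obtain t where t: "0 \<le> t" "g$1$1 = cos t" "g$2$1 = sin t"
    using sincos_total_2pi[of "g$1$1" "g$2$1"] 1 by (auto simp: power2_eq_square)
  have "g = rot_e3 t"
    using z z3 4 t by (simp add: vec_eq_iff forall_3)
  with t(1) that show ?thesis by blast
qed

text \<open>
  The stabilizer of \<open>axial\<close> is \<open>O(2)\<close>: the off-axis components of the last column of \<open>g\<close> vanish, so \<open>g\<close>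
  preserves or reverses the third axis.
\<close>

lemma axial_stabilizer:
  assumes g: "rotation_matrix g" and a: "act2 g axial = axial"
  obtains t where "0 \<le> t" "g = rot_e3 t \<or> g = rot_e3 t ** rot_e1 pi"
proof -
  have "act2 g axial$i$i = (\<Sum>p\<in>UNIV. g$i$p * g$i$p) - 3 * (g$i$3)\<^sup>2" for i
    by (simp add: act2_nth row_contract_def sum_3 axial_def power2_eq_square algebra_simps)
  then have r: "axial$i$i = 1 - 3 * (g$i$3)\<^sup>2" for i
    by (simp add: a rot_rows[OF g])
  have z: "g$1$3 = 0" "g$2$3 = 0" "(g$3$3)\<^sup>2 = 1"
    using r[of 1] r[of 2] r[of 3] by (simp_all add: axial_def)
  show ?thesis
  proof (cases "g$3$3 = 1")
    case True
    then show ?thesis using rotation_fixing_axis[OF g] z that by blast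
  next
    case False
    then have m: "g$3$3 = -1" using z(3) by (simp add: power2_eq_1_iff)
    let ?h = "g ** rot_e1 pi"
    have "?h$1$3 = 0" "?h$2$3 = 0" "?h$3$3 = 1"
      using z m by (simp_all add: matrix_matrix_mult_def sum_3)
    then obtain t where t: "0 \<le> t" "?h = rot_e3 t"
      using rotation_fixing_axis[OF rotation_mult[OF g rotation_rot_e1]] by blast
    have "g = rot_e3 t ** rot_e1 pi"
      by (simp add: t(2)[symmetric] matrix_mul_assoc[symmetric] rot_e1_pi_square)
    then show ?thesis using t(1) that by blast
  qed
qed

lemma generate_rot_e3:
  assumes "rot_e3 s \<in> S" 
  shows "rot_e3 (of_nat j * s) \<in> generate SO3 S"
proof (induction j)
  case 0
  then show ?case using generate.one[of SO3 S] by (simp add: rot_e3_0)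
next
  case (Suc j)
  have "rot_e3 (of_nat (Suc j) * s) = rot_e3 s ** rot_e3 (of_nat j * s)"
    by (simp add: rot_e3_add[symmetric] algebra_simps)
  then show ?case
    using generate.eng[OF generate.incl[OF assms] Suc] by simp
qed

text \<open>
  A nonzero \<open>k\<^sub>4\<close> forces every symmetry to preserve the axis; the angles that occur are then
  restricted to multiples of \<open>2 \<pi> / n\<close>.
\<close>

lemma stratum_dihedralI:
  assumes n: "n \<noteq> 0" and E: "E \<in> Ela" and k4: "k4_of E = c *\<^sub>R axial" "c \<noteq> 0"
    and fix1: "act (rot_e1 pi) E = E" and fix3: "act (rot_e3 (2 * pi / n)) E = E"
    and ang: "\<And>t. act (rot_e3 t) E = E \<Longrightarrow> cos (n * t) = 1"
  shows "E \<in> stratum (dihedral n)"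
proof (rule stratumI[OF E])
  have "dihedral n \<subseteq> symmetry_group E"
    unfolding dihedral_def
    by (rule group.generate_subgroup_incl[OF group_SO3 _ subgroup_symmetry_group])
      (use fix1 fix3 in \<open>simp add: symmetry_group_def rotation_rot_e1 rotation_rot_e3\<close>)
  moreover have "g \<in> dihedral n" if "g \<in> symmetry_group E" for g
  proof -
    have g: "rotation_matrix g" "act g E = E" using that by (auto simp: symmetry_group_def)
    have "act2 g (k4_of E) = k4_of E" using k4_of_act[OF g(1), of E] g(2) by simp
    then have "act2 g axial = axial" using k4 by (simp add: act2_scaleR)
    then obtain t where t: "0 \<le> t" "g = rot_e3 t \<or> g = rot_e3 t ** rot_e1 pi"
      using axial_stabilizer[OF g(1)] by blast
    then have "act (rot_e3 t) E = E"
      using g(2) fix1 by (auto simp: act_mult)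
    then have "cos (n * t) = 1" by (rule ang)
    then obtain x :: int where x: "n * t = of_int x * 2 * pi"
      using cos_one_2pi_int by auto
    \<comment> \<open>The angle was chosen nonnegative so that \<open>rot_e3 t\<close> is a power of the generator with a natural exponent.\<close>
    have "0 \<le> of_int x * 2 * pi" unfolding x[symmetric] using t(1) by simp
    then have "0 \<le> x" using pi_gt_zero by (auto simp: zero_le_mult_iff)
    then have "t = of_nat (nat x) * (2 * pi / n)"
      using x n by (simp add: field_simps)
    then have "rot_e3 t \<in> dihedral n"
      unfolding dihedral_def using generate_rot_e3[of "2 * pi / n" _ "nat x"] by simp
    moreover have "rot_e1 pi \<in> dihedral n"
      unfolding dihedral_def by (rule generate.incl) simp
    ultimately show ?thesis
      using t(2) generate.eng[of "rot_e3 t" SO3 _ "rot_e1 pi"] unfolding dihedral_def by auto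
  qed
  ultimately show "symmetry_group E = dihedral n" by blast
qed

lemma harmonic4_Ela: 
  assumes "harmonic4 H"
  shows "H \<in> Ela"
proof -
  have "H$i$j$k$l = H$k$l$i$j" for i j k l
    using harmonic4_swap[OF assms] by metis
  then show ?thesis using harmonic4_swap(1)[OF assms] by (simp add: Ela_def)
qed

lemma axisymmetric_part_Ela: "axisymmetric_part k l \<delta> \<nu> \<in> Ela"
proof -
  have "metric_part x y \<in> Ela" if "transpose x = x" "transpose y = y" for x y
  proof -
    have s: "x$i$j = x$j$i" "y$i$j = y$j$i" for i j
      by (rule symmetric_nth[OF that(1)] symmetric_nth[OF that(2)])+
    show ?thesis
      unfolding Ela_def metric_part_def
      by (simp add: add_ac) (auto simp: s mat_sym add_ac mult_ac)
  qed
  then show ?thesis by (simp add: axisymmetric_part_def transpose_lin)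
qed

lemma Ela_add: "A \<in> Ela \<Longrightarrow> B \<in> Ela \<Longrightarrow> A + B \<in> Ela"
  unfolding Ela_def by (simp only: mem_Collect_eq vector_add_component) metis

lemma normal_form_Ela: "normal_form tetragonal k l \<delta> \<nu> \<alpha> \<beta> \<in> Ela" "normal_form trigonal k l \<delta> \<nu> \<alpha> \<beta> \<in> Ela"
  unfolding normal_form_def
  by (intro Ela_add axisymmetric_part_Ela harmonic4_Ela harmonic4_normal)+

section \<open>Elasticity tensors fixed by a dihedral group\<close>

lemma Ela_sym:
  assumes "E \<in> Ela"
  shows "E$i$j$k$l = E$k$l$i$j" "E$i$j$k$l = E$j$i$k$l" "E$i$j$k$l = E$i$j$l$k"
proof -
  show 1: "E$i$j$k$l = E$k$l$i$j" and 2: "E$i$j$k$l = E$j$i$k$l" for i j k l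
    using assms unfolding Ela_def by blast+
  show "E$i$j$k$l = E$i$j$l$k"
    using 1[of i j k l] 1[of l k i j] 2[of k l i j] by simp
qed

text \<open>
  The rewrite rules that bring each component to one of the 21 independent ones. Index pairs are
  ordered 11, 22, 33, 23, 13, 12.
\<close>

lemma Ela_voigt:
  assumes "E \<in> Ela"
  shows "E$2$1$k$l = E$1$2$k$l" "E$3$1$k$l = E$1$3$k$l" "E$3$2$k$l = E$2$3$k$l"
    "E$k$l$2$1 = E$k$l$1$2" "E$k$l$3$1 = E$k$l$1$3" "E$k$l$3$2 = E$k$l$2$3"
    "E$2$2$1$1 = E$1$1$2$2" "E$3$3$1$1 = E$1$1$3$3" "E$2$3$1$1 = E$1$1$2$3" "E$1$3$1$1 = E$1$1$1$3"
    "E$1$2$1$1 = E$1$1$1$2" "E$3$3$2$2 = E$2$2$3$3" "E$2$3$2$2 = E$2$2$2$3" "E$1$3$2$2 = E$2$2$1$3"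
    "E$1$2$2$2 = E$2$2$1$2" "E$2$3$3$3 = E$3$3$2$3" "E$1$3$3$3 = E$3$3$1$3" "E$1$2$3$3 = E$3$3$1$2"
    "E$1$3$2$3 = E$2$3$1$3" "E$1$2$2$3 = E$2$3$1$2" "E$1$2$1$3 = E$1$3$1$2"
  by (rule Ela_sym[OF assms])+

lemma Ela_eqI:
  assumes A: "A \<in> Ela" and B: "B \<in> Ela"
    and "A$1$1$1$1 = B$1$1$1$1" "A$1$1$2$2 = B$1$1$2$2" "A$1$1$3$3 = B$1$1$3$3"
      "A$1$1$2$3 = B$1$1$2$3" "A$1$1$1$3 = B$1$1$1$3" "A$1$1$1$2 = B$1$1$1$2"
      "A$2$2$2$2 = B$2$2$2$2" "A$2$2$3$3 = B$2$2$3$3" "A$2$2$2$3 = B$2$2$2$3"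
      "A$2$2$1$3 = B$2$2$1$3" "A$2$2$1$2 = B$2$2$1$2" "A$3$3$3$3 = B$3$3$3$3"
      "A$3$3$2$3 = B$3$3$2$3" "A$3$3$1$3 = B$3$3$1$3" "A$3$3$1$2 = B$3$3$1$2"
      "A$2$3$2$3 = B$2$3$2$3" "A$2$3$1$3 = B$2$3$1$3" "A$2$3$1$2 = B$2$3$1$2"
      "A$1$3$1$3 = B$1$3$1$3" "A$1$3$1$2 = B$1$3$1$2" "A$1$2$1$2 = B$1$2$1$2"
  shows "A = B"
  unfolding vec_eq_iff forall_3
  by (simp only: Ela_voigt[OF A] Ela_voigt[OF B] assms simp_thms)

lemma row_contract_rot_e3:
  "row_contract (rot_e3 t) 1 X = cos t * X 1 - sin t * X 2"
  "row_contract (rot_e3 t) 2 X = sin t * X 1 + cos t * X 2"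
  "row_contract (rot_e3 t) 3 X = X 3"
  by (simp_all add: row_contract_def sum_3)

lemma row_contract_rot_e1_pi:
  "row_contract (rot_e1 pi) 1 X = X 1" "row_contract (rot_e1 pi) 2 X = - X 2" "row_contract (rot_e1 pi) 3 X = - X 3"
  by (simp_all add: row_contract_def sum_3)

lemma fixed_by_rot_e1:
  assumes E: "E \<in> Ela" and f: "act (rot_e1 pi) E = E"
  shows "E$1$1$1$2 = 0" "E$1$1$1$3 = 0" "E$2$2$1$2 = 0" "E$2$2$1$3 = 0"
    "E$3$3$1$2 = 0" "E$3$3$1$3 = 0" "E$2$3$1$2 = 0" "E$2$3$1$3 = 0"
proof -
  have e: "act (rot_e1 pi) E $i$j$k$l = E$i$j$k$l" for i j k l using f by simp
  show "E$1$1$1$2 = 0" "E$1$1$1$3 = 0" "E$2$2$1$2 = 0" "E$2$2$1$3 = 0"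
    "E$3$3$1$2 = 0" "E$3$3$1$3 = 0" "E$2$3$1$2 = 0" "E$2$3$1$3 = 0"
    using e[of 1 1 1 2] e[of 1 1 1 3] e[of 2 2 1 2] e[of 2 2 1 3] e[of 3 3 1 2] e[of 3 3 1 3]
      e[of 2 3 1 2] e[of 2 3 1 3]
    by (simp_all add: act_nth row_contract_rot_e1_pi)
qed

lemmas normal_form_nth = normal_form_def axisymmetric_part_def metric_part_def axial_def mat_def

text \<open>
  The six parameters are recovered from \<open>d\<close>, \<open>v\<close> and the components 3333, 1111, 1122 and 1212.
\<close>

lemma tetragonal_if_fixed:
  assumes E: "E \<in> Ela" and f1: "act (rot_e1 pi) E = E" and f3: "act (rot_e3 (pi / 2)) E = E"
  shows "\<exists>k l \<delta> \<nu> \<alpha> \<beta>. E = normal_form tetragonal k l \<delta> \<nu> \<alpha> \<beta>"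
proof -
  note z = fixed_by_rot_e1[OF E f1] and v = Ela_voigt[OF E]
  have e: "act (rot_e3 (pi / 2)) E $i$j$k$l = E$i$j$k$l" for i j k l using f3 by simp
  \<comment> \<open>The quarter turn sends \<open>e\<^sub>1\<close> to \<open>e\<^sub>2\<close> and \<open>e\<^sub>2\<close> to \<open>- e\<^sub>1\<close>.\<close>
  have r: "E$2$2$2$2 = E$1$1$1$1" "E$2$2$3$3 = E$1$1$3$3" "E$1$3$1$3 = E$2$3$2$3"
    "E$1$1$2$3 = 0" "E$2$2$2$3 = 0" "E$3$3$2$3 = 0" "E$1$3$1$2 = 0"
    using e[of 1 1 1 1] e[of 1 1 3 3] e[of 1 3 1 3] e[of 1 1 2 3] e[of 2 2 2 3] e[of 3 3 2 3] e[of 1 3 1 2]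
    by (simp_all add: act_nth row_contract_rot_e3 v z)
  \<comment> \<open>The diagonal components of \<open>d\<close> and \<open>v\<close>.\<close>
  define d1 d3 where "d1 = E$1$1$1$1 + E$1$1$2$2 + E$1$1$3$3" and "d3 = 2 * E$1$1$3$3 + E$3$3$3$3"
  define v1 v3 where "v1 = E$1$1$1$1 + E$1$2$1$2 + E$2$3$2$3" and "v3 = 2 * E$2$3$2$3 + E$3$3$3$3"
  define k l \<delta> \<nu> where "k = 2 * d1 + d3" and "l = 2 * v1 + v3" and "\<delta> = (d1 - d3) / 3" and "\<nu> = (v1 - v3) / 3"
  \<comment> \<open>The component 3333 of \<open>zonal\<close> is \<open>8\<close>, and both harmonics \<open>B\<close> vanish there.\<close>
  define \<alpha> where "\<alpha> = (E$3$3$3$3 - 2 * ((2 * k - l) / 30 - 2 * (5 * \<delta> - 4 * \<nu>) / 7)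
     - 4 * ((3 * l - k) / 60 - 2 * (3 * \<nu> - 2 * \<delta>) / 7)) / 8"
  define \<beta> where "\<beta> = (E$1$1$1$1 - E$1$1$2$2 - 2 * E$1$2$1$2) / 4"
  note defs = \<alpha>_def \<beta>_def k_def l_def \<delta>_def \<nu>_def d1_def d3_def v1_def v3_def
  have "E = normal_form tetragonal k l \<delta> \<nu> \<alpha> \<beta>"
    by (rule Ela_eqI[OF E normal_form_Ela(1)])
      (simp_all add: normal_form_nth zonal_nth tetragonal_nth r z, simp_all add: defs field_simps)
  then show ?thesis by blast
qed

lemma trigonal_if_fixed:
  assumes E: "E \<in> Ela" and f1: "act (rot_e1 pi) E = E" and f3: "act (rot_e3 (2 * pi / 3)) E = E"
  shows "\<exists>k l \<delta> \<nu> \<alpha> \<beta>. E = normal_form trigonal k l \<delta> \<nu> \<alpha> \<beta>"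
proof -
  note z = fixed_by_rot_e1[OF E f1] and v = Ela_voigt[OF E]
  define g where "g = rot_e3 (2 * pi / 3)"
  have e: "act g E $i$j$k$l = E$i$j$k$l" for i j k l using f3 by (simp add: g_def)
  \<comment> \<open>The sine of \<open>2 \<pi> / 3\<close>; only its square enters the relations below.\<close>
  define h where "h = sqrt 3 / 2"
  have h: "h * h = 3 / 4" "h * (h * x) = 3 / 4 * x" for x
    by (simp_all add: h_def)
  have R: "row_contract g 1 X = - 1 / 2 * X 1 - h * X 2"
    "row_contract g 2 X = h * X 1 - 1 / 2 * X 2" 
    "row_contract g 3 X = X 3" for X
    by (simp_all add: g_def row_contract_rot_e3 cos_120 sin_120 h_def)
  note ex = act_nth R v z h algebra_simps
  have a: "E$3$3$2$3 = 0" "E$2$2$3$3 = E$1$1$3$3" "E$1$3$1$3 = E$2$3$2$3"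
    using e[of 3 3 2 3] e[of 1 1 3 3] e[of 1 3 1 3] by (simp_all add: ex)
  have b: "E$2$2$2$2 = E$1$1$1$1 \<and> E$1$2$1$2 = (E$1$1$1$1 - E$1$1$2$2) / 2"
    using e[of 1 1 1 1] e[of 2 2 2 2] e[of 1 1 2 2] e[of 1 2 1 2] by (simp add: ex)
  have c: "E$2$2$2$3 = - E$1$1$2$3 \<and> E$1$3$1$2 = E$1$1$2$3"
    using e[of 1 1 2 3] e[of 2 2 2 3] e[of 1 3 1 2] by (simp add: ex)
  note r = a b[THEN conjunct1] b[THEN conjunct2] c[THEN conjunct1] c[THEN conjunct2]
  \<comment> \<open>The diagonal components of \<open>d\<close> and \<open>v\<close>.\<close>
  define d1 d3 where "d1 = E$1$1$1$1 + E$1$1$2$2 + E$1$1$3$3" and "d3 = 2 * E$1$1$3$3 + E$3$3$3$3"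
  define v1 v3 where "v1 = E$1$1$1$1 + E$1$2$1$2 + E$2$3$2$3" and "v3 = 2 * E$2$3$2$3 + E$3$3$3$3"
  define k l \<delta> \<nu> where "k = 2 * d1 + d3" and "l = 2 * v1 + v3" and "\<delta> = (d1 - d3) / 3" and "\<nu> = (v1 - v3) / 3"
  \<comment> \<open>The component 3333 of \<open>zonal\<close> is \<open>8\<close>, and both harmonics \<open>B\<close> vanish there.\<close>
  define \<alpha> where "\<alpha> = (E$3$3$3$3 - 2 * ((2 * k - l) / 30 - 2 * (5 * \<delta> - 4 * \<nu>) / 7)
     - 4 * ((3 * l - k) / 60 - 2 * (3 * \<nu> - 2 * \<delta>) / 7)) / 8"
  note defs = \<alpha>_def k_def l_def \<delta>_def \<nu>_def d1_def d3_def v1_def v3_def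
  have "E = normal_form trigonal k l \<delta> \<nu> \<alpha> (E$1$1$2$3)"
    by (rule Ela_eqI[OF E normal_form_Ela(2)])
      (simp_all add: normal_form_nth zonal_nth trigonal_nth r z, simp_all add: defs r field_simps)
  then show ?thesis by blast
qed

section \<open>Orbits of the normal forms\<close>

text \<open>
  Two tensors lie in the same orbit of the rotation group.
\<close>

definition same_orbit :: "tensor4 \<Rightarrow> tensor4 \<Rightarrow> bool" where
  "same_orbit x y \<longleftrightarrow> (\<exists>g. rotation_matrix g \<and> act g x = y)"

lemma same_orbit_sym: "same_orbit x y \<Longrightarrow> same_orbit y x"
  unfolding same_orbit_def using rotation_transpose act_transpose_cancel(1) by metis

lemma same_orbit_trans: "same_orbit x y \<Longrightarrow> same_orbit y z \<Longrightarrow> same_orbit x z"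
  unfolding same_orbit_def using rotation_mult act_mult by metis

lemma invariants_same_orbit:
  assumes "same_orbit x y"
  shows "K1 y = K1 x" "L1 y = L1 x" "I3 y = I3 x" "K4 y = K4 x" "K5 y = K5 x" "L5 y = L5 x" "K9 y = K9 x" "K10 y = K10 x"
  using assms invariants unfolding same_orbit_def by metis+

text \<open>
  The factor in \<open>k\<^sub>4 = - axial_magnitude \<delta> \<nu> p axial\<close>, where \<open>p\<close> is the coefficient of \<open>axial\<close> in \<open>d\<^sub>2\<close>.
\<close>

definition axial_magnitude :: "real \<Rightarrow> real \<Rightarrow> real \<Rightarrow> real" where
  "axial_magnitude \<delta> \<nu> p = 6 * \<delta>^4 + 6 * \<nu>^4 + p\<^sup>2"

lemma axial_magnitude_eq_0: "axial_magnitude \<delta> \<nu> p = 0 \<longleftrightarrow> \<delta> = 0 \<and> \<nu> = 0 \<and> p = 0"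
proof
  assume z: "axial_magnitude \<delta> \<nu> p = 0"
  have "0 \<le> \<delta>^4" "0 \<le> \<nu>^4" "0 \<le> p\<^sup>2" by simp_all
  then have "\<delta>^4 = 0" "\<nu>^4 = 0" "p\<^sup>2 = 0" using z unfolding axial_magnitude_def by linarith+
  then show "\<delta> = 0 \<and> \<nu> = 0 \<and> p = 0" by simp
qed (simp add: axial_magnitude_def)

lemmas tetragonal_values =
  invariants_from_d2[OF tetragonal_parts(1,2) d2_of_tetragonal axial_magnitude_def]
lemmas trigonal_values =
  invariants_from_d2[OF trigonal_parts(1,2) d2_of_trigonal axial_magnitude_def]
lemmas tetragonal_invariants = tetragonal_values I3_tetragonal K9_tetragonal[OF tetragonal_values(3)]
  K10_tetragonal[OF tetragonal_values(3)]
lemmas trigonal_invariants = trigonal_values I3_trigonal K9_trigonal[OF trigonal_values(3)]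
  K10_trigonal[OF trigonal_values(3)]

lemma tetragonal_rot:
  "cis (4 * t) = 1 \<Longrightarrow> act (rot_e3 t) tetragonal = tetragonal"
  "cis (4 * t) = -1 \<Longrightarrow> act (rot_e3 t) tetragonal = - tetragonal"
  "act (rot_e3 t) tetragonal = tetragonal \<Longrightarrow> cos (4 * t) = 1"
proof -
  have c: "cis (- (4 * t)) = cnj (cis (4 * t))" by (simp add: cis_cnj)
  show "cis (4 * t) = 1 \<Longrightarrow> act (rot_e3 t) tetragonal = tetragonal"
    "cis (4 * t) = -1 \<Longrightarrow> act (rot_e3 t) tetragonal = - tetragonal"
    unfolding act_rot_e3_tetragonal c by (simp_all add: tetragonal_def vec_eq_iff Let_def del: cis_cnj)
  assume "act (rot_e3 t) tetragonal = tetragonal"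
  then have "act (rot_e3 t) tetragonal $1$1$1$1 = 1" by (simp add: tetragonal_nth)
  then show "cos (4 * t) = 1"
    unfolding act_rot_e3_tetragonal vec_lambda_beta Let_def by (simp add: complex_dir_def)
qed

lemma trigonal_rot:
  "cis (3 * t) = 1 \<Longrightarrow> act (rot_e3 t) trigonal = trigonal"
  "cis (3 * t) = -1 \<Longrightarrow> act (rot_e3 t) trigonal = - trigonal"
  "act (rot_e3 t) trigonal = trigonal \<Longrightarrow> cos (3 * t) = 1"
proof -
  have c: "cis (- (3 * t)) = cnj (cis (3 * t))" by (simp add: cis_cnj)
  show "cis (3 * t) = 1 \<Longrightarrow> act (rot_e3 t) trigonal = trigonal"
    "cis (3 * t) = -1 \<Longrightarrow> act (rot_e3 t) trigonal = - trigonal"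
    unfolding act_rot_e3_trigonal c by (simp_all add: trigonal_def vec_eq_iff Let_def algebra_simps del: cis_cnj)
  assume "act (rot_e3 t) trigonal = trigonal"
  then have "act (rot_e3 t) trigonal $1$1$2$3 = 1" by (simp add: trigonal_nth)
  then show "cos (3 * t) = 1"
    unfolding act_rot_e3_trigonal vec_lambda_beta Let_def by (simp add: complex_dir_def axis_dir_def)
qed

text \<open>
  A rotation by half the period of the phase changes the sign of \<open>\<beta>\<close>, so only \<open>\<beta>\<^sup>2\<close> matters.
\<close>

lemma tetragonal_flip: "same_orbit (normal_form tetragonal k l \<delta> \<nu> \<alpha> \<beta>) (normal_form tetragonal k l \<delta> \<nu> \<alpha> (- \<beta>))"
  unfolding same_orbit_def
  by (rule exI[of _ "rot_e3 (pi / 4)"])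
    (simp add: rotation_rot_e3 act_normal_form tetragonal_rot(2) normal_form_minus)

lemma trigonal_flip: "same_orbit (normal_form trigonal k l \<delta> \<nu> \<alpha> \<beta>) (normal_form trigonal k l \<delta> \<nu> \<alpha> (- \<beta>))"
  unfolding same_orbit_def
  by (rule exI[of _ "rot_e3 (pi / 3)"])
    (simp add: rotation_rot_e3 act_normal_form trigonal_rot(2) normal_form_minus)

lemma tetragonal_in_stratum:
  assumes m: "axial_magnitude \<delta> \<nu> ((4 * \<beta>\<^sup>2 - 100 * \<alpha>\<^sup>2) / 3) \<noteq> 0" and b: "\<beta> \<noteq> 0"
  shows "normal_form tetragonal k l \<delta> \<nu> \<alpha> \<beta> \<in> stratum (dihedral 4)"
proof (rule stratum_dihedralI[OF _ normal_form_Ela(1) tetragonal_values(3)])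
  show "act (rot_e1 pi) (normal_form tetragonal k l \<delta> \<nu> \<alpha> \<beta>) = normal_form tetragonal k l \<delta> \<nu> \<alpha> \<beta>"
    by (simp add: act_normal_form act_rot_e1_tetragonal)
  have "cis (4 * (2 * pi / real 4)) = 1" by simp
  then show "act (rot_e3 (2 * pi / real 4)) (normal_form tetragonal k l \<delta> \<nu> \<alpha> \<beta>) = normal_form tetragonal k l \<delta> \<nu> \<alpha> \<beta>"
    unfolding act_normal_form by (simp only: tetragonal_rot(1))
  fix t assume "act (rot_e3 t) (normal_form tetragonal k l \<delta> \<nu> \<alpha> \<beta>) = normal_form tetragonal k l \<delta> \<nu> \<alpha> \<beta>"
  then have "act (rot_e3 t) tetragonal = tetragonal"
    using b by (simp add: act_normal_form) (simp add: normal_form_def)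
  then show "cos (real 4 * t) = 1" by (simp add: tetragonal_rot(3))
qed (use m in auto)

lemma trigonal_in_stratum:
  assumes m: "axial_magnitude \<delta> \<nu> ((2 * \<beta>\<^sup>2 - 100 * \<alpha>\<^sup>2) / 3) \<noteq> 0" and b: "\<beta> \<noteq> 0"
  shows "normal_form trigonal k l \<delta> \<nu> \<alpha> \<beta> \<in> stratum (dihedral 3)"
proof (rule stratum_dihedralI[OF _ normal_form_Ela(2) trigonal_values(3)])
  show "act (rot_e1 pi) (normal_form trigonal k l \<delta> \<nu> \<alpha> \<beta>) = normal_form trigonal k l \<delta> \<nu> \<alpha> \<beta>"
    by (simp add: act_normal_form act_rot_e1_trigonal)
  have "cis (3 * (2 * pi / real 3)) = 1" by simp
  then show "act (rot_e3 (2 * pi / real 3)) (normal_form trigonal k l \<delta> \<nu> \<alpha> \<beta>) = normal_form trigonal k l \<delta> \<nu> \<alpha> \<beta>"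
    unfolding act_normal_form by (simp only: trigonal_rot(1))
  fix t assume "act (rot_e3 t) (normal_form trigonal k l \<delta> \<nu> \<alpha> \<beta>) = normal_form trigonal k l \<delta> \<nu> \<alpha> \<beta>"
  then have "act (rot_e3 t) trigonal = trigonal"
    using b by (simp add: act_normal_form) (simp add: normal_form_def)
  then show "cos (real 3 * t) = 1" by (simp add: trigonal_rot(3))
qed (use m in auto)

text \<open>
  The rotation that takes the coordinate axes, the fourfold axes of a cube, to a triple of
  orthonormal vectors arranged symmetrically about the third axis, which becomes a threefold axis of the cube.
\<close>

definition cubic_rotation :: tensor2 where
  "cubic_rotation = vector [vector [0, - (sqrt 2 / 2), sqrt 2 / 2],
     vector [sqrt 2 * sqrt 3 / 3, - (sqrt 2 * sqrt 3 / 6), - (sqrt 2 * sqrt 3 / 6)],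
     vector [sqrt 3 / 3, sqrt 3 / 3, sqrt 3 / 3]]"

lemma cubic_rotation_nth:
  "cubic_rotation$1$1 = 0" "cubic_rotation$1$2 = - (sqrt 2 / 2)" "cubic_rotation$1$3 = sqrt 2 / 2"
  "cubic_rotation$2$1 = sqrt 2 * sqrt 3 / 3" "cubic_rotation$2$2 = - (sqrt 2 * sqrt 3 / 6)" "cubic_rotation$2$3 = - (sqrt 2 * sqrt 3 / 6)"
  "cubic_rotation$3$1 = sqrt 3 / 3" "cubic_rotation$3$2 = sqrt 3 / 3" "cubic_rotation$3$3 = sqrt 3 / 3"
  by (simp_all add: cubic_rotation_def)

lemma sqrt_simps:
  "sqrt 2 * (sqrt 2 * x) = 2 * x" "sqrt 3 * (sqrt 3 * x) = 3 * x" "sqrt 3 * (sqrt 2 * x) = sqrt 2 * (sqrt 3 * x)"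
  "sqrt 3 * sqrt 2 = sqrt 2 * sqrt 3"
  by (simp_all add: mult.assoc[symmetric])

lemma rotation_cubic_rotation: "rotation_matrix cubic_rotation"
  unfolding rotation_matrix_def orthogonal_matrix
  by (simp add: det_3 vec_eq_iff forall_3 matrix_matrix_mult_def sum_3 Finite_Cartesian_Product.transpose_def
      mat_def cubic_rotation_nth mult.assoc sqrt_simps)

text \<open>
  For \<open>\<beta> = 5 \<alpha>\<close> the harmonic part of the tetragonal normal form is cubic: it is a combination of
  \<open>\<Sum>\<^sub>m e\<^sub>m \<otimes> e\<^sub>m \<otimes> e\<^sub>m \<otimes> e\<^sub>m\<close> and the symmetrized square of the metric.
\<close>

lemma act_cubic_rotation:
  "act cubic_rotation (zonal + 5 *\<^sub>R tetragonal) = (- (2 / 3)) *\<^sub>R zonal + (- (10 * sqrt 2 / 3)) *\<^sub>R trigonal"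
proof -
  \<comment> \<open>On this cubic tensor the rotation only has to be applied to the fourth powers of the axes.\<close>
  define D :: tensor4 where "D = (\<chi> i j k l. \<Sum>m\<in>UNIV. mat 1$i$m * mat 1$j$m * mat 1$k$m * mat 1$l$m)"
  define Q :: tensor4 where "Q = (\<chi> i j k l. mat 1$i$j * mat 1$k$l + mat 1$i$k * mat 1$j$l + mat 1$i$l * mat 1$j$k)"
  have zt: "zonal + 5 *\<^sub>R tetragonal = 20 *\<^sub>R D - 4 *\<^sub>R Q"
    unfolding vec_eq_iff forall_3
    by (simp add: zonal_nth tetragonal_nth D_def Q_def mat_def sum_3)
  have r: "row_contract g i (\<lambda>p. mat 1$p$m) = g$i$m" for g i m
    by (simp add: row_contract_def mat_def if_distrib[of "\<lambda>x. _ * x"] cong: if_cong)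
  have D: "act g D $i$j$k$l = (\<Sum>m\<in>UNIV. g$i$m * g$j$m * g$k$m * g$l$m)" for g i j k l
    by (simp add: act_nth D_def row_contract_sum row_contract_mult_left row_contract_mult_right r)
  have Q: "act cubic_rotation Q = Q"
    by (simp add: vec_eq_iff act_nth Q_def row_contract_add row_contract_mult_left row_contract_mult_right
        row_contract_mat1[OF rotation_cubic_rotation])
  have Qn: "act cubic_rotation Q $i$j$k$l = mat 1$i$j * mat 1$k$l + mat 1$i$k * mat 1$j$l + mat 1$i$l * mat 1$j$k" for i j k l
    unfolding Q by (simp add: Q_def)
  have e: "zonal + 5 *\<^sub>R tetragonal \<in> Ela"
    using harmonic4_Ela[OF harmonic4_normal(1)[of 1 5]] by simp
  show ?thesis
    by (rule Ela_eqI[OF act_Ela[OF e] harmonic4_Ela[OF harmonic4_normal(2)]])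
      (simp_all add: zt act_diff act_scaleR D Qn sum_3 cubic_rotation_nth zonal_nth trigonal_nth mat_def
        mult.assoc sqrt_simps)
qed

lemma act_isotropic: "rotation_matrix g \<Longrightarrow> act g (axisymmetric_part k l 0 0) = axisymmetric_part k l 0 0"
  by (simp add: axisymmetric_part_def act_metric_part act2_scaleR act2_mat)

text \<open>
  The coefficient of \<open>axial\<close> in \<open>d\<^sub>2\<close> vanishes on a trigonal harmonic part exactly when
  \<open>\<beta>\<^sup>2 = 50 \<alpha>\<^sup>2\<close>. Such a tensor is cubic and has a tetragonal normal form as well.
\<close>

lemma cubic_trigonal:
  assumes "\<beta>\<^sup>2 = 50 * \<alpha>\<^sup>2"
  shows "same_orbit (normal_form trigonal k l 0 0 \<alpha> \<beta>)
    (normal_form tetragonal k l 0 0 (- (3 / 2) * \<alpha>) (- (15 / 2) * \<alpha>))"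
proof -
  have "normal_form tetragonal k l 0 0 (- (3 / 2) * \<alpha>) (- (15 / 2) * \<alpha>)
    = axisymmetric_part k l 0 0 + (- (3 / 2) * \<alpha>) *\<^sub>R (zonal + 5 *\<^sub>R tetragonal)"
    by (simp add: normal_form_def vec_eq_iff algebra_simps)
  then have "act cubic_rotation (normal_form tetragonal k l 0 0 (- (3 / 2) * \<alpha>) (- (15 / 2) * \<alpha>))
    = axisymmetric_part k l 0 0 + (- (3 / 2) * \<alpha>) *\<^sub>R ((- (2 / 3)) *\<^sub>R zonal + (- (10 * sqrt 2 / 3)) *\<^sub>R trigonal)"
    by (simp only: act_add[of _ "axisymmetric_part k l 0 0"] act_scaleR[of _ "- (3 / 2) * \<alpha>"] act_isotropic[OF rotation_cubic_rotation] act_cubic_rotation)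
  also have "\<dots> = normal_form trigonal k l 0 0 \<alpha> (5 * sqrt 2 * \<alpha>)"
    by (simp add: normal_form_def vec_eq_iff algebra_simps)
  finally have "same_orbit (normal_form tetragonal k l 0 0 (- (3 / 2) * \<alpha>) (- (15 / 2) * \<alpha>))
      (normal_form trigonal k l 0 0 \<alpha> (5 * sqrt 2 * \<alpha>))"
    unfolding same_orbit_def using rotation_cubic_rotation by blast
  then have s: "same_orbit (normal_form trigonal k l 0 0 \<alpha> (5 * sqrt 2 * \<alpha>))
      (normal_form tetragonal k l 0 0 (- (3 / 2) * \<alpha>) (- (15 / 2) * \<alpha>))"
    by (rule same_orbit_sym)
  have "\<beta>\<^sup>2 = (5 * sqrt 2 * \<alpha>)\<^sup>2"
    using assms by (simp add: power_mult_distrib)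
  then have "\<beta> = 5 * sqrt 2 * \<alpha> \<or> \<beta> = - (5 * sqrt 2 * \<alpha>)"
    by (simp add: power2_eq_iff)
  then show ?thesis
  proof
    assume "\<beta> = - (5 * sqrt 2 * \<alpha>)"
    then show ?thesis
      using same_orbit_trans[OF trigonal_flip[of k l 0 0 \<alpha> \<beta>]] s by simp
  qed (use s in simp)
qed

text \<open>
  A rotation by \<open>2 \<pi> / 3\<close> about \<open>(1, 1, 1)\<close>. It belongs to the octahedral group and
  does not fix \<open>axial\<close>.
\<close>

definition cyclic_perm :: tensor2 where
  "cyclic_perm = vector [vector [0, 1, 0], vector [0, 0, 1], vector [1, 0, 0]]"

lemma cyclic_perm_nth:
  "cyclic_perm$1$1 = 0" "cyclic_perm$1$2 = 1" "cyclic_perm$1$3 = 0"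
  "cyclic_perm$2$1 = 0" "cyclic_perm$2$2 = 0" "cyclic_perm$2$3 = 1"
  "cyclic_perm$3$1 = 1" "cyclic_perm$3$2 = 0" "cyclic_perm$3$3 = 0"
  by (simp_all add: cyclic_perm_def)

lemma rotation_cyclic_perm: "rotation_matrix cyclic_perm"
  unfolding rotation_matrix_def orthogonal_matrix
  by (simp add: det_3 vec_eq_iff forall_3 matrix_matrix_mult_def sum_3 Finite_Cartesian_Product.transpose_def
      mat_def cyclic_perm_nth)

lemma K4_zero_of_cyclic:
  assumes "act cyclic_perm E = E" "k4_of E = c *\<^sub>R axial"
  shows "c = 0"
proof -
  have "act2 cyclic_perm (k4_of E) = k4_of E"
    using k4_of_act[OF rotation_cyclic_perm, of E] assms(1) by simp
  then have "act2 cyclic_perm (k4_of E)$2$2 = k4_of E$2$2" by simp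
  then show ?thesis
    by (simp add: assms(2) act2_nth row_contract_def sum_3 cyclic_perm_nth axial_def)
qed

lemma octahedralI:
  assumes g: "rotation_matrix g"
    and "\<And>x :: real^3. \<forall>i. \<bar>x$i\<bar> \<le> 1 \<Longrightarrow> \<forall>i. \<bar>(g *v x)$i\<bar> \<le> 1"
    and "\<And>x :: real^3. \<forall>i. \<bar>x$i\<bar> \<le> 1 \<Longrightarrow> \<forall>i. \<bar>(transpose g *v x)$i\<bar> \<le> 1"
  shows "g \<in> octahedral"
proof -
  define C where "C = {x :: real^3. \<forall>i. \<bar>x$i\<bar> \<le> 1}"
  have "(\<lambda>x. g *v x) ` C = C"
  proof
    show "(\<lambda>x. g *v x) ` C \<subseteq> C" using assms(2) by (auto simp: C_def)
    show "C \<subseteq> (\<lambda>x. g *v x) ` C"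
    proof
      fix x assume "x \<in> C"
      then have "transpose g *v x \<in> C" using assms(3)[of x] unfolding C_def by blast
      moreover have "x = g *v (transpose g *v x)"
        by (simp only: matrix_vector_mul_assoc transpose_rotation(2)[OF g] matrix_vector_mul_lid)
      ultimately show "x \<in> (\<lambda>x. g *v x) ` C" by blast
    qed
  qed
  then show ?thesis using g by (simp add: octahedral_def C_def Let_def)
qed

lemma octahedral_members: "rot_e1 pi \<in> octahedral" "rot_e3 (pi / 2) \<in> octahedral" "cyclic_perm \<in> octahedral"
  by (rule octahedralI; simp add: rotation_rot_e1 rotation_rot_e3 rotation_cyclic_perm forall_3
      matrix_vector_mult_def vector_matrix_mult_def sum_3 Finite_Cartesian_Product.transpose_def cyclic_perm_nth)+

lemma cube_eq_imp_eq:
  fixes x y :: real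
  assumes "x^3 = y^3"
  shows "x = y"
proof -
  have "(x - y) * ((x + y)\<^sup>2 + x\<^sup>2 + y\<^sup>2) = 0"
    using assms by (simp add: power2_eq_square power3_eq_cube algebra_simps)
  then have "x = y \<or> (x + y)\<^sup>2 + x\<^sup>2 + y\<^sup>2 = 0" by simp
  moreover have "0 \<le> (x + y)\<^sup>2" "0 \<le> x\<^sup>2" "0 \<le> y\<^sup>2" by simp_all
  ultimately have "x = y \<or> x\<^sup>2 = 0 \<and> y\<^sup>2 = 0" by linarith
  then show ?thesis by auto
qed

text \<open>
  The tensors that have a tetragonal, respectively trigonal, normal form. The choice \<open>\<beta> \<ge> 0\<close> makes
  the normal form unique within each class.
\<close>

definition tetragonal_class :: "tensor4 set" where
  "tetragonal_class = {E. \<exists>k l \<delta> \<nu> \<alpha> \<beta>. 0 \<le> \<beta> \<and> same_orbit E (normal_form tetragonal k l \<delta> \<nu> \<alpha> \<beta>)}"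

definition trigonal_class :: "tensor4 set" where
  "trigonal_class = {E. \<exists>k l \<delta> \<nu> \<alpha> \<beta>. 0 \<le> \<beta> \<and> same_orbit E (normal_form trigonal k l \<delta> \<nu> \<alpha> \<beta>)}"

text \<open>
  Membership in \<open>stratum K\<close> is used only through a tensor in the same orbit that \<open>K\<close> fixes.
\<close>

lemma stratum_fixed_representative:
  assumes "E \<in> stratum K"
  obtains F where "same_orbit E F" "F \<in> Ela" "\<And>h. h \<in> K \<Longrightarrow> act h F = F"
proof -
  obtain g where g: "rotation_matrix g" "act g E \<in> Ela" "symmetry_group (act g E) = K"
    using stratum_normalize[OF assms] .
  have "act h (act g E) = act g E" if "h \<in> K" for h
    using that unfolding g(3)[symmetric] symmetry_group_def by blast
  moreover have "same_orbit E (act g E)"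
    unfolding same_orbit_def using g(1) by blast
  ultimately show ?thesis using that g(2) by blast
qed

lemma same_orbit_tetragonal_class:
  assumes "same_orbit E (normal_form tetragonal k l \<delta> \<nu> \<alpha> \<beta>)"
  shows "E \<in> tetragonal_class"
proof -
  have "same_orbit E (normal_form tetragonal k l \<delta> \<nu> \<alpha> \<bar>\<beta>\<bar>)"
    using assms same_orbit_trans[OF assms tetragonal_flip] by (cases "0 \<le> \<beta>") simp_all
  then show ?thesis
    unfolding tetragonal_class_def using abs_ge_zero[of \<beta>] by blast
qed

lemma same_orbit_trigonal_class:
  assumes "same_orbit E (normal_form trigonal k l \<delta> \<nu> \<alpha> \<beta>)"
  shows "E \<in> trigonal_class"
proof -
  have "same_orbit E (normal_form trigonal k l \<delta> \<nu> \<alpha> \<bar>\<beta>\<bar>)"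
    using assms same_orbit_trans[OF assms trigonal_flip] by (cases "0 \<le> \<beta>") simp_all
  then show ?thesis
    unfolding trigonal_class_def using abs_ge_zero[of \<beta>] by blast
qed

lemma stratum_tetragonal_class:
  assumes E: "E \<in> stratum K" and K: "rot_e1 pi \<in> K" "rot_e3 (pi / 2) \<in> K"
  shows "E \<in> tetragonal_class" and "cyclic_perm \<in> K \<Longrightarrow> K4 E = 0"
proof -
  obtain F where F: "same_orbit E F" "F \<in> Ela" "\<And>h. h \<in> K \<Longrightarrow> act h F = F"
    using stratum_fixed_representative[OF E] by blast
  obtain k l \<delta> \<nu> \<alpha> \<beta> where n: "F = normal_form tetragonal k l \<delta> \<nu> \<alpha> \<beta>"
    using tetragonal_if_fixed[OF F(2) F(3)[OF K(1)] F(3)[OF K(2)]] by blast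
  show "E \<in> tetragonal_class"
    using F(1) unfolding n by (rule same_orbit_tetragonal_class)
  show "K4 E = 0" if "cyclic_perm \<in> K"
    using K4_zero_of_cyclic[OF F(3)[OF that] tetragonal_values(3)[of k l \<delta> \<nu> \<alpha> \<beta>, folded n]]
      invariants_same_orbit(4)[OF F(1)[unfolded n]] by (simp add: tetragonal_invariants)
qed

text \<open>
  For \<open>K4 = 0\<close> the normal form is isotropic or cubic, and the tetragonal one is used instead.
\<close>

lemma stratum_trigonal_class:
  assumes E: "E \<in> stratum K" and K: "rot_e1 pi \<in> K" "rot_e3 (2 * pi / 3) \<in> K"
  shows "E \<in> trigonal_class \<and> K4 E \<noteq> 0 \<or> E \<in> tetragonal_class \<and> K4 E = 0"
proof -
  obtain F where F: "same_orbit E F" "F \<in> Ela" "\<And>h. h \<in> K \<Longrightarrow> act h F = F"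
    using stratum_fixed_representative[OF E] by blast
  obtain k l \<delta> \<nu> \<alpha> \<beta> where n: "F = normal_form trigonal k l \<delta> \<nu> \<alpha> \<beta>"
    using trigonal_if_fixed[OF F(2) F(3)[OF K(1)] F(3)[OF K(2)]] by blast
  note s = F(1)[unfolded n]
  show ?thesis
  proof (cases "K4 E = 0")
    case True
    then have "axial_magnitude \<delta> \<nu> ((2 * \<beta>\<^sup>2 - 100 * \<alpha>\<^sup>2) / 3) = 0"
      using invariants_same_orbit(4)[OF s] by (simp add: trigonal_invariants)
    then have z: "\<delta> = 0" "\<nu> = 0" "\<beta>\<^sup>2 = 50 * \<alpha>\<^sup>2"
      unfolding axial_magnitude_eq_0 by simp_all
    have "E \<in> tetragonal_class"
      by (rule same_orbit_tetragonal_class[OF same_orbit_trans[OF s[unfolded z(1,2)] cubic_trigonal[OF z(3)]]])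
    with True show ?thesis by blast
  qed (use same_orbit_trigonal_class[OF s] in blast)
qed

section \<open>Separation of orbits\<close>

text \<open>
  The parameters of a normal form are determined by the invariants. The coefficients \<open>b\<close> and \<open>c\<close> are
  \<open>4\<close> and \<open>48\<close> in the tetragonal case, \<open>2\<close> and \<open>-144\<close> in the trigonal one. If \<open>m \<noteq> 0\<close>, the invariants of
  degree five and nine give \<open>\<delta>\<close>, \<open>\<nu>\<close> and \<open>\<alpha>\<close>; then \<open>I3\<close> gives \<open>\<beta>\<^sup>2\<close> if \<open>\<alpha> \<noteq> 0\<close>, and \<open>K4\<close> does
  if \<open>\<alpha> = 0\<close>. If \<open>m = 0\<close>, the tensor is isotropic or cubic, \<open>\<beta>\<^sup>2\<close> is a fixed multiple of \<open>\<alpha>\<^sup>2\<close>, and \<open>I3\<close> is a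
  nonzero multiple of \<open>\<alpha>\<^sup>3\<close>.
\<close>

lemma params_unique:
  fixes \<alpha> \<beta> \<alpha>' \<beta>' b c \<delta> \<nu> \<delta>' \<nu>' :: real
  defines "p \<equiv> (b * \<beta>\<^sup>2 - 100 * \<alpha>\<^sup>2) / 3" and "p' \<equiv> (b * \<beta>'\<^sup>2 - 100 * \<alpha>'\<^sup>2) / 3"
  defines "m \<equiv> axial_magnitude \<delta> \<nu> p"
  assumes nn: "0 \<le> \<beta>" "0 \<le> \<beta>'" and b: "b \<noteq> 0" and c: "c \<noteq> 0" and a: "720 * b + 100 * c \<noteq> 0"
    and m: "axial_magnitude \<delta>' \<nu>' p' = m"
    and eq: "\<delta>' * m = \<delta> * m" "\<nu>' * m = \<nu> * m" "\<alpha>' * m\<^sup>2 = \<alpha> * m\<^sup>2"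
    and I3: "720 * \<alpha>'^3 + c * \<alpha>' * \<beta>'\<^sup>2 = 720 * \<alpha>^3 + c * \<alpha> * \<beta>\<^sup>2"
  shows "\<delta>' = \<delta>" "\<nu>' = \<nu>" "\<alpha>' = \<alpha>" "\<beta>' = \<beta>"
proof -
  have "\<delta>' = \<delta> \<and> \<nu>' = \<nu> \<and> \<alpha>' = \<alpha> \<and> \<beta>'\<^sup>2 = \<beta>\<^sup>2"
  proof (cases "m = 0")
    case False
    then have e: "\<delta>' = \<delta>" "\<nu>' = \<nu>" "\<alpha>' = \<alpha>" using eq by simp_all
    have "\<beta>'\<^sup>2 = \<beta>\<^sup>2"
    proof (cases "\<alpha> = 0")
      case False
      then show ?thesis using I3 c by (simp add: e)
    next
      case True
      have "p'\<^sup>2 = p\<^sup>2" using m by (simp add: m_def axial_magnitude_def e)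
      then have "(b / 3)\<^sup>2 * (\<beta>'\<^sup>2)\<^sup>2 = (b / 3)\<^sup>2 * (\<beta>\<^sup>2)\<^sup>2"
        by (simp add: p_def p'_def e True power_mult_distrib power_divide)
      then have "(\<beta>'\<^sup>2)\<^sup>2 = (\<beta>\<^sup>2)\<^sup>2" using b by simp
      then show ?thesis by (rule power2_eq_imp_eq) simp_all
    qed
    then show ?thesis using e by simp
  next
    case True
    then have "axial_magnitude \<delta> \<nu> p = 0" "axial_magnitude \<delta>' \<nu>' p' = 0"
      using m by (simp_all add: m_def)
    then have z: "\<delta> = 0" "\<nu> = 0" "p = 0" "\<delta>' = 0" "\<nu>' = 0" "p' = 0"
      unfolding axial_magnitude_eq_0 by blast+
    then have bb: "\<beta>\<^sup>2 = 100 / b * \<alpha>\<^sup>2" "\<beta>'\<^sup>2 = 100 / b * \<alpha>'\<^sup>2"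
      using b by (simp_all add: p_def p'_def field_simps)
    have "(720 + 100 * c / b) * \<alpha>'^3 = (720 + 100 * c / b) * \<alpha>^3"
      using I3 unfolding bb by (simp add: power2_eq_square power3_eq_cube algebra_simps)
    moreover have "720 + 100 * c / b \<noteq> 0" using a b by (simp add: field_simps)
    ultimately have "\<alpha>'^3 = \<alpha>^3" by simp
    then have "\<alpha>' = \<alpha>" by (rule cube_eq_imp_eq)
    then show ?thesis using z bb by simp
  qed
  then show "\<delta>' = \<delta>" "\<nu>' = \<nu>" "\<alpha>' = \<alpha>" "\<beta>' = \<beta>"
    using nn by (simp_all add: power2_eq_iff_nonneg)
qed

lemma tetragonal_separation:
  assumes "0 \<le> \<beta>" "0 \<le> \<beta>'"
    and "x = normal_form tetragonal k l \<delta> \<nu> \<alpha> \<beta>" "y = normal_form tetragonal k' l' \<delta>' \<nu>' \<alpha>' \<beta>'"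
    and "K1 x = K1 y" "L1 x = L1 y" "I3 x = I3 y" "K4 x = K4 y" "K5 x = K5 y" "L5 x = L5 y" "K9 x = K9 y"
  shows "x = y"
proof -
  have "\<delta>' = \<delta>" "\<nu>' = \<nu>" "\<alpha>' = \<alpha>" "\<beta>' = \<beta>"
    by (rule params_unique[of \<beta> \<beta>' 4 48 \<delta>' \<nu>' \<alpha>' \<delta> \<nu> \<alpha>]; use assms in \<open>auto simp: tetragonal_invariants\<close>)+
  then show ?thesis using assms by (simp add: tetragonal_invariants)
qed

lemma trigonal_separation:
  assumes "0 \<le> \<beta>" "0 \<le> \<beta>'"
    and "x = normal_form trigonal k l \<delta> \<nu> \<alpha> \<beta>" "y = normal_form trigonal k' l' \<delta>' \<nu>' \<alpha>' \<beta>'"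
    and "K1 x = K1 y" "L1 x = L1 y" "I3 x = I3 y" "K4 x = K4 y" "K5 x = K5 y" "L5 x = L5 y" "K9 x = K9 y"
  shows "x = y"
proof -
  have "\<delta>' = \<delta>" "\<nu>' = \<nu>" "\<alpha>' = \<alpha>" "\<beta>' = \<beta>"
    by (rule params_unique[of \<beta> \<beta>' 2 "-144" \<delta>' \<nu>' \<alpha>' \<delta> \<nu> \<alpha>]; use assms in \<open>auto simp: trigonal_invariants\<close>)+
  then show ?thesis using assms by (simp add: trigonal_invariants)
qed

abbreviation seven :: "(tensor4 \<Rightarrow> real) list" where
  "seven \<equiv> [K1, L1, I3, K4, K5, L5, K9]"

lemma tetragonal_class_separation:
  assumes x: "x \<in> tetragonal_class" and y: "y \<in> tetragonal_class"
    and eq: "\<And>\<phi>. \<phi> \<in> set seven \<Longrightarrow> \<phi> x = \<phi> y"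
  shows "same_orbit x y"
proof -
  obtain k l \<delta> \<nu> \<alpha> \<beta> where n: "0 \<le> \<beta>" "same_orbit x (normal_form tetragonal k l \<delta> \<nu> \<alpha> \<beta>)"
    using x unfolding tetragonal_class_def by blast
  obtain k' l' \<delta>' \<nu>' \<alpha>' \<beta>' where n': "0 \<le> \<beta>'" "same_orbit y (normal_form tetragonal k' l' \<delta>' \<nu>' \<alpha>' \<beta>')"
    using y unfolding tetragonal_class_def by blast
  have "normal_form tetragonal k l \<delta> \<nu> \<alpha> \<beta> = normal_form tetragonal k' l' \<delta>' \<nu>' \<alpha>' \<beta>'"
    by (rule tetragonal_separation[OF n(1) n'(1) refl refl])
      (simp_all add: invariants_same_orbit[OF n(2)] invariants_same_orbit[OF n'(2)] eq)
  then show ?thesis using same_orbit_trans[OF n(2)] same_orbit_sym[OF n'(2)] by simp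
qed

lemma trigonal_class_separation:
  assumes x: "x \<in> trigonal_class" and y: "y \<in> trigonal_class"
    and eq: "\<And>\<phi>. \<phi> \<in> set seven \<Longrightarrow> \<phi> x = \<phi> y"
  shows "same_orbit x y"
proof -
  obtain k l \<delta> \<nu> \<alpha> \<beta> where n: "0 \<le> \<beta>" "same_orbit x (normal_form trigonal k l \<delta> \<nu> \<alpha> \<beta>)"
    using x unfolding trigonal_class_def by blast
  obtain k' l' \<delta>' \<nu>' \<alpha>' \<beta>' where n': "0 \<le> \<beta>'" "same_orbit y (normal_form trigonal k' l' \<delta>' \<nu>' \<alpha>' \<beta>')"
    using y unfolding trigonal_class_def by blast
  have "normal_form trigonal k l \<delta> \<nu> \<alpha> \<beta> = normal_form trigonal k' l' \<delta>' \<nu>' \<alpha>' \<beta>'"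
    by (rule trigonal_separation[OF n(1) n'(1) refl refl])
      (simp_all add: invariants_same_orbit[OF n(2)] invariants_same_orbit[OF n'(2)] eq)
  then show ?thesis using same_orbit_trans[OF n(2)] same_orbit_sym[OF n'(2)] by simp
qed

text \<open>
  A trigonal tensor with \<open>K4 \<noteq> 0\<close> and \<open>K10 = 0\<close> is axisymmetric, and the two normal forms agree there.
\<close>

lemma trigonal_class_K10:
  assumes "x \<in> trigonal_class" "K4 x \<noteq> 0" "K10 x = 0"
  shows "x \<in> tetragonal_class"
proof -
  obtain k l \<delta> \<nu> \<alpha> \<beta> where n: "0 \<le> \<beta>" "same_orbit x (normal_form trigonal k l \<delta> \<nu> \<alpha> \<beta>)"
    using assms(1) unfolding trigonal_class_def by blast
  have "\<beta> = 0"
    using assms(2,3) invariants_same_orbit(4,8)[OF n(2)] by (simp add: trigonal_invariants)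
  then have "same_orbit x (normal_form tetragonal k l \<delta> \<nu> \<alpha> 0)"
    using n(2) by (simp add: normal_form_def)
  then show ?thesis unfolding tetragonal_class_def by blast
qed

lemma tetragonal_class_K10:
  assumes "x \<in> tetragonal_class"
  shows "K10 x = 0"
proof -
  obtain k l \<delta> \<nu> \<alpha> \<beta> where "same_orbit x (normal_form tetragonal k l \<delta> \<nu> \<alpha> \<beta>)"
    using assms(1) unfolding tetragonal_class_def by blast
  from invariants_same_orbit(8)[OF this] show ?thesis by (simp add: tetragonal_invariants)
qed

lemma rot_in_O2: "rot_e1 pi \<in> O2" "rot_e3 t \<in> O2"
  unfolding O2_def by (auto intro: generate.incl)

lemma rot_in_dihedral: "rot_e1 pi \<in> dihedral n" "rot_e3 (2 * pi / n) \<in> dihedral n"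
  unfolding dihedral_def by (auto intro: generate.incl)

lemma stratum_classes:
  "E \<in> stratum (carrier SO3) \<Longrightarrow> E \<in> tetragonal_class \<and> K4 E = 0"
  "E \<in> stratum octahedral \<Longrightarrow> E \<in> tetragonal_class \<and> K4 E = 0"
  "E \<in> stratum O2 \<Longrightarrow> E \<in> tetragonal_class"
  "E \<in> stratum O2 \<Longrightarrow> E \<in> trigonal_class \<and> K4 E \<noteq> 0 \<or> E \<in> tetragonal_class \<and> K4 E = 0"
  "E \<in> stratum (dihedral 4) \<Longrightarrow> E \<in> tetragonal_class"
  "E \<in> stratum (dihedral 3) \<Longrightarrow> E \<in> trigonal_class \<and> K4 E \<noteq> 0 \<or> E \<in> tetragonal_class \<and> K4 E = 0"
proof -
  show "E \<in> stratum (carrier SO3) \<Longrightarrow> E \<in> tetragonal_class \<and> K4 E = 0"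
    using stratum_tetragonal_class[of E "carrier SO3"]
    by (simp add: rotation_rot_e1 rotation_rot_e3 rotation_cyclic_perm)
  show "E \<in> stratum octahedral \<Longrightarrow> E \<in> tetragonal_class \<and> K4 E = 0"
    using stratum_tetragonal_class octahedral_members by blast
  show "E \<in> stratum O2 \<Longrightarrow> E \<in> tetragonal_class"
    using stratum_tetragonal_class(1) rot_in_O2 by blast
  show "E \<in> stratum O2 \<Longrightarrow> E \<in> trigonal_class \<and> K4 E \<noteq> 0 \<or> E \<in> tetragonal_class \<and> K4 E = 0"
    using stratum_trigonal_class rot_in_O2 by blast
  show "E \<in> stratum (dihedral 4) \<Longrightarrow> E \<in> tetragonal_class"
    using stratum_tetragonal_class(1)[of E "dihedral 4"] rot_in_dihedral[of 4] by simp
  show "E \<in> stratum (dihedral 3) \<Longrightarrow> E \<in> trigonal_class \<and> K4 E \<noteq> 0 \<or> E \<in> tetragonal_class \<and> K4 E = 0"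
    using stratum_trigonal_class[of E "dihedral 3"] rot_in_dihedral[of 3] by simp
qed

section \<open>Minimality\<close>

lemma all_less_7:
  "(\<forall>j<7. P j) \<longleftrightarrow> P 0 \<and> P 1 \<and> P 2 \<and> P 3 \<and> P 4 \<and> P 5 \<and> P (6::nat)"
  by (auto simp: numeral_eq_Suc All_less_Suc)

lemma separates_only_append:
  assumes "separates_only (\<phi>s @ \<psi>s) i x y"
  shows "separates_only \<phi>s i x y"
  unfolding separates_only_def
proof (intro allI impI)
  fix j assume j: "j < length \<phi>s"
  then have "j < length (\<phi>s @ \<psi>s)" by simp
  with assms have "((\<phi>s @ \<psi>s)!j) x = ((\<phi>s @ \<psi>s)!j) y \<longleftrightarrow> j \<noteq> i"
    unfolding separates_only_def by blast
  then show "(\<phi>s!j) x = (\<phi>s!j) y \<longleftrightarrow> j \<noteq> i"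
    using j by (simp add: nth_append)
qed

lemma tetragonal_witnessI:
  assumes "\<beta> \<noteq> 0" "axial_magnitude \<delta> \<nu> ((4 * \<beta>\<^sup>2 - 100 * \<alpha>\<^sup>2) / 3) \<noteq> 0"
    and "\<beta>' \<noteq> 0" "axial_magnitude \<delta>' \<nu>' ((4 * \<beta>'\<^sup>2 - 100 * \<alpha>'\<^sup>2) / 3) \<noteq> 0"
    and "separates_only \<phi>s i (normal_form tetragonal k l \<delta> \<nu> \<alpha> \<beta>) (normal_form tetragonal k' l' \<delta>' \<nu>' \<alpha>' \<beta>')"
  shows "\<exists>x\<in>stratum (dihedral 4). \<exists>y\<in>stratum (dihedral 4). separates_only \<phi>s i x y"
  using assms tetragonal_in_stratum by blast

text \<open>
  The third pair (position 2) has the same \<open>\<alpha>\<close> and opposite values of \<open>4 \<beta>\<^sup>2 - 100 \<alpha>\<^sup>2\<close>, so only \<open>I3\<close> changes.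
  In the last pair \<open>4 \<beta>\<^sup>2 - 100 \<alpha>\<^sup>2\<close> is again reversed, and \<open>\<beta>\<close> is chosen so that \<open>I3 = 6400\<close> for both
  values of \<open>\<alpha>\<close>. All these tensors have \<open>K10 = 0\<close>.
\<close>

lemma tetragonal_witnesses:
  assumes "i < 7"
  shows "\<exists>x\<in>stratum (dihedral 4). \<exists>y\<in>stratum (dihedral 4). separates_only (seven @ [K10]) i x y"
proof -
  note vals = separates_only_def All_less_Suc axial_magnitude_def tetragonal_invariants power_divide
  have "\<forall>i<7. \<exists>x\<in>stratum (dihedral 4). \<exists>y\<in>stratum (dihedral 4). separates_only (seven @ [K10]) i x y"
    (is "\<forall>i<7. ?P i")
    unfolding all_less_7
  proof (intro conjI)
    show "?P 0"
      by (rule tetragonal_witnessI[where k = 1 and l = 0 and \<delta> = 0 and \<nu> = 0 and \<alpha> = 0 and \<beta> = 1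
          and k' = 0 and l' = 0 and \<delta>' = 0 and \<nu>' = 0 and \<alpha>' = 0 and \<beta>' = 1])
        (simp_all add: vals)
    show "?P 1"
      by (rule tetragonal_witnessI[where k = 0 and l = 1 and \<delta> = 0 and \<nu> = 0 and \<alpha> = 0 and \<beta> = 1
          and k' = 0 and l' = 0 and \<delta>' = 0 and \<nu>' = 0 and \<alpha>' = 0 and \<beta>' = 1])
        (simp_all add: vals)
    show "?P 2"
      by (rule tetragonal_witnessI[where k = 0 and l = 0 and \<delta> = 0 and \<nu> = 0 and \<alpha> = 1 and \<beta> = 1
          and k' = 0 and l' = 0 and \<delta>' = 0 and \<nu>' = 0 and \<alpha>' = 1 and \<beta>' = 7])
        (simp_all add: vals)
    show "?P 3"
      by (rule tetragonal_witnessI[where k = 0 and l = 0 and \<delta> = 0 and \<nu> = 0 and \<alpha> = 0 and \<beta> = 1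
          and k' = 0 and l' = 0 and \<delta>' = 0 and \<nu>' = 0 and \<alpha>' = 0 and \<beta>' = 2])
        (simp_all add: vals)
    show "?P 4"
      by (rule tetragonal_witnessI[where k = 0 and l = 0 and \<delta> = 1 and \<nu> = 0 and \<alpha> = 0 and \<beta> = 1
          and k' = 0 and l' = 0 and \<delta>' = "-1" and \<nu>' = 0 and \<alpha>' = 0 and \<beta>' = 1])
        (simp_all add: vals)
    show "?P 5"
      by (rule tetragonal_witnessI[where k = 0 and l = 0 and \<delta> = 0 and \<nu> = 1 and \<alpha> = 0 and \<beta> = 1
          and k' = 0 and l' = 0 and \<delta>' = 0 and \<nu>' = "-1" and \<alpha>' = 0 and \<beta>' = 1])
        (simp_all add: vals)
    show "?P 6"
      by (rule tetragonal_witnessI[where k = 0 and l = 0 and \<delta> = 0 and \<nu> = 0 and \<alpha> = 1 and \<beta> = "sqrt (355 / 3)"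
          and k' = 0 and l' = 0 and \<delta>' = 0 and \<nu>' = 0 and \<alpha>' = 2 and \<beta>' = "sqrt (20 / 3)"])
        (simp_all add: vals)
  qed
  with assms show ?thesis by blast
qed

lemma trigonal_witnessI:
  assumes "\<beta> \<noteq> 0" "axial_magnitude \<delta> \<nu> ((2 * \<beta>\<^sup>2 - 100 * \<alpha>\<^sup>2) / 3) \<noteq> 0"
    and "\<beta>' \<noteq> 0" "axial_magnitude \<delta>' \<nu>' ((2 * \<beta>'\<^sup>2 - 100 * \<alpha>'\<^sup>2) / 3) \<noteq> 0"
    and "separates_only \<phi>s i (normal_form trigonal k l \<delta> \<nu> \<alpha> \<beta>) (normal_form trigonal k' l' \<delta>' \<nu>' \<alpha>' \<beta>')"
  shows "\<exists>x\<in>stratum (dihedral 3). \<exists>y\<in>stratum (dihedral 3). separates_only \<phi>s i x y"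
  using assms trigonal_in_stratum by blast

text \<open>
  The pairs follow the same pattern. In the last one \<open>I3\<close> vanishes, once because \<open>\<alpha> = 0\<close> and once
  because \<open>\<beta>\<^sup>2 = 5 \<alpha>\<^sup>2\<close>.
\<close>

lemma trigonal_witnesses:
  assumes "i < 7"
  shows "\<exists>x\<in>stratum (dihedral 3). \<exists>y\<in>stratum (dihedral 3). separates_only seven i x y"
proof -
  note vals = separates_only_def All_less_Suc axial_magnitude_def trigonal_invariants power_divide
  have "\<forall>i<7. \<exists>x\<in>stratum (dihedral 3). \<exists>y\<in>stratum (dihedral 3). separates_only seven i x y"
    (is "\<forall>i<7. ?P i")
    unfolding all_less_7
  proof (intro conjI)
    show "?P 0"
      by (rule trigonal_witnessI[where k = 1 and l = 0 and \<delta> = 0 and \<nu> = 0 and \<alpha> = 0 and \<beta> = 1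
          and k' = 0 and l' = 0 and \<delta>' = 0 and \<nu>' = 0 and \<alpha>' = 0 and \<beta>' = 1])
        (simp_all add: vals)
    show "?P 1"
      by (rule trigonal_witnessI[where k = 0 and l = 1 and \<delta> = 0 and \<nu> = 0 and \<alpha> = 0 and \<beta> = 1
          and k' = 0 and l' = 0 and \<delta>' = 0 and \<nu>' = 0 and \<alpha>' = 0 and \<beta>' = 1])
        (simp_all add: vals)
    show "?P 2"
      by (rule trigonal_witnessI[where k = 0 and l = 0 and \<delta> = 0 and \<nu> = 0 and \<alpha> = 1 and \<beta> = 6
          and k' = 0 and l' = 0 and \<delta>' = 0 and \<nu>' = 0 and \<alpha>' = 1 and \<beta>' = 8])
        (simp_all add: vals)
    show "?P 3"
      by (rule trigonal_witnessI[where k = 0 and l = 0 and \<delta> = 0 and \<nu> = 0 and \<alpha> = 0 and \<beta> = 1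
          and k' = 0 and l' = 0 and \<delta>' = 0 and \<nu>' = 0 and \<alpha>' = 0 and \<beta>' = 2])
        (simp_all add: vals)
    show "?P 4"
      by (rule trigonal_witnessI[where k = 0 and l = 0 and \<delta> = 1 and \<nu> = 0 and \<alpha> = 0 and \<beta> = 1
          and k' = 0 and l' = 0 and \<delta>' = "-1" and \<nu>' = 0 and \<alpha>' = 0 and \<beta>' = 1])
        (simp_all add: vals)
    show "?P 5"
      by (rule trigonal_witnessI[where k = 0 and l = 0 and \<delta> = 0 and \<nu> = 1 and \<alpha> = 0 and \<beta> = 1
          and k' = 0 and l' = 0 and \<delta>' = 0 and \<nu>' = "-1" and \<alpha>' = 0 and \<beta>' = 1])
        (simp_all add: vals)
    show "?P 6"
      by (rule trigonal_witnessI[where k = 0 and l = 0 and \<delta> = 0 and \<nu> = 0 and \<alpha> = 0 and \<beta> = "sqrt 45"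
          and k' = 0 and l' = 0 and \<delta>' = 0 and \<nu>' = 0 and \<alpha>' = 1 and \<beta>' = "sqrt 5"])
        (simp_all add: vals)
  qed
  with assms show ?thesis by blast
qed

text \<open>
  With \<open>\<alpha> = 0\<close> both \<open>I3\<close> and \<open>K9\<close> vanish, and \<open>2 \<beta>\<^sup>2\<close> on the trigonal side equals \<open>4 \<beta>\<^sup>2\<close> on the
  tetragonal side, so the values of \<open>K4\<close> agree.
\<close>

lemma K10_witness:
  "\<exists>x\<in>stratum (dihedral 3). \<exists>y\<in>stratum (dihedral 4). separates_only (seven @ [K10]) 7 x y"
proof (intro bexI)
  show "separates_only (seven @ [K10]) 7 (normal_form trigonal 0 0 0 0 0 (sqrt 2)) (normal_form tetragonal 0 0 0 0 0 1)"
    by (simp add: separates_only_def All_less_Suc trigonal_invariants tetragonal_invariants axial_magnitude_def power_divide)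
  show "normal_form trigonal 0 0 0 0 0 (sqrt 2) \<in> stratum (dihedral 3)"
    by (rule trigonal_in_stratum) (simp_all add: axial_magnitude_def)
  show "normal_form tetragonal 0 0 0 0 0 1 \<in> stratum (dihedral 4)"
    by (rule tetragonal_in_stratum) (simp_all add: axial_magnitude_def)
qed

lemma SO3_invariant_all:
  "\<phi> \<in> set (seven @ [K10]) \<Longrightarrow> SO3_invariant X \<phi>"
  unfolding SO3_invariant_def using invariants by auto

theorem theorem7p1:
  shows "(\<forall>\<phi> \<in> {K1, L1, I3, K4, K5, L5, K9, K10}. real_polynomial_function \<phi>) \<and>
    minimal_functional_basis
      (stratum (carrier SO3) \<union> stratum octahedral \<union> stratum O2 \<union> stratum (dihedral 4))
      [K1, L1, I3, K4, K5, L5, K9] \<and>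
    minimal_functional_basis
      (stratum (carrier SO3) \<union> stratum octahedral \<union> stratum O2 \<union> stratum (dihedral 3))
      [K1, L1, I3, K4, K5, L5, K9] \<and>
    minimal_functional_basis
      (stratum (carrier SO3) \<union> stratum octahedral \<union> stratum O2
        \<union> stratum (dihedral 3) \<union> stratum (dihedral 4))
      [K1, L1, I3, K4, K5, L5, K9, K10]"
proof (intro conjI)
  show "\<forall>\<phi> \<in> {K1, L1, I3, K4, K5, L5, K9, K10}. real_polynomial_function \<phi>"
    by (rule all_polynomial)
next
  let ?X = "stratum (carrier SO3) \<union> stratum octahedral \<union> stratum O2 \<union> stratum (dihedral 4)"
  show "minimal_functional_basis ?X seven"
  proof (rule minimal_functional_basisI)
    show "functional_basis ?X seven"
    proof (rule functional_basisI)
      fix x y assume "x \<in> ?X" "y \<in> ?X" and eq: "\<And>\<phi>. \<phi> \<in> set seven \<Longrightarrow> \<phi> x = \<phi> y"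
      then have "x \<in> tetragonal_class" "y \<in> tetragonal_class" using stratum_classes by blast+
      from tetragonal_class_separation[OF this eq]
      show "\<exists>g. rotation_matrix g \<and> act g x = y" by (simp add: same_orbit_def)
    next
      show "SO3_invariant ?X \<phi>" if "\<phi> \<in> set seven" for \<phi>
        using that by (intro SO3_invariant_all) auto
    qed (intro SO3_stable_Un stratum_stable)
  next
    fix i assume "i < length seven"
    then have "i < 7" by simp
    from tetragonal_witnesses[OF this]
    show "\<exists>x\<in>?X. \<exists>y\<in>?X. separates_only seven i x y"
      using separates_only_append[of seven "[K10]"] by blast
  qed
next
  let ?X = "stratum (carrier SO3) \<union> stratum octahedral \<union> stratum O2 \<union> stratum (dihedral 3)"
  show "minimal_functional_basis ?X seven"
  proof (rule minimal_functional_basisI)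
    show "functional_basis ?X seven"
    proof (rule functional_basisI)
      fix x y assume x: "x \<in> ?X" and y: "y \<in> ?X" and eq: "\<And>\<phi>. \<phi> \<in> set seven \<Longrightarrow> \<phi> x = \<phi> y"
      have c: "z \<in> trigonal_class \<and> K4 z \<noteq> 0 \<or> z \<in> tetragonal_class \<and> K4 z = 0" if "z \<in> ?X" for z
        using that stratum_classes by blast
      have "K4 x = K4 y" using eq[of K4] by simp
      then have "x \<in> trigonal_class \<and> y \<in> trigonal_class \<or> x \<in> tetragonal_class \<and> y \<in> tetragonal_class"
        using c[OF x] c[OF y] by argo
      then have "same_orbit x y"
        using trigonal_class_separation[of x y] tetragonal_class_separation[of x y] eq by blast
      then show "\<exists>g. rotation_matrix g \<and> act g x = y" by (simp add: same_orbit_def)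
    next
      show "SO3_invariant ?X \<phi>" if "\<phi> \<in> set seven" for \<phi>
        using that by (intro SO3_invariant_all) auto
    qed (intro SO3_stable_Un stratum_stable)
  next
    fix i assume "i < length seven"
    then have "i < 7" by simp
    from trigonal_witnesses[OF this]
    show "\<exists>x\<in>?X. \<exists>y\<in>?X. separates_only seven i x y" by blast
  qed
next
  let ?X = "stratum (carrier SO3) \<union> stratum octahedral \<union> stratum O2
        \<union> stratum (dihedral 3) \<union> stratum (dihedral 4)"
  show "minimal_functional_basis ?X [K1, L1, I3, K4, K5, L5, K9, K10]"
  proof (rule minimal_functional_basisI)
    show "functional_basis ?X [K1, L1, I3, K4, K5, L5, K9, K10]"
    proof (rule functional_basisI)
      fix x y assume x: "x \<in> ?X" and y: "y \<in> ?X"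
        and eq: "\<And>\<phi>. \<phi> \<in> set [K1, L1, I3, K4, K5, L5, K9, K10] \<Longrightarrow> \<phi> x = \<phi> y"
      have c: "z \<in> tetragonal_class \<or> z \<in> trigonal_class \<and> K10 z \<noteq> 0" if "z \<in> ?X" for z
        using that stratum_classes trigonal_class_K10 by blast
      have "K10 x = K10 y" using eq[of K10] by simp
      then have "x \<in> trigonal_class \<and> y \<in> trigonal_class \<or> x \<in> tetragonal_class \<and> y \<in> tetragonal_class"
        using c[OF x] c[OF y] tetragonal_class_K10[of x] tetragonal_class_K10[of y] by argo
      moreover have "\<And>\<phi>. \<phi> \<in> set seven \<Longrightarrow> \<phi> x = \<phi> y" using eq by auto
      ultimately have "same_orbit x y"
        using trigonal_class_separation[of x y] tetragonal_class_separation[of x y] by blast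
      then show "\<exists>g. rotation_matrix g \<and> act g x = y" by (simp add: same_orbit_def)
    next
      show "SO3_invariant ?X \<phi>" if "\<phi> \<in> set [K1, L1, I3, K4, K5, L5, K9, K10]" for \<phi>
        using that by (intro SO3_invariant_all) auto
    qed (intro SO3_stable_Un stratum_stable)
  next
    fix i assume "i < length [K1, L1, I3, K4, K5, L5, K9, K10]"
    then have "i < 7 \<or> i = 7" by (simp add: less_Suc_eq) linarith
    then have "\<exists>x\<in>?X. \<exists>y\<in>?X. separates_only (seven @ [K10]) i x y"
      using tetragonal_witnesses[of i] K10_witness by blast
    then show "\<exists>x\<in>?X. \<exists>y\<in>?X. separates_only [K1, L1, I3, K4, K5, L5, K9, K10] i x y" by simp
  qed
qed

end
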